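(* Consider the unidirectionally coupled stochastic system $$\mathrm{d}\psi=kL\psi\,\mathrm{d}t+(\alpha_i-\sin\psi_i)_{i=1}^N\,\mathrm{d}t+(\epsilon_i\,\mathrm{d}W_i(t))_{i=1}^N$$ (see context). If the coupling coefficient $k$ is sufficiently large, then this system admits a dynamical order, i.e., it admits a simple asymptotic one-dimensional structure which is totally ordered with respect to the standard order "$\le$" in $\mathbb{R}^N$.
   Context: **Stochastic system.** $N\ge 2$ is the number of oscillators, $k>0$ is the coupling coefficient, $\alpha_i\in\mathbb{R}$ are input frequencies and $\epsilon_i>0$ are perturbation coefficients ($1\le i\le N$). $\psi=(\psi_1,\dots,\psi_N)^\top$ is the vector of angular variables. $L$ is the $N\times N$ matrix with $L_{11}=0$, $L_{ii}=-1$ and $L_{i,i-1}=1$ for $2\le i\le N$, all other entries $0$. $(W_i)_{i=1}^N$ is the standard $N$-dimensional Brownian motion (two-sided in time). **Order.** The standard order on $\mathbb{R}^N$ is $x\le y\iff y-x\in\mathbb{R}^N_+$, where $\mathbb{R}^N_+$ is the nonnegative orthant. A nonempty set $B\subset\mathbb{R}^N$ is totally ordered with respect to "$\le$" if $x_1-x_2\in\mathbb{R}^N_+\cup(-\mathbb{R}^N_+)$ for any two distinct points $x_1,x_2\in B$. A random set is called one-dimensional if each of its fibers (its value at each $\omega$) is a one-dimensional topological manifold. **Terminology.** "Dynamical order" is a descriptive term combining two features of the long-time dynamics: (a) a simple asymptotic one-dimensional structure, meaning that the global random attractor (described next) has a one-dimensional topological structure; (b) a total order structure with respect to "$\le$"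 in $\mathbb{R}^N$. The attractor meant here arises as follows. Let $\mathrm{d}z_i+z_i\,\mathrm{d}t=\epsilon_i\,\mathrm{d}W_i$ have stationary solution $z_i(\theta_t\omega)$ ($\theta_t$ the Wiener shift on the path space $\Omega$), and put $z=(z_1,\dots,z_N)^\top$. The substitution $\phi=\psi-z(\theta_t\omega)$ turns the stochastic system into a system of random differential equations generating a $C^1$-random dynamical system $\phi$ on $\mathbb{R}^N$ with $\phi(t,\phi_0+2\pi\mathbf{e},\omega)=\phi(t,\phi_0,\omega)+2\pi\mathbf{e}$, $\mathbf{e}=(1,\dots,1)^\top$. It therefore induces a random dynamical system $\Phi(t,\phi_0\bmod 2\pi\mathbf{e},\omega)=\phi(t,\phi_0,\omega)\bmod 2\pi\mathbf{e}$ on the quotient manifold $M=\mathbb{R}^N/\mathbb{Z}\cdot2\pi\mathbf{e}$ (diffeomorphic to $\mathbb{S}^1\times\mathbb{R}^{N-1}$). The global random attractor is that of $\Phi$: the tempered invariant random compact set in $M$ attracting, in the pull-back sense, all tempered random sets in $M$. The total order refers to its unwrapping from $M$ to $\mathbb{R}^N$. *)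

theory Defs
  imports "HOL-Probability.Probability"
begin

section \<open>The quotient manifold\<close>

definition ones :: "real ^ 'n::finite" where
  "ones = (\<chi> i. 1)"

definition period_rel :: "real ^ 'n::finite \<Rightarrow> real ^ 'n \<Rightarrow> bool" where
  "period_rel x y \<longleftrightarrow> (\<exists>m::int. y = x + (2 * pi * of_int m) *\<^sub>R ones)"

lemma period_rel_equivp: "equivp (period_rel :: real ^ 'n::finite \<Rightarrow> _)"
proof (rule equivpI)
  show "reflp (period_rel :: real ^ 'n \<Rightarrow> _)"
    unfolding period_rel_def by (auto intro!: reflpI exI[of _ 0])
  show "symp (period_rel :: real ^ 'n \<Rightarrow> _)"
  proof (rule sympI)
    fix x y :: "real ^ 'n" assume "period_rel x y"
    then obtain m where "y = x + (2 * pi * of_int m) *\<^sub>R ones" by (auto simp: period_rel_def)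
    then have "x = y + (2 * pi * of_int (-m)) *\<^sub>R ones" by simp
    then show "period_rel y x" unfolding period_rel_def by blast
  qed
  show "transp (period_rel :: real ^ 'n \<Rightarrow> _)"
  proof (rule transpI)
    fix x y z :: "real ^ 'n" assume "period_rel x y" "period_rel y z"
    then obtain m l where "y = x + (2 * pi * of_int m) *\<^sub>R ones"
      "z = y + (2 * pi * of_int l) *\<^sub>R ones" by (auto simp: period_rel_def)
    then have "z = x + (2 * pi * of_int (m + l)) *\<^sub>R ones" by (simp add: algebra_simps)
    then show "period_rel x z" unfolding period_rel_def by blast
  qed
qed

text \<open>
  The type of points of \<open>M = \<real>\<^sup>N / \<int> \<cdot> 2\<pi>e\<close>; \<open>wrap\<close> is the projection
  \<open>x \<mapsto> x mod 2\<pi>e\<close>.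
\<close>

quotient_type (overloaded) 'n cyl = "real ^ ('n::finite)" / period_rel
  morphisms rep_cyl wrap
  by (rule period_rel_equivp)

lemma wrap_eq_iff: "wrap x = wrap y \<longleftrightarrow> period_rel x y"
  by (rule cyl.abs_eq_iff)

lemma wrap_surj: "\<exists>x. wrap x = p"
  by (metis Quotient_cyl Quotient_abs_rep)

text \<open>
  The translation group acts by isometries, so the distance of two classes is the infimum of
  the Euclidean distances of their representatives.  It is the distance of the flat Riemannian
  metric, and it induces the quotient topology.
\<close>

instantiation cyl :: (finite) metric_space
begin

definition dist_cyl :: "'a cyl \<Rightarrow> 'a cyl \<Rightarrow> real" where
  "dist_cyl p q = Inf {dist x y | x y. wrap x = p \<and> wrap y = q}"

definition uniformity_cyl :: "('a cyl \<times> 'a cyl) filter" where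
  "uniformity_cyl = (INF e\<in>{0 <..}. principal {(x, y). dist x y < e})"

definition open_cyl :: "'a cyl set \<Rightarrow> bool" where
  "open_cyl U \<longleftrightarrow> (\<forall>x\<in>U. \<forall>\<^sub>F (x', y) in uniformity. x' = x \<longrightarrow> y \<in> U)"

lemma dist_wrap_ex:
  fixes x y :: "real ^ 'a"
  assumes "dist (wrap x) (wrap y) < d"
  shows "\<exists>m::int. norm (x - y + (2 * pi * of_int m) *\<^sub>R ones) < d"
proof -
  let ?S = "{dist u v | u v. wrap u = wrap x \<and> wrap v = wrap y}"
  have "?S \<noteq> {}" by blast
  moreover have "Inf ?S < d" using assms by (simp add: dist_cyl_def)
  ultimately obtain s where "s \<in> ?S" "s < d" by (rule cInf_lessD[THEN bexE])
  then obtain u v where "s = dist u v" "wrap u = wrap x" "wrap v = wrap y" by blast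
  with \<open>s < d\<close> have uv: "wrap x = wrap u" "wrap y = wrap v" "dist u v < d" by simp_all
  then obtain a b where "u = x + (2 * pi * of_int a) *\<^sub>R ones" "v = y + (2 * pi * of_int b) *\<^sub>R ones"
    unfolding wrap_eq_iff period_rel_def by blast
  then have "u - v = x - y + (2 * pi * of_int (a - b)) *\<^sub>R ones" by (simp add: algebra_simps)
  then show ?thesis using uv(3) by (metis dist_norm)
qed

lemma dist_wrap_le:
  fixes x y :: "real ^ 'a"
  shows "dist (wrap x) (wrap y) \<le> norm (x - y + (2 * pi * of_int m) *\<^sub>R ones)"
proof -
  let ?u = "x + (2 * pi * of_int m) *\<^sub>R ones"
  have "wrap ?u = wrap x" by (metis wrap_eq_iff period_rel_def)
  then have "dist ?u y \<in> {dist u v | u v. wrap u = wrap x \<and> wrap v = wrap y}" by blast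
  moreover have "bdd_below {dist u v | u v. wrap u = wrap x \<and> wrap v = wrap y}"
    by (rule bdd_belowI[of _ 0]) auto
  ultimately have "dist (wrap x) (wrap y) \<le> dist ?u y"
    unfolding dist_cyl_def by (rule cInf_lower)
  then show ?thesis by (simp add: dist_norm algebra_simps)
qed

instance
proof
  fix p q r :: "'a cyl"
  obtain x y z where xyz: "p = wrap x" "q = wrap y" "r = wrap z" by (metis wrap_surj)
  show "dist p q = 0 \<longleftrightarrow> p = q"
  proof
    assume "p = q"
    have "0 \<le> dist p q"
      unfolding dist_cyl_def by (rule cInf_greatest) (auto simp: xyz)
    moreover have "dist p q \<le> 0"
      using dist_wrap_le[of x x 0] \<open>p = q\<close> xyz by simp
    ultimately show "dist p q = 0" by simp
  next
    assume d0: "dist p q = 0"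
    let ?v = "\<lambda>m::int. x - y + (2 * pi * of_int m) *\<^sub>R ones"
    let ?c = "norm (ones :: real ^ 'a)"
    have "(ones :: real ^ 'a) \<noteq> 0" by (simp add: ones_def vec_eq_iff)
    then have c: "?c > 0" by simp
    obtain m where m: "norm (?v m) < pi * ?c"
      using dist_wrap_ex[of x y "pi * ?c"] d0 c xyz by auto
    have "?v m = 0"
    proof (rule ccontr)
      assume "?v m \<noteq> 0"
      then obtain l where l: "norm (?v l) < norm (?v m)"
        using dist_wrap_ex[of x y "norm (?v m)"] d0 xyz by auto
      then have "l \<noteq> m" by auto
      then have "1 \<le> \<bar>of_int (l - m) :: real\<bar>" by linarith
      then have "2 * pi * ?c \<le> 2 * pi * \<bar>of_int (l - m)\<bar> * ?c" using c by simp
      also have "\<dots> = norm (?v l - ?v m)"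
      proof -
        have "?v l - ?v m = (2 * pi * of_int (l - m)) *\<^sub>R ones" by (simp add: algebra_simps)
        then show ?thesis by (simp add: abs_mult)
      qed
      also have "\<dots> \<le> norm (?v l) + norm (?v m)" by (rule norm_triangle_ineq4)
      finally show False using l m by simp
    qed
    then have "y = x + (2 * pi * of_int m) *\<^sub>R ones" by (simp add: algebra_simps)
    then show "p = q" by (auto simp: xyz wrap_eq_iff period_rel_def)
  qed
  show "dist p q \<le> dist p r + dist q r"
  proof (rule field_le_epsilon)
    fix e :: real assume "e > 0"
    obtain a where a: "norm (x - z + (2 * pi * of_int a) *\<^sub>R ones) < dist p r + e / 2"
      using dist_wrap_ex[of x z "dist p r + e / 2"] \<open>e > 0\<close> xyz by auto
    obtain b where b: "norm (y - z + (2 * pi * of_int b) *\<^sub>R ones) < dist q r + e / 2"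
      using dist_wrap_ex[of y z "dist q r + e / 2"] \<open>e > 0\<close> xyz by auto
    have "dist p q \<le> norm (x - y + (2 * pi * of_int (a - b)) *\<^sub>R ones)"
      unfolding xyz by (rule dist_wrap_le)
    also have "\<dots> = norm ((x - z + (2 * pi * of_int a) *\<^sub>R ones)
        - (y - z + (2 * pi * of_int b) *\<^sub>R ones))" by (simp add: algebra_simps)
    also have "\<dots> \<le> norm (x - z + (2 * pi * of_int a) *\<^sub>R ones)
        + norm (y - z + (2 * pi * of_int b) *\<^sub>R ones)" by (rule norm_triangle_ineq4)
    finally show "dist p q \<le> dist p r + dist q r + e" using a b by simp
  qed
qed (simp_all only: uniformity_cyl_def open_cyl_def)

end


section \<open>Two-sided Brownian motion on the path space\<close>

type_synonym 'n path = "real \<Rightarrow> real ^ 'n"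

definition wiener_paths :: "('n::finite) path set" where
  "wiener_paths = {\<omega>. continuous_on UNIV \<omega> \<and> \<omega> 0 = 0}"

text \<open>
  The sigma-algebra generated by the evaluations; on \<^const>\<open>wiener_paths\<close> it is the Borel
  sigma-algebra of the compact-open topology.
\<close>

definition path_algebra :: "('n::finite) path measure" where
  "path_algebra = restrict_space (Pi\<^sub>M UNIV (\<lambda>_. borel)) wiener_paths"

text \<open>
  Under \<open>P\<close> the coordinate process \<open>W t \<omega> = \<omega> t\<close> is a standard two-sided Brownian motion:
  the coordinates of increments over consecutive intervals of the whole time axis form one
  independent family, and each is centred Gaussian with the length of the interval as variance.
\<close>

definition wiener_measure :: "('n::finite) path measure \<Rightarrow> bool" where
  "wiener_measure P \<longleftrightarrow>
     prob_space P \<and> sets P = sets path_algebra \<and>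
     (\<forall>s t i. s < t \<longrightarrow>
        distributed P lborel (\<lambda>\<omega>. (\<omega> t - \<omega> s) $ i) (normal_density 0 (sqrt (t - s)))) \<and>
     (\<forall>(n::nat) (T::nat \<Rightarrow> real). strict_mono_on {..n} T \<longrightarrow>
        prob_space.indep_vars P (\<lambda>_. borel)
          (\<lambda>(j, i) \<omega>. (\<omega> (T (Suc j)) - \<omega> (T j)) $ i) ({..<n} \<times> UNIV))"

definition shift :: "real \<Rightarrow> ('n::finite) path \<Rightarrow> 'n path" where
  "shift t \<omega> = (\<lambda>s. \<omega> (t + s) - \<omega> t)"


section \<open>The stochastic system and its random dynamical system\<close>

type_synonym 'n rvec = "(real, 'n) vec"

text \<open>The position of an index in its finite linear order plays the role of the labels \<open>1, \<dots>, N\<close>.\<close>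

definition coupling :: "real ^ ('n::{finite,linorder}) ^ ('n::{finite,linorder})" where
  "coupling = (\<chi> i j. if i = Min UNIV then 0
                      else if j = i then -1
                      else if j = Max {l. l < i} then 1
                      else 0)"

definition drift :: "real \<Rightarrow> ('n::{finite,linorder}) rvec \<Rightarrow> 'n rvec \<Rightarrow> 'n rvec" where
  "drift k \<alpha> x = k *\<^sub>R (coupling *v x) + (\<chi> i. \<alpha> $ i - sin (x $ i))"

definition noise :: "real ^ ('n::finite) \<Rightarrow> real ^ 'n \<Rightarrow> real ^ 'n" where
  "noise \<epsilon> w = (\<chi> i. \<epsilon> $ i * w $ i)"

text \<open>The noise is additive, so the stochastic system is solved path by path in integrated form.\<close>

definition sde_solution ::
    "real \<Rightarrow> ('n::{finite,linorder}) rvec \<Rightarrow> 'n rvec \<Rightarrow> 'n path \<Rightarrow> (real \<Rightarrow> 'n rvec) \<Rightarrow> bool" where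
  "sde_solution k \<alpha> \<epsilon> \<omega> \<psi> \<longleftrightarrow>
     continuous_on {0..} \<psi> \<and>
     (\<forall>t\<ge>0. ((\<lambda>s. drift k \<alpha> (\<psi> s)) has_integral (\<psi> t - \<psi> 0 - noise \<epsilon> (\<omega> t))) {0..t})"

text \<open>\<open>t \<mapsto> z (\<theta>\<^sub>t \<omega>)\<close> solves \<open>dz\<^sub>i + z\<^sub>i dt = \<epsilon>\<^sub>i dW\<^sub>i\<close> on the whole time axis.\<close>

definition stationary_ou ::
    "('n::finite) path measure \<Rightarrow> real ^ 'n \<Rightarrow> ('n path \<Rightarrow> real ^ 'n) \<Rightarrow> bool" where
  "stationary_ou P \<epsilon> z \<longleftrightarrow>
     z \<in> borel_measurable P \<and>
     (AE \<omega> in P. continuous_on UNIV (\<lambda>t. z (shift t \<omega>)) \<and>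
        (\<forall>s t. s \<le> t \<longrightarrow>
           ((\<lambda>r. z (shift r \<omega>)) has_integral
              (noise \<epsilon> (\<omega> t - \<omega> s) - (z (shift t \<omega>) - z (shift s \<omega>)))) {s..t}))"

text \<open>The random differential equation for \<open>u t = \<psi> t - z (\<theta>\<^sub>t \<omega>)\<close>.\<close>

definition rde_solution ::
    "real \<Rightarrow> ('n::{finite,linorder}) rvec \<Rightarrow> ('n path \<Rightarrow> 'n rvec) \<Rightarrow> 'n path \<Rightarrow>
       (real \<Rightarrow> 'n rvec) \<Rightarrow> bool" where
  "rde_solution k \<alpha> z \<omega> u \<longleftrightarrow>
     (\<forall>t\<ge>0. (u has_vector_derivative
               (drift k \<alpha> (u t + z (shift t \<omega>)) + z (shift t \<omega>))) (at t within {0..}))"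

definition C1_rds ::
    "('n::finite) path measure \<Rightarrow> (real \<Rightarrow> real ^ 'n \<Rightarrow> 'n path \<Rightarrow> real ^ 'n) \<Rightarrow> bool" where
  "C1_rds P \<phi> \<longleftrightarrow>
     (\<lambda>(t, x, \<omega>). \<phi> t x \<omega>)
        \<in> borel_measurable (restrict_space borel {0..} \<Otimes>\<^sub>M (borel \<Otimes>\<^sub>M P)) \<and>
     (\<forall>\<omega>\<in>space P.
        (\<forall>x. \<phi> 0 x \<omega> = x) \<and>
        (\<forall>s\<ge>0. \<forall>t\<ge>0. \<forall>x. \<phi> (t + s) x \<omega> = \<phi> t (\<phi> s x \<omega>) (shift s \<omega>)) \<and>
        continuous_on ({0..} \<times> UNIV) (\<lambda>(t, x). \<phi> t x \<omega>) \<and>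
        (\<exists>J :: real \<Rightarrow> real ^ 'n \<Rightarrow> real ^ 'n ^ 'n.
           (\<forall>t\<ge>0. \<forall>x. ((\<lambda>y. \<phi> t y \<omega>) has_derivative (\<lambda>h. J t x *v h)) (at x)) \<and>
           continuous_on ({0..} \<times> UNIV) (\<lambda>(t, x). J t x)))"


section \<open>Random attractors on the quotient manifold\<close>

definition random_set :: "('n::finite) path measure \<Rightarrow> ('n path \<Rightarrow> 'n cyl set) \<Rightarrow> bool" where
  "random_set P D \<longleftrightarrow>
     (\<forall>\<omega>\<in>space P. D \<omega> \<noteq> {}) \<and> (\<forall>p. (\<lambda>\<omega>. infdist p (D \<omega>)) \<in> borel_measurable P)"

text \<open>
  The choice of the base point is immaterial, and suprema are taken in \<^typ>\<open>ennreal\<close>,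
  so that an unbounded fibre has infinite size.
\<close>

definition tempered :: "('n::finite) path measure \<Rightarrow> ('n path \<Rightarrow> 'n cyl set) \<Rightarrow> bool" where
  "tempered P D \<longleftrightarrow>
     (AE \<omega> in P. \<forall>\<gamma>>0.
        ((\<lambda>t. ennreal (exp (- \<gamma> * t)) * (SUP p\<in>D (shift (- t) \<omega>). ennreal (dist (wrap 0) p)))
           \<longlongrightarrow> 0) at_top)"

definition hausdorff_semidist :: "'a::metric_space set \<Rightarrow> 'a set \<Rightarrow> ennreal" where
  "hausdorff_semidist A B = (SUP a\<in>A. ennreal (infdist a B))"

definition global_random_attractor ::
    "('n::finite) path measure \<Rightarrow> (real \<Rightarrow> 'n cyl \<Rightarrow> 'n path \<Rightarrow> 'n cyl) \<Rightarrow>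
       ('n path \<Rightarrow> 'n cyl set) \<Rightarrow> bool" where
  "global_random_attractor P \<Phi> A \<longleftrightarrow>
     random_set P A \<and> (\<forall>\<omega>\<in>space P. compact (A \<omega>)) \<and> tempered P A \<and>
     (AE \<omega> in P. \<forall>t\<ge>0. (\<lambda>p. \<Phi> t p \<omega>) ` A \<omega> = A (shift t \<omega>)) \<and>
     (\<forall>D. random_set P D \<longrightarrow> tempered P D \<longrightarrow>
        (AE \<omega> in P.
          ((\<lambda>t. hausdorff_semidist
                 ((\<lambda>p. \<Phi> t p (shift (- t) \<omega>)) ` D (shift (- t) \<omega>)) (A \<omega>)) \<longlongrightarrow> 0) at_top))"


section \<open>Dynamical order\<close>

definition one_dim_manifold :: "'a::topological_space set \<Rightarrow> bool" where
  "one_dim_manifold S \<longleftrightarrow>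
     Hausdorff_space (top_of_set S) \<and> second_countable (top_of_set S) \<and>
     (\<forall>p\<in>S. \<exists>U. openin (top_of_set S) U \<and> p \<in> U \<and> (\<exists>V::real set. open V \<and> U homeomorphic V))"

definition totally_ordered :: "(real ^ 'n::finite) set \<Rightarrow> bool" where
  "totally_ordered B \<longleftrightarrow>
     B \<noteq> {} \<and> (\<forall>x\<in>B. \<forall>y\<in>B. x \<noteq> y \<longrightarrow> x - y \<in> {v. 0 \<le> v} \<union> uminus ` {v. 0 \<le> v})"

text \<open>
  \<open>z\<close>, \<open>\<phi>\<close> and \<open>\<Phi>\<close> (at nonnegative times) and \<open>A\<close> are determined almost surely by the
  conditions imposed on them.  The set \<^term>\<open>wrap -` A \<omega>\<close> is the unwrapping of the fibre
  of the attractor.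
\<close>

definition admits_dynamical_order ::
    "('n::{finite,linorder}) path measure \<Rightarrow> real \<Rightarrow> 'n rvec \<Rightarrow> 'n rvec \<Rightarrow> bool" where
  "admits_dynamical_order P k \<alpha> \<epsilon> \<longleftrightarrow>
     (\<exists>z \<phi> \<Phi> A.
        stationary_ou P \<epsilon> z \<and>
        C1_rds P \<phi> \<and>
        (AE \<omega> in P. \<forall>x.
           rde_solution k \<alpha> z \<omega> (\<lambda>t. \<phi> t x \<omega>) \<and>
           sde_solution k \<alpha> \<epsilon> \<omega> (\<lambda>t. \<phi> t x \<omega> + z (shift t \<omega>))) \<and>
        (\<forall>\<omega>\<in>space P. \<forall>t\<ge>0. \<forall>x.
           \<phi> t (x + (2 * pi) *\<^sub>R ones) \<omega> = \<phi> t x \<omega> + (2 * pi) *\<^sub>R ones \<and>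
           \<Phi> t (wrap x) \<omega> = wrap (\<phi> t x \<omega>)) \<and>
        global_random_attractor P \<Phi> A \<and>
        (\<forall>\<omega>\<in>space P. one_dim_manifold (A \<omega>) \<and> totally_ordered (wrap -` A \<omega>)))"

end

theory Submission
  imports Defs
begin

text \<open>
  The first phase obeys a scalar equation of its own, whose flow is invertible and order preserving
  on the line.  Given its whole history, the chain of the remaining phases is a forced system which,
  for \<open>k \<ge> 8\<close>, contracts: the weighted energy \<open>\<Sum> 2\<^sup>-\<^sup>i h\<^sub>i\<^sup>2\<close> of the difference of two states with
  equal first phase decays like \<open>exp (- t)\<close>.  Starting on the diagonal at time \<open>- n\<close>, with the first
  phase chosen so that it takes the value \<open>a\<close> at time \<open>0\<close>, and letting \<open>n \<rightarrow> \<infinity>\<close> therefore yields a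
  state \<open>G a\<close>, and the unwrapped attractor is the graph-like curve \<open>G\<close>.  It is continuous as a uniform
  limit, monotone because the system is cooperative, and \<open>2\<pi>\<close>-equivariant, so that its image in the
  quotient is a closed curve.

  All estimates are pathwise.  The driving Ornstein-Uhlenbeck path enters only through its
  continuity and the finiteness of \<open>\<integral> exp (\<gamma> r) |\<zeta> r|\<^sup>2 dr\<close> over \<open>r \<le> 0\<close> for all \<open>\<gamma> > 0\<close>, and this
  follows from the Gaussian second moments by Tonelli's theorem.
\<close>

section \<open>Differential inequalities and primitives\<close>

text \<open>Two rates compete. At equal first phase, energy differences contract like
  \<open>exp (- t)\<close>, whereas deviations from the diagonal, which the forcing keeps creating,
  grow into the past at most at a rate \<gamma> as small as desired. This gap makes the pullback
  limit exist; it also characterizes the slow manifold by backward growth alone, a shift-invariant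
  property that yields invariance without interchanging limits. The threshold 8 comes from the
  energy balance: after splitting the cross terms the damping leaves \<open>- k\<close>, the
  predecessors give back at most \<open>k / 2\<close>, sine and forcing cost 3, and
  \<open>3 - k / 2 \<le> - 1\<close> is what decay at rate 1 asks for. It depends neither on the
  number of phases nor on frequencies or noise. The cocycle property, smoothness and the manifold
  structure are demanded on every fibre, so the process is built explicitly for all continuous
  paths. Measurability has to survive too: flows are limits of Picard iterates given by Lebesgue
  integrals, the slow manifold is a limit along integer times, and distances to it are infima over
  rational parameters.\<close>

lemma linear_differential_inequality:
  fixes W :: "real \<Rightarrow> real"
  assumes "s \<le> t"
    and der: "\<And>\<tau>. s \<le> \<tau> \<Longrightarrow> \<tau> \<le> t \<Longrightarrow> (W has_real_derivative W' \<tau>) (at \<tau>)"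
    and le: "\<And>\<tau>. s \<le> \<tau> \<Longrightarrow> \<tau> \<le> t \<Longrightarrow> W' \<tau> \<le> c * W \<tau>"
  shows "W t \<le> exp (c * (t - s)) * W s"
proof -
  let ?U = "\<lambda>\<tau>. exp (- (c * \<tau>)) * W \<tau>"
  have "?U t \<le> ?U s"
  proof (rule DERIV_nonpos_imp_nonincreasing[OF \<open>s \<le> t\<close>])
    fix \<tau> assume \<tau>: "s \<le> \<tau>" "\<tau> \<le> t"
    have "(?U has_real_derivative exp (- (c * \<tau>)) * (W' \<tau> - c * W \<tau>)) (at \<tau>)"
      by (auto intro!: derivative_eq_intros der \<tau> simp: algebra_simps)
    moreover have "exp (- (c * \<tau>)) * (W' \<tau> - c * W \<tau>) \<le> 0"
      using le[OF \<tau>] by (intro mult_nonneg_nonpos) auto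
    ultimately show "\<exists>y. (?U has_real_derivative y) (at \<tau>) \<and> y \<le> 0" by blast
  qed
  then have "exp (c * t) * ?U t \<le> exp (c * t) * ?U s" by simp
  then show ?thesis by (simp add: exp_diff exp_minus field_simps)
qed

text \<open>After the last time at which \<open>h\<close> is nonnegative,
  \<open>exp (- L * \<tau>) * h \<tau>\<close> would be nondecreasing, so \<open>h\<close> cannot
  have become negative. The derivative bound is asked for only where \<open>h\<close> is negative;
  this lets a coupling term of favourable sign be dropped in \<open>flow_mono\<close>.\<close>

lemma nonneg_preserved:
  fixes h :: "real \<Rightarrow> real"
  assumes "s \<le> t" "h s \<ge> 0"
    and der: "\<And>\<tau>. s \<le> \<tau> \<Longrightarrow> \<tau> \<le> t \<Longrightarrow> (h has_real_derivative h' \<tau>) (at \<tau>)"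
    and ge: "\<And>\<tau>. s \<le> \<tau> \<Longrightarrow> \<tau> \<le> t \<Longrightarrow> h \<tau> < 0 \<Longrightarrow> h' \<tau> \<ge> L * h \<tau>"
  shows "h t \<ge> 0"
proof (rule ccontr)
  assume neg: "\<not> 0 \<le> h t"
  have cont: "continuous_on {s..t} h"
    by (rule continuous_at_imp_continuous_on) (auto intro: DERIV_isCont[OF der])
  define S where "S = {\<tau>\<in>{s..t}. h \<tau> \<ge> 0}"
  have "closed S"
    using continuous_closed_preimage[OF cont closed_atLeastAtMost, of "{0..}"]
    by (simp add: S_def vimage_def Int_def)
  moreover have "s \<in> S" "bdd_above S"
    using assms by (auto simp: S_def bdd_above_def)
  ultimately have sup: "Sup S \<in> S" using closed_contains_Sup by blast
  let ?r = "Sup S"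
  have r: "s \<le> ?r" "?r \<le> t" "h ?r \<ge> 0" using sup by (auto simp: S_def)
  have neg': "h \<tau> < 0" if "?r < \<tau>" "\<tau> \<le> t" for \<tau>
    using cSup_upper[OF _ \<open>bdd_above S\<close>, of \<tau>] that r by (force simp: S_def)
  have "?r < t" using r neg by (metis less_eq_real_def)
  let ?U = "\<lambda>\<tau>. exp (- (L * \<tau>)) * h \<tau>"
  have "?U ?r \<le> ?U t"
  proof (rule DERIV_nonneg_imp_increasing_open[of ?r t ?U])
    show "?r \<le> t" using r by simp
    show "continuous_on {?r..t} ?U"
      by (intro continuous_intros continuous_on_subset[OF cont]) (use r in auto)
    fix \<tau> assume \<tau>: "?r < \<tau>" "\<tau> < t"
    have "(?U has_real_derivative exp (- (L * \<tau>)) * (h' \<tau> - L * h \<tau>)) (at \<tau>)"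
      using der[of \<tau>] \<tau> r by (auto intro!: derivative_eq_intros simp: algebra_simps)
    moreover have "exp (- (L * \<tau>)) * (h' \<tau> - L * h \<tau>) \<ge> 0"
      using ge[of \<tau>] neg'[of \<tau>] \<tau> r by simp
    ultimately show "\<exists>y. (?U has_real_derivative y) (at \<tau>) \<and> 0 \<le> y" by blast
  qed
  moreover have "?U ?r \<ge> 0" using r by simp
  moreover have "?U t < 0" using neg by (simp add: mult_pos_neg)
  ultimately show False by linarith
qed

section \<open>Two-sided primitives as Lebesgue integrals\<close>

definition signed_indicator :: "real \<Rightarrow> real \<Rightarrow> real" where
  "signed_indicator t s = indicator {0..t} s - indicator {t..0} s"

text \<open>A Bochner integral over the whole line, which makes joint measurability in parameters
  accessible; the signed indicator supplies the orientation for negative \<open>t\<close>.\<close>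

definition primitive :: "(real \<Rightarrow> 'a::euclidean_space) \<Rightarrow> real \<Rightarrow> 'a" where
  "primitive g t = (LINT s|lborel. signed_indicator t s *\<^sub>R g s)"

lemma primitive_0 [simp]: "primitive g 0 = 0"
proof -
  have "primitive g 0 = (LINT s|lborel. (0::'a))"
    unfolding primitive_def signed_indicator_def by simp
  then show ?thesis by simp
qed

lemma continuous_set_integrable:
  fixes g :: "real \<Rightarrow> 'a::euclidean_space"
  assumes "continuous_on UNIV g"
  shows "set_integrable lborel {a..b} g"
  unfolding set_integrable_def
  by (rule borel_integrable_compact) (auto intro: continuous_on_subset[OF assms])

lemma signed_indicator_integrable:
  fixes g :: "real \<Rightarrow> 'a::euclidean_space"
  assumes "continuous_on UNIV g"
  shows "integrable lborel (\<lambda>s. signed_indicator t s *\<^sub>R g s)"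
  unfolding signed_indicator_def scaleR_diff_left
  by (intro Bochner_Integration.integrable_diff)
    (use continuous_set_integrable[OF assms] in \<open>simp_all add: set_integrable_def\<close>)

text \<open>Rewrites the primitive with a fixed left endpoint, the form to which the fundamental
  theorem of calculus applies.\<close>

lemma primitive_eq:
  fixes g :: "real \<Rightarrow> 'a::euclidean_space"
  assumes c: "continuous_on UNIV g" and "-T \<le> 0" "-T \<le> t"
  shows "primitive g t = integral {-T..t} g - integral {-T..0} g"
proof -
  have si: "set_integrable lborel {a..b} g" for a b by (rule continuous_set_integrable[OF c])
  have ii: "g integrable_on {a..b}" for a b
    by (rule integrable_continuous_real) (rule continuous_on_subset[OF c], simp)
  have "primitive g t = (LINT s:{0..t}|lborel. g s) - (LINT s:{t..0}|lborel. g s)"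
    unfolding primitive_def signed_indicator_def scaleR_diff_left set_lebesgue_integral_def
    by (rule Bochner_Integration.integral_diff) (use si in \<open>auto simp: set_integrable_def\<close>)
  also have "\<dots> = integral {0..t} g - integral {t..0} g"
    using si by (simp add: set_borel_integral_eq_integral)
  also have "\<dots> = integral {-T..t} g - integral {-T..0} g"
  proof (cases "0 \<le> t")
    case True
    have "integral {-T..0} g + integral {0..t} g = integral {-T..t} g"
      by (rule Henstock_Kurzweil_Integration.integral_combine) (use assms True ii in auto)
    moreover have "integral {t..0} g = 0" using True by (cases "t = 0") auto
    ultimately show ?thesis by (simp add: algebra_simps)
  next
    case False
    have "integral {-T..t} g + integral {t..0} g = integral {-T..0} g"
      by (rule Henstock_Kurzweil_Integration.integral_combine) (use assms False ii in auto)
    then show ?thesis using False by (simp add: algebra_simps)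
  qed
  finally show ?thesis .
qed

lemma primitive_has_vector_derivative:
  fixes g :: "real \<Rightarrow> 'a::euclidean_space"
  assumes c: "continuous_on UNIV g"
  shows "(primitive g has_vector_derivative g t) (at t)"
proof -
  \<comment> \<open>A window with both 0 and \<open>t\<close> in its interior, so that one formula
    for the primitive holds near \<open>t\<close>.\<close>
  define T where "T = \<bar>t\<bar> + 1"
  have t: "t \<in> {-T<..<T}" by (auto simp: T_def)
  have "((\<lambda>u. integral {-T..u} g) has_vector_derivative g t) (at t within {-T..T})"
    by (rule integral_has_vector_derivative) (use c continuous_on_subset t in auto)
  then have "((\<lambda>u. integral {-T..u} g) has_vector_derivative g t) (at t)"
    using t by (metis at_within_Icc_at greaterThanLessThan_iff)
  then have "((\<lambda>u. integral {-T..u} g - integral {-T..0} g) has_vector_derivative g t) (at t)"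
    by (auto intro!: derivative_eq_intros)
  then show ?thesis
  proof (rule has_vector_derivative_transform_within_open[OF _ open_greaterThanLessThan t])
    show "integral {-T..u} g - integral {-T..0} g = primitive g u" if "u \<in> {-T<..<T}" for u
      using primitive_eq[OF c, of T u] that t by (auto simp: T_def)
  qed
qed

lemma has_vector_derivative_imp_continuous_on:
  fixes u :: "real \<Rightarrow> 'a::real_normed_vector"
  assumes "\<And>t. (u has_vector_derivative u' t) (at t)"
  shows "continuous_on S u"
  by (rule continuous_at_imp_continuous_on) (use assms has_vector_derivative_continuous in blast)

text \<open>Integrating an exponential of rate \<open>L\<close> gains a factor \<open>1 / L\<close>.
  With twice the Lipschitz constant as rate, this makes every Picard step a halving, on arbitrarily
  long intervals.\<close>

lemma primitive_bound:
  fixes g :: "real \<Rightarrow> 'a::euclidean_space"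
  assumes c: "continuous_on UNIV g" and L: "L > 0" and tT: "\<bar>t\<bar> \<le> T"
    and le: "\<And>s. \<bar>s\<bar> \<le> T \<Longrightarrow> norm (g s) \<le> C * exp (L * \<bar>s\<bar>)"
  shows "norm (primitive g t) \<le> C / L * (exp (L * \<bar>t\<bar>) - 1)"
proof -
  note d = primitive_has_vector_derivative[OF c]
  have cp: "continuous_on S (primitive g)" for S
    using d by (rule has_vector_derivative_imp_continuous_on)
  consider "t = 0" | "t > 0" | "t < 0" by linarith
  then show ?thesis
  proof cases
    case 1 then show ?thesis by simp
  next
    case 2
    have "norm (primitive g t - primitive g 0) \<le> C / L * exp (L * t) - C / L * exp (L * 0)"
    proof (rule differentiable_bound_general[where f' = g and \<phi>' = "\<lambda>s. C * exp (L * s)"])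
      fix s assume s: "0 < s" "s < t"
      show "norm (g s) \<le> C * exp (L * s)" using le[of s] s tT by simp
      show "((\<lambda>s. C / L * exp (L * s)) has_vector_derivative C * exp (L * s)) (at s)"
        unfolding has_real_derivative_iff_has_vector_derivative[symmetric]
        using L by (auto intro!: derivative_eq_intros)
    qed (use 2 L cp d in \<open>auto intro!: continuous_intros\<close>)
    then show ?thesis using 2 by (simp add: algebra_simps)
  next
    case 3
    have "norm (primitive g 0 - primitive g t) \<le> - C / L * exp (- L * 0) - (- C / L * exp (- L * t))"
    proof (rule differentiable_bound_general[where f' = g and \<phi>' = "\<lambda>s. C * exp (- L * s)"])
      fix s assume s: "t < s" "s < 0"
      show "norm (g s) \<le> C * exp (- L * s)" using le[of s] s tT by simp
      show "((\<lambda>s. - C / L * exp (- L * s)) has_vector_derivative C * exp (- L * s)) (at s)"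
        unfolding has_real_derivative_iff_has_vector_derivative[symmetric]
        using L by (auto intro!: derivative_eq_intros)
    qed (use 3 L cp d in \<open>auto intro!: continuous_intros\<close>)
    then show ?thesis using 3 by (simp add: algebra_simps)
  qed
qed

lemma measurable_primitive:
  fixes g :: "'b \<Rightarrow> real \<Rightarrow> 'a::euclidean_space"
  assumes [measurable]: "(\<lambda>(w, s). g w s) \<in> borel_measurable (M \<Otimes>\<^sub>M lborel)"
    and [measurable]: "\<tau> \<in> borel_measurable M"
  shows "(\<lambda>w. primitive (g w) (\<tau> w)) \<in> borel_measurable M"
proof -
  have [measurable]: "(\<lambda>(w, s). signed_indicator (\<tau> w) s) \<in> borel_measurable (M \<Otimes>\<^sub>M lborel)"
    unfolding signed_indicator_def indicator_def atLeastAtMost_iff by measurable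
  show ?thesis unfolding primitive_def by measurable
qed

lemma primitive_diff:
  fixes g h :: "real \<Rightarrow> 'a::euclidean_space"
  assumes "continuous_on UNIV g" "continuous_on UNIV h"
  shows "primitive g t - primitive h t = primitive (\<lambda>s. g s - h s) t"
  unfolding primitive_def scaleR_diff_right
  by (rule Bochner_Integration.integral_diff[symmetric]) (rule signed_indicator_integrable assms)+

text \<open>Gronwall's argument for the squared norm, which is differentiable also where
  \<open>h\<close> vanishes. The backward half is the forward inequality for \<open>- W\<close>;
  having both directions gives uniqueness of solutions in the past as well.\<close>

lemma norm_growth_bound:
  fixes h :: "real \<Rightarrow> 'a::euclidean_space"
  assumes der: "\<And>t. (h has_vector_derivative h' t) (at t)"
    and le: "\<And>t. norm (h' t) \<le> L * norm (h t)"
  shows "norm (h t) \<le> exp (L * \<bar>t - s\<bar>) * norm (h s)"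
proof -
  define W where "W t = h t \<bullet> h t" for t
  define W' where "W' t = 2 * (h t \<bullet> h' t)" for t
  have W: "(W has_real_derivative W' t) (at t)" for t
    using bounded_bilinear.has_vector_derivative[OF bounded_bilinear_inner der der, of t]
    unfolding W_def W'_def has_real_derivative_iff_has_vector_derivative
    by (simp add: inner_commute)
  have b: "\<bar>W' t\<bar> \<le> 2 * L * W t" for t
  proof -
    have "\<bar>h t \<bullet> h' t\<bar> \<le> norm (h t) * norm (h' t)" by (rule Cauchy_Schwarz_ineq2)
    also have "\<dots> \<le> norm (h t) * (L * norm (h t))" by (intro mult_left_mono le) auto
    finally show ?thesis
      by (simp add: W_def W'_def dot_square_norm power2_eq_square abs_mult algebra_simps)
  qed
  have forward: "W b \<le> exp (2 * L * (b - a)) * W a" if "a \<le> b" for a b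
    by (rule linear_differential_inequality[OF that W]) (rule order_trans[OF abs_ge_self b])
  have backward: "W a \<le> exp (2 * L * (b - a)) * W b" if "a \<le> b" for a b
  proof -
    have "- W b \<le> exp (- (2 * L) * (b - a)) * (- W a)"
    proof (rule linear_differential_inequality[OF that])
      show "((\<lambda>t. - W t) has_real_derivative - W' \<tau>) (at \<tau>)" for \<tau>
        by (rule DERIV_minus[OF W])
      show "- W' \<tau> \<le> - (2 * L) * - W \<tau>" for \<tau> using b[of \<tau>] by linarith
    qed
    then have "W a * inverse (exp (2 * L * (b - a))) \<le> W b"
      by (simp only: exp_minus[symmetric] mult_minus_left) (simp add: mult.commute)
    then show ?thesis
      by (simp only: divide_inverse[symmetric] pos_divide_le_eq[OF exp_gt_zero] mult.commute)
  qed
  have "(norm (h t))\<^sup>2 \<le> exp (2 * L * \<bar>t - s\<bar>) * (norm (h s))\<^sup>2"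
    using forward[of s t] backward[of t s] by (cases "s \<le> t") (auto simp: W_def dot_square_norm)
  also have "\<dots> = (exp (L * \<bar>t - s\<bar>) * norm (h s))\<^sup>2"
    by (simp add: power_mult_distrib exp_double[symmetric])
  finally show ?thesis by (rule power2_le_imp_le) simp
qed

section \<open>Global flows of Lipschitz fields\<close>

primrec picard :: "(real \<Rightarrow> 'a \<Rightarrow> 'a) \<Rightarrow> 'a::euclidean_space \<Rightarrow> nat \<Rightarrow> real \<Rightarrow> 'a" where
  "picard f x 0 = (\<lambda>t. x)"
| "picard f x (Suc n) = (\<lambda>t. x + primitive (\<lambda>s. f s (picard f x n s)) t)"

text \<open>A \<open>lim\<close> defined for every field, outside any locale. Convergence is proved
  for Lipschitz fields, and a pointwise limit of measurable iterates is again measurable in all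
  arguments together.\<close>

definition flow :: "(real \<Rightarrow> 'a \<Rightarrow> 'a) \<Rightarrow> 'a::euclidean_space \<Rightarrow> real \<Rightarrow> 'a" where
  "flow f x t = lim (\<lambda>n. picard f x n t)"

locale lipschitz_field =
  fixes f :: "real \<Rightarrow> 'a::euclidean_space \<Rightarrow> 'a" and L :: real
  assumes field_continuous: "continuous_on UNIV (\<lambda>(t, x). f t x)"
    and field_lipschitz: "norm (f t x - f t y) \<le> L * norm (x - y)"
    and L_pos: "L > 0"
begin

lemma field_comp_continuous:
  "continuous_on S u \<Longrightarrow> continuous_on S (\<lambda>s. f s (u s))"
  using continuous_on_compose2[OF field_continuous, of S "\<lambda>s. (s, u s)"]
  by (simp add: continuous_on_Pair)

lemma picard_continuous: "continuous_on S (picard f x n)"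
proof (induction n arbitrary: S)
  case (Suc n)
  have "continuous_on S (primitive (\<lambda>s. f s (picard f x n s)))"
    by (rule has_vector_derivative_imp_continuous_on)
      (rule primitive_has_vector_derivative[OF field_comp_continuous[OF Suc]])
  then show ?case by (auto intro!: continuous_intros)
qed auto

text \<open>The weight \<open>exp (2 * L * |t|)\<close> absorbs the Lipschitz constant: integrating
  \<open>L * exp (2 * L * |s|)\<close> returns at most half of it, whence the factor
  \<open>1 / 2 ^ n\<close> without a smallness condition on the interval.\<close>

lemma picard_step:
  assumes C: "\<And>s. \<bar>s\<bar> \<le> T \<Longrightarrow> norm (f s x) \<le> C" and t: "\<bar>t\<bar> \<le> T"
  shows "norm (picard f x (Suc n) t - picard f x n t) \<le> C / (2 * L) / 2 ^ n * exp (2 * L * \<bar>t\<bar>)"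
  using t
proof (induction n arbitrary: t)
  case 0
  have C0: "C \<ge> 0" using C[of 0] norm_ge_zero[of "f 0 x"] 0 by linarith
  have "norm (primitive (\<lambda>s. f s x) t) \<le> C / (2 * L) * (exp (2 * L * \<bar>t\<bar>) - 1)"
  proof (rule primitive_bound[OF field_comp_continuous])
    fix s assume "\<bar>s\<bar> \<le> T"
    then have "norm (f s x) \<le> C * 1" using C by simp
    also have "\<dots> \<le> C * exp (2 * L * \<bar>s\<bar>)" using L_pos C0 by (intro mult_left_mono) auto
    finally show "norm (f s x) \<le> C * exp (2 * L * \<bar>s\<bar>)" .
  qed (use L_pos 0 in auto)
  also have "\<dots> \<le> C / (2 * L) * exp (2 * L * \<bar>t\<bar>)"
    using C0 L_pos by (intro mult_left_mono) auto
  finally show ?case by simp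
next
  case (Suc n)
  have C0: "C \<ge> 0" using C[of 0] norm_ge_zero[of "f 0 x"] Suc.prems by linarith
  let ?g = "\<lambda>s. f s (picard f x (Suc n) s)" and ?h = "\<lambda>s. f s (picard f x n s)"
  have c: "continuous_on UNIV ?g" "continuous_on UNIV ?h"
    by (rule field_comp_continuous picard_continuous)+
  have "norm (primitive (\<lambda>s. ?g s - ?h s) t)
     \<le> C / 2 / 2 ^ n / (2 * L) * (exp (2 * L * \<bar>t\<bar>) - 1)"
  proof (rule primitive_bound)
    fix s assume "\<bar>s\<bar> \<le> T"
    then have "norm (picard f x (Suc n) s - picard f x n s) \<le> C / (2 * L) / 2 ^ n * exp (2 * L * \<bar>s\<bar>)"
      by (rule Suc.IH)
    then have "L * norm (picard f x (Suc n) s - picard f x n s)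
        \<le> L * (C / (2 * L) / 2 ^ n * exp (2 * L * \<bar>s\<bar>))"
      using L_pos by (intro mult_left_mono) auto
    with field_lipschitz[of s] have "norm (?g s - ?h s) \<le> L * (C / (2 * L) / 2 ^ n * exp (2 * L * \<bar>s\<bar>))"
      by (rule order_trans)
    then show "norm (?g s - ?h s) \<le> C / 2 / 2 ^ n * exp (2 * L * \<bar>s\<bar>)"
      using L_pos by simp
  qed (use L_pos Suc.prems in \<open>auto intro: continuous_on_diff[OF c] simp del: picard.simps\<close>)
  also have "\<dots> \<le> C / 2 / 2 ^ n / (2 * L) * exp (2 * L * \<bar>t\<bar>)"
    using C0 L_pos by (intro mult_left_mono) auto
  also have "primitive (\<lambda>s. ?g s - ?h s) t = picard f x (Suc (Suc n)) t - picard f x (Suc n) t"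
    unfolding primitive_diff[OF c, symmetric] picard.simps(2)[of f x "Suc n"]
    by (subst (2) picard.simps(2)) (rule add_diff_cancel_left[symmetric])
  finally show ?case by (simp add: mult.commute)
qed

text \<open>The iterates are partial sums of a telescoping series that is dominated on bounded
  intervals by a geometric one.\<close>

lemma picard_uniform_limit: "uniform_limit {-T..T} (picard f x) (flow f x) sequentially"
proof -
  define d where "d n t = picard f x (Suc n) t - picard f x n t" for n t
  have "compact ((\<lambda>s. f s x) ` {-T..T})"
    by (intro compact_continuous_image field_comp_continuous) auto
  then obtain C where C': "\<forall>y\<in>(\<lambda>s. f s x) ` {-T..T}. norm y \<le> C"
    by (meson compact_imp_bounded bounded_iff)
  have C: "norm (f s x) \<le> C" if "\<bar>s\<bar> \<le> T" for s
    by (rule bspec[OF C']) (use that in \<open>simp add: abs_le_iff\<close>)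
  have b: "norm (d n t) \<le> \<bar>C\<bar> / (2 * L) * exp (2 * L * T) * (1/2) ^ n" if "t \<in> {-T..T}" for n t
  proof -
    have t: "\<bar>t\<bar> \<le> T" using that by auto
    have "norm (d n t) \<le> \<bar>C\<bar> / (2 * L) / 2 ^ n * exp (2 * L * \<bar>t\<bar>)"
      unfolding d_def by (rule picard_step[of T]) (use C t in \<open>auto intro: order_trans[OF _ abs_ge_self]\<close>)
    also have "\<dots> \<le> \<bar>C\<bar> / (2 * L) / 2 ^ n * exp (2 * L * T)"
      using t L_pos by (intro mult_left_mono) auto
    finally show ?thesis by (simp add: field_simps)
  qed
  have "uniform_limit {-T..T} (\<lambda>n t. \<Sum>i<n. d i t) (\<lambda>t. \<Sum>i. d i t) sequentially"
    by (rule Weierstrass_m_test[OF b]) (auto intro!: summable_mult summable_geometric)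
  then have "uniform_limit {-T..T} (\<lambda>n t. x + (\<Sum>i<n. d i t)) (\<lambda>t. x + (\<Sum>i. d i t)) sequentially"
    by (intro uniform_limit_intros)
  moreover have "x + (\<Sum>i<n. d i t) = picard f x n t" for n t
    unfolding d_def sum_lessThan_telescope[of "\<lambda>i. picard f x i t"] by simp
  ultimately have u: "uniform_limit {-T..T} (picard f x) (\<lambda>t. x + (\<Sum>i. d i t)) sequentially"
    by simp
  moreover have "flow f x t = x + (\<Sum>i. d i t)" if "t \<in> {-T..T}" for t
    unfolding flow_def using tendsto_uniform_limitI[OF u that] by (rule limI)
  ultimately show ?thesis by (simp add: uniform_limit_iff)
qed

lemma picard_tendsto: "(\<lambda>n. picard f x n t) \<longlonglongrightarrow> flow f x t"
  by (rule tendsto_uniform_limitI[OF picard_uniform_limit[where T = "\<bar>t\<bar>"]]) auto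

lemma flow_continuous: "continuous_on S (flow f x)"
proof -
  have "isCont (flow f x) t" for t
  proof -
    have "continuous_on {-(\<bar>t\<bar>+1)..\<bar>t\<bar>+1} (flow f x)"
      by (rule uniform_limit_theorem[OF _ picard_uniform_limit])
        (simp_all add: picard_continuous)
    then show ?thesis
      by (rule continuous_on_interior) (auto simp: interior_atLeastAtMost_real)
  qed
  then show ?thesis using continuous_at_imp_continuous_on by blast
qed

lemma flow_integral_equation: "flow f x t = x + primitive (\<lambda>s. f s (flow f x s)) t"
proof -
  let ?h = "\<lambda>s. f s (flow f x s)"
  have "(\<lambda>n. primitive (\<lambda>s. f s (picard f x n s)) t) \<longlonglongrightarrow> primitive ?h t"
  proof (rule LIMSEQ_I)
    fix e :: real assume "e > 0"
    \<comment> \<open>An integrand below \<open>L * d\<close> has a primitive of size at most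
      \<open>L * d * (exp |t| - 1)\<close>, which this choice keeps below \<open>e\<close>.\<close>
    define d where "d = e / (L * exp \<bar>t\<bar>)"
    have "d > 0" using \<open>e > 0\<close> L_pos by (simp add: d_def)
    from uniform_limitD[OF picard_uniform_limit[where T = "\<bar>t\<bar>"] this]
    obtain N where N': "\<forall>n\<ge>N. \<forall>s\<in>{-\<bar>t\<bar>..\<bar>t\<bar>}. dist (picard f x n s) (flow f x s) < d"
      unfolding eventually_sequentially by blast
    have N: "dist (picard f x n s) (flow f x s) < d" if "n \<ge> N" "\<bar>s\<bar> \<le> \<bar>t\<bar>" for n s
    proof -
      have "s \<in> {-\<bar>t\<bar>..\<bar>t\<bar>}" using that(2) by auto
      with N' that(1) show ?thesis by blast
    qed
    have "norm (primitive (\<lambda>s. f s (picard f x n s)) t - primitive ?h t) < e" if "n \<ge> N" for n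
    proof -
      let ?g = "\<lambda>s. f s (picard f x n s)"
      have c: "continuous_on UNIV ?g" "continuous_on UNIV ?h"
        by (rule field_comp_continuous picard_continuous flow_continuous)+
      have "norm (primitive (\<lambda>s. ?g s - ?h s) t) \<le> L * d / 1 * (exp (1 * \<bar>t\<bar>) - 1)"
      proof (rule primitive_bound[where T = "\<bar>t\<bar>"])
        fix s assume s: "\<bar>s\<bar> \<le> \<bar>t\<bar>"
        have "norm (?g s - ?h s) \<le> L * norm (picard f x n s - flow f x s)" by (rule field_lipschitz)
        also have "\<dots> \<le> L * d"
          using N[OF that s] L_pos by (intro mult_left_mono) (auto simp: dist_norm)
        also have "\<dots> \<le> L * d * exp (1 * \<bar>s\<bar>)" using L_pos \<open>d > 0\<close> by simp
        finally show "norm (?g s - ?h s) \<le> L * d * exp (1 * \<bar>s\<bar>)" .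
      qed (simp_all add: continuous_on_diff[OF c])
      also have "\<dots> < L * d * exp \<bar>t\<bar>" using L_pos \<open>d > 0\<close> by simp
      also have "\<dots> = e" using L_pos by (simp add: d_def)
      finally show ?thesis using primitive_diff[OF c] by simp
    qed
    then show "\<exists>N. \<forall>n\<ge>N. norm (primitive (\<lambda>s. f s (picard f x n s)) t - primitive ?h t) < e"
      by (intro exI[of _ N]) simp
  qed
  then have "(\<lambda>n. picard f x (Suc n) t) \<longlonglongrightarrow> x + primitive ?h t"
    unfolding picard.simps by (intro tendsto_intros)
  then show ?thesis by (rule LIMSEQ_unique[OF LIMSEQ_Suc[OF picard_tendsto]])
qed

lemma flow_0 [simp]: "flow f x 0 = x"
  using flow_integral_equation[of x 0] by simp

lemma flow_has_vector_derivative: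
  "(flow f x has_vector_derivative f t (flow f x t)) (at t)"
proof -
  have "((\<lambda>t. x + primitive (\<lambda>s. f s (flow f x s)) t) has_vector_derivative 0 + f t (flow f x t)) (at t)"
    by (intro derivative_intros primitive_has_vector_derivative field_comp_continuous flow_continuous)
  then show ?thesis by (simp only: flow_integral_equation[symmetric] add_0_left)
qed

lemma solutions_separation:
  assumes u: "\<And>t. (u has_vector_derivative f t (u t)) (at t)"
    and v: "\<And>t. (v has_vector_derivative f t (v t)) (at t)"
  shows "norm (u t - v t) \<le> exp (L * \<bar>t - s\<bar>) * norm (u s - v s)"
  by (rule norm_growth_bound[OF has_vector_derivative_diff[OF u v] field_lipschitz])

text \<open>Solutions with equal value at time 0 stay at distance 0. The cocycle property, linearity
  of the variational flow and equivariance under translations all come from exhibiting a solution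
  and applying this.\<close>

lemma flow_unique:
  assumes u: "\<And>t. (u has_vector_derivative f t (u t)) (at t)"
  shows "u t = flow f (u 0) t"
  using solutions_separation[OF u flow_has_vector_derivative[where x = "u 0"], where t = t and s = 0] by simp

lemma flow_separation: "norm (flow f x t - flow f y t) \<le> exp (L * \<bar>t\<bar>) * norm (x - y)"
  using solutions_separation[OF flow_has_vector_derivative[where x = x] flow_has_vector_derivative[where x = y],
    where t = t and s = 0] by simp

lemma lipschitz_field_shift: "lipschitz_field (\<lambda>t. f (s + t)) L"
proof
  show "continuous_on UNIV (\<lambda>(t, x). f (s + t) x)"
  proof -
    have "continuous_on UNIV (\<lambda>p::real \<times> 'a. (s + fst p, snd p))"
      by (rule continuous_on_Pair continuous_on_add continuous_on_const continuous_on_fst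
        continuous_on_snd continuous_on_id)+
    from continuous_on_compose2[OF field_continuous this] show ?thesis
      by (simp add: case_prod_beta)
  qed
qed (use field_lipschitz L_pos in auto)

text \<open>Holds for negative times too, so that every time map is invertible.\<close>

lemma flow_cocycle: "flow f x (s + t) = flow (\<lambda>t. f (s + t)) (flow f x s) t"
proof -
  interpret sh: lipschitz_field "\<lambda>t. f (s + t)" L by (rule lipschitz_field_shift)
  have "((\<lambda>t. flow f x (s + t)) has_vector_derivative f (s + t) (flow f x (s + t))) (at t)" for t
  proof -
    have "((\<lambda>t. s + t) has_vector_derivative 1) (at t)"
      by (auto intro!: derivative_eq_intros simp: has_real_derivative_iff_has_vector_derivative[symmetric])
    from vector_diff_chain_at[OF this flow_has_vector_derivative[of x "s + t"]] show ?thesis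
      by (simp add: o_def)
  qed
  from sh.flow_unique[where u = "\<lambda>t. flow f x (s + t)" and t = t, OF this]
  show ?thesis by (simp only: add_0_right)
qed

end

section \<open>Measurable dependence of flows on a parameter\<close>

lemma measurable_picard:
  fixes f :: "'b \<Rightarrow> real \<Rightarrow> 'a \<Rightarrow> 'a::euclidean_space"
  assumes f: "(\<lambda>(w, s, x). f w s x) \<in> borel_measurable (M \<Otimes>\<^sub>M (borel \<Otimes>\<^sub>M borel))"
  shows "(\<lambda>((w, x), t). picard (f w) x n t) \<in> borel_measurable ((M \<Otimes>\<^sub>M borel) \<Otimes>\<^sub>M borel)"
proof (induction n)
  case 0
  show ?case by (simp add: case_prod_beta)
next
  case (Suc n)
  let ?N = "(M \<Otimes>\<^sub>M borel) \<Otimes>\<^sub>M (borel :: real measure)"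
  note Suc[measurable] f[measurable]
  have [measurable]: "(\<lambda>z. picard (f (fst (fst (fst z)))) (snd (fst (fst z))) n (snd z))
      \<in> borel_measurable (?N \<Otimes>\<^sub>M lborel)"
    using measurable_compose[OF _ Suc, of "\<lambda>z. (fst (fst z), snd z)" "?N \<Otimes>\<^sub>M lborel"]
    by (simp add: case_prod_beta)
  have "(\<lambda>z. f (fst (fst (fst z))) (snd z) (picard (f (fst (fst (fst z)))) (snd (fst (fst z))) n (snd z)))
      \<in> borel_measurable (?N \<Otimes>\<^sub>M lborel)"
    using measurable_compose[OF _ f, of "\<lambda>z. (fst (fst (fst z)), snd z,
      picard (f (fst (fst (fst z)))) (snd (fst (fst z))) n (snd z))" "?N \<Otimes>\<^sub>M lborel"]
    by (simp add: case_prod_beta)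
  then have "(\<lambda>z. primitive (\<lambda>s. f (fst (fst z)) s (picard (f (fst (fst z))) (snd (fst z)) n s)) (snd z))
      \<in> borel_measurable ?N"
    by (intro measurable_primitive) (auto simp: case_prod_beta)
  then have "(\<lambda>z. snd (fst z) + primitive (\<lambda>s. f (fst (fst z)) s (picard (f (fst (fst z))) (snd (fst z)) n s)) (snd z))
      \<in> borel_measurable ?N"
    by measurable
  then show ?case by (simp add: case_prod_beta)
qed

lemma measurable_flow:
  fixes f :: "'b \<Rightarrow> real \<Rightarrow> 'a \<Rightarrow> 'a::euclidean_space"
  assumes "(\<lambda>(w, s, x). f w s x) \<in> borel_measurable (M \<Otimes>\<^sub>M (borel \<Otimes>\<^sub>M borel))"
    and "\<And>w. w \<in> space M \<Longrightarrow> lipschitz_field (f w) L"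
  shows "(\<lambda>((w, x), t). flow (f w) x t) \<in> borel_measurable ((M \<Otimes>\<^sub>M borel) \<Otimes>\<^sub>M borel)"
proof (rule borel_measurable_LIMSEQ_metric[OF measurable_picard[OF assms(1)]])
  fix z assume "z \<in> space ((M \<Otimes>\<^sub>M (borel :: 'a measure)) \<Otimes>\<^sub>M (borel :: real measure))"
  then have "fst (fst z) \<in> space M" by (auto simp: space_pair_measure)
  from lipschitz_field.picard_tendsto[OF assms(2)[OF this]]
  show "(\<lambda>n. case z of (a, b) \<Rightarrow> (case a of (w, x) \<Rightarrow> picard (f w) x n) b)
     \<longlonglongrightarrow> (case z of (a, b) \<Rightarrow> (case a of (w, x) \<Rightarrow> flow (f w) x) b)"
    by (simp add: case_prod_beta)
qed

section \<open>The driven system and its linearization\<close>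

text \<open>Adding \<open>e\<^sup>2\<close> to the squared norm makes the inequality homogeneous:
  the inhomogeneous term \<open>2 * norm (\<rho> s) * e\<close> is at most the new quantity itself,
  so that its growth rate is bounded by \<open>2 * L + 2\<close>.\<close>

lemma perturbed_growth:
  fixes \<rho> :: "real \<Rightarrow> 'a::euclidean_space"
  assumes der: "\<And>s. (\<rho> has_vector_derivative g s) (at s)" and "\<rho> 0 = 0" "0 \<le> t" "L \<ge> 0"
    and le: "\<And>s. 0 \<le> s \<Longrightarrow> s \<le> t \<Longrightarrow> norm (g s) \<le> L * norm (\<rho> s) + e"
  shows "norm (\<rho> t) \<le> exp ((L + 1) * t) * e"
proof -
  have "e \<ge> 0" using order_trans[OF norm_ge_zero le[of 0]] assms(2,3) by simp
  define U where "U s = \<rho> s \<bullet> \<rho> s + e\<^sup>2" for s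
  have "U t \<le> exp ((2 * L + 2) * (t - 0)) * U 0"
  proof (rule linear_differential_inequality[OF \<open>0 \<le> t\<close>])
    fix s assume s: "0 \<le> s" "s \<le> t"
    from bounded_bilinear.has_vector_derivative[OF bounded_bilinear_inner der der, of s]
    have "((\<lambda>s. \<rho> s \<bullet> \<rho> s) has_real_derivative 2 * (\<rho> s \<bullet> g s)) (at s)"
      by (simp add: has_real_derivative_iff_has_vector_derivative inner_commute)
    then show "(U has_real_derivative 2 * (\<rho> s \<bullet> g s)) (at s)"
      unfolding U_def by (auto intro!: derivative_eq_intros)
    have "\<rho> s \<bullet> g s \<le> norm (\<rho> s) * norm (g s)" by (rule norm_cauchy_schwarz)
    also have "\<dots> \<le> norm (\<rho> s) * (L * norm (\<rho> s) + e)" by (intro mult_left_mono le s) auto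
    finally have "2 * (\<rho> s \<bullet> g s) \<le> 2 * L * (norm (\<rho> s))\<^sup>2 + 2 * norm (\<rho> s) * e"
      by (simp add: power2_eq_square algebra_simps)
    moreover have "2 * norm (\<rho> s) * e \<le> (norm (\<rho> s))\<^sup>2 + e\<^sup>2" by (rule sum_squares_bound)
    moreover have "0 \<le> (2 * L + 1) * e\<^sup>2 + (norm (\<rho> s))\<^sup>2" using \<open>L \<ge> 0\<close> by simp
    moreover have "(2 * L + 2) * U s = (2 * L + 2) * (norm (\<rho> s))\<^sup>2 + (2 * L + 2) * e\<^sup>2"
      by (simp add: U_def dot_square_norm algebra_simps)
    ultimately show "2 * (\<rho> s \<bullet> g s) \<le> (2 * L + 2) * U s"
      by (simp add: algebra_simps)
  qed
  then have "(norm (\<rho> t))\<^sup>2 + e\<^sup>2 \<le> exp ((2 * L + 2) * t) * e\<^sup>2"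
    unfolding U_def by (simp add: assms(2) dot_square_norm)
  then have "(norm (\<rho> t))\<^sup>2 \<le> exp ((2 * L + 2) * t) * e\<^sup>2"
    using zero_le_power2[of e] by linarith
  also have "\<dots> = (exp ((L + 1) * t) * e)\<^sup>2"
  proof -
    have "(2 * L + 2) * t = (L + 1) * t + (L + 1) * t" by (simp add: algebra_simps)
    then have "exp ((2 * L + 2) * t) = exp ((L + 1) * t) * exp ((L + 1) * t)" by (simp only: exp_add)
    then show ?thesis by (simp add: power_mult_distrib power2_eq_square)
  qed
  finally show ?thesis by (rule power2_le_imp_le) (use \<open>e \<ge> 0\<close> in auto)
qed

text \<open>Lipschitz dependence on the state, uniform on bounded time intervals, upgrades separate
  continuity to joint continuity.\<close>

lemma jointly_continuous:
  fixes g :: "real \<Rightarrow> 'a::metric_space \<Rightarrow> 'b::metric_space"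
  assumes cont: "\<And>x. continuous_on {0..} (\<lambda>t. g t x)"
    and lip: "\<And>t x y. 0 \<le> t \<Longrightarrow> dist (g t x) (g t y) \<le> C * exp (c * t) * dist x y"
    and "c \<ge> 0" "C \<ge> 0"
  shows "continuous_on ({0..} \<times> UNIV) (\<lambda>(t, x). g t x)"
  unfolding continuous_on_iff
proof (intro ballI allI impI)
  fix p :: "real \<times> 'a" and e :: real assume p: "p \<in> {0..} \<times> UNIV" and "e > 0"
  obtain t x where tx: "p = (t, x)" "t \<ge> 0" using p by auto
  \<comment> \<open>The added 1 keeps \<open>K\<close> positive when \<open>C = 0\<close>, so that
    it can be divided by.\<close>
  define K where "K = C * exp (c * (t + 1)) + 1"
  have K: "K > 0" using \<open>C \<ge> 0\<close> by (simp add: K_def add_nonneg_pos)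
  obtain d where d: "d > 0" "\<And>s. s \<ge> 0 \<Longrightarrow> dist s t < d \<Longrightarrow> dist (g s x) (g t x) < e / 2"
    using cont[of x] \<open>t \<ge> 0\<close> \<open>e > 0\<close> unfolding continuous_on_iff
    by (metis atLeast_iff half_gt_zero)
  let ?d = "min (min d 1) (e / (2 * K))"
  have "dist (g s y) (g t x) < e" if "s \<ge> 0" "dist (s, y) (t, x) < ?d" for s y
  proof -
    have "dist s t \<le> dist (s, y) (t, x)" "dist y x \<le> dist (s, y) (t, x)"
      using dist_fst_le[of "(s, y)" "(t, x)"] dist_snd_le[of "(s, y)" "(t, x)"] by auto
    then have s: "dist s t < d" "dist s t < 1" and y: "dist y x < e / (2 * K)" using that by auto
    have "s \<le> t + 1" using s(2) by (simp add: dist_real_def)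
    have "dist (g s y) (g s x) \<le> C * exp (c * s) * dist y x" by (rule lip) fact
    also have "\<dots> \<le> K * dist y x"
    proof (rule mult_right_mono)
      have "C * exp (c * s) \<le> C * exp (c * (t + 1))"
        using \<open>s \<le> t + 1\<close> \<open>c \<ge> 0\<close> \<open>C \<ge> 0\<close> by (intro mult_left_mono) (auto intro: mult_left_mono)
      then show "C * exp (c * s) \<le> K" by (simp add: K_def)
    qed simp
    also have "\<dots> < K * (e / (2 * K))" using K y by (intro mult_strict_left_mono)
    also have "\<dots> = e / 2" using K by simp
    finally have "dist (g s y) (g s x) < e / 2" .
    moreover have "dist (g s x) (g t x) < e / 2" using d(2) that(1) s(1) by blast
    ultimately show ?thesis using dist_triangle[of "g s y" "g t x" "g s x"] by linarith
  qed
  moreover have "?d > 0" using d \<open>e > 0\<close> K by simp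
  ultimately show "\<exists>d>0. \<forall>q\<in>{0..} \<times> UNIV. dist q p < d \<longrightarrow>
      dist (case q of (t, x) \<Rightarrow> g t x) (case p of (t, x) \<Rightarrow> g t x) < e"
    unfolding tx by (intro exI[of _ ?d]) auto
qed

section \<open>Estimates for the drift and its linearization\<close>

lemma abs_sin_diff_le: "\<bar>sin x - sin y\<bar> \<le> \<bar>x - y\<bar>" for x y :: real
proof -
  have "\<bar>sin x - sin y\<bar> = 2 * \<bar>sin ((x - y) / 2)\<bar> * \<bar>cos ((x + y) / 2)\<bar>"
    by (simp add: sin_diff_sin abs_mult)
  also have "\<dots> \<le> 2 * \<bar>(x - y) / 2\<bar> * 1"
    by (intro mult_mono mult_left_mono abs_sin_x_le_abs_x) auto
  finally show ?thesis by simp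
qed

lemma abs_cos_diff_le: "\<bar>cos x - cos y\<bar> \<le> \<bar>x - y\<bar>" for x y :: real
  using abs_sin_diff_le[of "pi / 2 - x" "pi / 2 - y"] by (simp add: sin_diff abs_minus_commute)

text \<open>The mean value theorem gives the slope \<open>cos \<xi>\<close> at an intermediate
  point, and the cosine is 1-Lipschitz.\<close>

lemma sin_quadratic_remainder: "\<bar>sin y - sin x - cos x * (y - x)\<bar> \<le> \<bar>y - x\<bar> * \<bar>y - x\<bar>" for x y :: real
proof -
  have "\<exists>\<xi>. \<bar>\<xi> - x\<bar> \<le> \<bar>y - x\<bar> \<and> sin y - sin x = (y - x) * cos \<xi>"
  proof (cases x y rule: linorder_cases)
    case less
    from MVT2[OF this, of sin cos] obtain z where "x < z" "z < y" "sin y - sin x = (y - x) * cos z" by auto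
    then show ?thesis by (intro exI[of _ z]) auto
  next
    case greater
    from MVT2[OF this, of sin cos] obtain z where "y < z" "z < x" "sin x - sin y = (x - y) * cos z" by auto
    then show ?thesis by (intro exI[of _ z]) (auto simp: algebra_simps)
  qed auto
  then obtain \<xi> where \<xi>: "\<bar>\<xi> - x\<bar> \<le> \<bar>y - x\<bar>" "sin y - sin x = (y - x) * cos \<xi>" by blast
  have "\<bar>sin y - sin x - cos x * (y - x)\<bar> = \<bar>y - x\<bar> * \<bar>cos \<xi> - cos x\<bar>"
    unfolding \<xi> by (simp add: abs_mult[symmetric] algebra_simps)
  also have "\<dots> \<le> \<bar>y - x\<bar> * \<bar>y - x\<bar>"
    using abs_cos_diff_le[of \<xi> x] \<xi>(1) by (intro mult_left_mono) auto
  finally show ?thesis .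
qed

text \<open>The Jacobian of \<open>drift k \<alpha>\<close> at \<open>x\<close>, applied to
  \<open>h\<close>; the frequencies drop out.\<close>

definition drift_deriv :: "real \<Rightarrow> ('n::{finite,linorder}) rvec \<Rightarrow> 'n rvec \<Rightarrow> 'n rvec" where
  "drift_deriv k x h = k *\<^sub>R (coupling *v h) - (\<chi> i. cos (x $ i) * h $ i)"

text \<open>At the least index this is the unspecified value \<open>Max {}\<close>; the estimates
  below use it for the other indices.\<close>

definition pred_index :: "'n::{finite,linorder} \<Rightarrow> 'n" where
  "pred_index i = Max {l. l < i}"

lemma pred_index_less: "i \<noteq> Min UNIV \<Longrightarrow> pred_index i < i"
proof -
  assume "i \<noteq> Min UNIV"
  then have "Min UNIV \<in> {l. l < i}" using Min_le[of UNIV i] by (simp add: order_less_le)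
  then have "{l. l < i} \<noteq> {}" by blast
  then show "pred_index i < i" using Max_in[of "{l. l < i}"] by (simp add: pred_index_def)
qed

lemma le_pred_index: "j < i \<Longrightarrow> j \<le> pred_index i"
  unfolding pred_index_def by (rule Max_ge) auto

text \<open>Of two distinct indices the smaller one is at most the predecessor of the larger, and
  strictly above its own predecessor.\<close>

lemma inj_on_pred_index: "inj_on pred_index (- {Min UNIV})"
proof (rule inj_onI)
  fix i j :: 'a
  assume ij: "i \<in> - {Min UNIV}" "j \<in> - {Min UNIV}" "pred_index i = pred_index j"
  show "i = j"
    using le_pred_index[of i j] le_pred_index[of j i] pred_index_less[of i] pred_index_less[of j] ij
    by (cases i j rule: linorder_cases) auto
qed

lemma coupling_mult:
  "(coupling *v x) $ i = (if i = Min UNIV then 0 else x $ pred_index i - x $ i)"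
proof (cases "i = Min UNIV")
  case False
  have "(coupling *v x) $ i = (\<Sum>j\<in>UNIV. (if j = i then - x $ j else 0) + (if j = pred_index i then x $ j else 0))"
    unfolding matrix_vector_mult_def coupling_def vec_lambda_beta
    by (rule sum.cong) (use pred_index_less[OF False] False in \<open>auto simp: pred_index_def\<close>)
  then show ?thesis using False by (simp add: sum.distrib)
qed (simp add: matrix_vector_mult_def coupling_def)

lemma power2_norm_vec: "(norm x)\<^sup>2 = (\<Sum>i\<in>UNIV. (x $ i)\<^sup>2)" for x :: "(real, 'n::finite) vec"
  by (simp add: norm_vec_def L2_set_def sum_nonneg)

lemma sum_pred_index_le:
  fixes f :: "'n::{finite,linorder} \<Rightarrow> real"
  assumes "\<And>i. f i \<ge> 0"
  shows "(\<Sum>i\<in>- {Min UNIV}. f (pred_index i)) \<le> sum f UNIV"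
  unfolding sum.reindex[OF inj_on_pred_index, unfolded o_def, symmetric]
  by (rule sum_mono2) (use assms in auto)

text \<open>The coupling is a shift along the chain minus a truncation of coordinates, and neither
  enlarges the norm.\<close>

lemma norm_coupling: "norm (coupling *v h) \<le> 2 * norm h"
proof -
  let ?p = "\<chi> i. if i = Min UNIV then 0 else h $ pred_index i"
  let ?q = "\<chi> i. if i = Min UNIV then 0 else h $ i"
  have "(norm ?p)\<^sup>2 = (\<Sum>i\<in>- {Min UNIV}. (h $ pred_index i)\<^sup>2)"
    unfolding power2_norm_vec by (rule sum.mono_neutral_cong_right) auto
  also have "\<dots> \<le> (norm h)\<^sup>2"
    unfolding power2_norm_vec by (rule sum_pred_index_le[of "\<lambda>i. (h $ i)\<^sup>2"]) simp
  finally have "norm ?p \<le> norm h" by (rule power2_le_imp_le) simp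
  moreover have "norm ?q \<le> norm h" by (rule norm_le_componentwise_cart) simp
  moreover have "coupling *v h = ?p - ?q" by (simp add: vec_eq_iff coupling_mult)
  ultimately show ?thesis using norm_triangle_ineq4[of ?p ?q] by simp
qed

definition drift_lipschitz :: "real \<Rightarrow> real" where
  "drift_lipschitz k = 2 * \<bar>k\<bar> + 1"

lemma drift_lipschitz_pos: "drift_lipschitz k > 0"
  unfolding drift_lipschitz_def by simp

lemma coupling_norm: "norm (k *\<^sub>R (coupling *v h)) \<le> 2 * \<bar>k\<bar> * norm h"
  using mult_left_mono[OF norm_coupling[of h], of "\<bar>k\<bar>"] by (simp add: mult_ac)

lemma drift_diff:
  "drift k \<alpha> x - drift k \<alpha> y = k *\<^sub>R (coupling *v (x - y)) - (\<chi> i. sin (x $ i) - sin (y $ i))"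
  by (simp add: drift_def vec_eq_iff matrix_vector_mult_diff_distrib algebra_simps)

lemma norm_drift_diff:
  fixes x y :: "('n::{finite,linorder}) rvec"
  shows "norm (drift k \<alpha> x - drift k \<alpha> y) \<le> drift_lipschitz k * norm (x - y)"
proof -
  have "norm (\<chi> i. sin (x $ i) - sin (y $ i)) \<le> norm (x - y)"
    by (rule norm_le_componentwise_cart) (simp add: abs_sin_diff_le)
  then show ?thesis
    unfolding drift_diff using coupling_norm[of k "x - y"]
      norm_triangle_ineq4[of "k *\<^sub>R (coupling *v (x - y))" "\<chi> i. sin (x $ i) - sin (y $ i)"]
    by (simp add: drift_lipschitz_def algebra_simps)
qed

lemma drift_deriv_add: "drift_deriv k x (g + h) = drift_deriv k x g + drift_deriv k x h"
  by (simp add: drift_deriv_def vec_eq_iff matrix_vector_right_distrib algebra_simps)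

lemma drift_deriv_scaleR: "drift_deriv k x (c *\<^sub>R h) = c *\<^sub>R drift_deriv k x h"
  by (simp add: drift_deriv_def vec_eq_iff matrix_vector_mult_scaleR algebra_simps)

lemma drift_deriv_diff: "drift_deriv k x (g - h) = drift_deriv k x g - drift_deriv k x h"
  by (simp add: drift_deriv_def vec_eq_iff matrix_vector_mult_diff_distrib algebra_simps)

lemma norm_drift_deriv:
  fixes x h :: "('n::{finite,linorder}) rvec"
  shows "norm (drift_deriv k x h) \<le> drift_lipschitz k * norm h"
proof -
  have "norm (\<chi> i. cos (x $ i) * h $ i) \<le> norm h"
    by (rule norm_le_componentwise_cart) (simp add: abs_mult mult_left_le_one_le)
  then show ?thesis
    unfolding drift_deriv_def using coupling_norm[of k h]
      norm_triangle_ineq4[of "k *\<^sub>R (coupling *v h)" "\<chi> i. cos (x $ i) * h $ i"]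
    by (simp add: drift_lipschitz_def algebra_simps)
qed

lemma drift_deriv_lipschitz:
  "norm (drift_deriv k x h - drift_deriv k y h) \<le> norm (x - y) * norm h"
proof -
  have "norm (drift_deriv k x h - drift_deriv k y h) \<le> norm (norm (x - y) *\<^sub>R h)"
  proof (rule norm_le_componentwise_cart)
    fix i
    have "\<bar>cos (y $ i) - cos (x $ i)\<bar> \<le> norm (x - y)"
      using abs_cos_diff_le[of "y $ i" "x $ i"] component_le_norm_cart[of "x - y" i] by simp
    then have "\<bar>cos (y $ i) - cos (x $ i)\<bar> * \<bar>h $ i\<bar> \<le> norm (x - y) * \<bar>h $ i\<bar>"
      by (rule mult_right_mono) simp
    then show "norm ((drift_deriv k x h - drift_deriv k y h) $ i) \<le> norm ((norm (x - y) *\<^sub>R h) $ i)"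
      by (simp add: drift_deriv_def abs_mult left_diff_distrib[symmetric])
  qed
  then show ?thesis by simp
qed

lemma drift_remainder:
  "norm (drift k \<alpha> y - drift k \<alpha> x - drift_deriv k x (y - x)) \<le> norm (y - x) * norm (y - x)"
proof -
  have "norm (drift k \<alpha> y - drift k \<alpha> x - drift_deriv k x (y - x)) \<le> norm (norm (y - x) *\<^sub>R (y - x))"
  proof (rule norm_le_componentwise_cart)
    fix i
    have "(drift k \<alpha> y - drift k \<alpha> x - drift_deriv k x (y - x)) $ i
        = - (sin (y $ i) - sin (x $ i) - cos (x $ i) * (y $ i - x $ i))"
      unfolding drift_diff by (simp add: drift_deriv_def)
    moreover have "\<bar>y $ i - x $ i\<bar> * \<bar>y $ i - x $ i\<bar> \<le> norm (y - x) * \<bar>y $ i - x $ i\<bar>"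
      using component_le_norm_cart[of "y - x" i] by (intro mult_right_mono) auto
    ultimately show "norm ((drift k \<alpha> y - drift k \<alpha> x - drift_deriv k x (y - x)) $ i)
        \<le> norm ((norm (y - x) *\<^sub>R (y - x)) $ i)"
      using sin_quadratic_remainder[of "y $ i" "x $ i"] by (simp add: abs_mult abs_minus_commute)
  qed
  then show ?thesis by simp
qed

section \<open>The equation driven by a path and its variational equation\<close>

definition driven_field ::
    "real \<Rightarrow> ('n::{finite,linorder}) rvec \<Rightarrow> (real \<Rightarrow> 'n rvec) \<Rightarrow> real \<Rightarrow> 'n rvec \<Rightarrow> 'n rvec" where
  "driven_field k \<alpha> \<zeta> t x = drift k \<alpha> (x + \<zeta> t) + \<zeta> t"

lemma drift_continuous: "continuous_on S (drift k \<alpha>)"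
  unfolding drift_def
  by (intro continuous_intros continuous_on_vec_lambda linear_continuous_on matrix_vector_mul_bounded_linear)

lemma driven_field_lipschitz:
  fixes \<zeta> :: "real \<Rightarrow> ('n::{finite,linorder}) rvec"
  assumes "continuous_on UNIV \<zeta>"
  shows "lipschitz_field (driven_field k \<alpha> \<zeta>) (drift_lipschitz k)"
proof
  have c: "continuous_on UNIV (\<lambda>p::real \<times> 'n rvec. \<zeta> (fst p))"
    by (rule continuous_on_compose2[OF assms]) (auto intro: continuous_intros)
  have "continuous_on UNIV (\<lambda>p::real \<times> 'n rvec. drift k \<alpha> (snd p + \<zeta> (fst p)))"
    by (rule continuous_on_compose2[OF drift_continuous[of UNIV]])
      (auto intro!: continuous_on_add continuous_on_snd c)
  then show "continuous_on UNIV (\<lambda>(t, x). driven_field k \<alpha> \<zeta> t x)"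
    unfolding driven_field_def case_prod_beta by (intro continuous_on_add c)
  show "norm (driven_field k \<alpha> \<zeta> t x - driven_field k \<alpha> \<zeta> t y) \<le> drift_lipschitz k * norm (x - y)"
    for t x y using norm_drift_diff[of k \<alpha> "x + \<zeta> t" "y + \<zeta> t"] by (simp add: driven_field_def)
qed (rule drift_lipschitz_pos)

locale driven_system =
  fixes k :: real and \<alpha> :: "('n::{finite,linorder}) rvec" and \<zeta> :: "real \<Rightarrow> 'n rvec"
  assumes driver_continuous: "continuous_on UNIV \<zeta>"
begin

sublocale lipschitz_field "driven_field k \<alpha> \<zeta>" "drift_lipschitz k"
  by (rule driven_field_lipschitz[OF driver_continuous])

abbreviation "L \<equiv> drift_lipschitz k"
abbreviation "\<phi> t x \<equiv> flow (driven_field k \<alpha> \<zeta>) x t"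

text \<open>The equation linearized along the trajectory through \<open>x\<close>; its flow turns
  out to be the spatial derivative of \<open>\<phi>\<close>.\<close>

definition variational_field :: "'n rvec \<Rightarrow> real \<Rightarrow> 'n rvec \<Rightarrow> 'n rvec" where
  "variational_field x t h = drift_deriv k (\<phi> t x + \<zeta> t) h"

lemma variational_lipschitz: "lipschitz_field (variational_field x) L"
proof
  have c: "continuous_on UNIV (\<lambda>p::real \<times> 'n rvec. \<phi> (fst p) x + \<zeta> (fst p))"
    by (rule continuous_on_add; rule continuous_on_compose2[OF flow_continuous[of UNIV]]
        continuous_on_compose2[OF driver_continuous]) (auto intro!: continuous_on_fst)
  show "continuous_on UNIV (\<lambda>(t, h). variational_field x t h)"
    unfolding variational_field_def drift_deriv_def case_prod_beta
    by (intro continuous_on_diff continuous_on_scaleR continuous_on_const continuous_on_vec_lambda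
        continuous_on_mult continuous_on_cos continuous_on_component c continuous_on_snd
        continuous_on_id bounded_linear.continuous_on[OF matrix_vector_mul_bounded_linear])
  show "norm (variational_field x t g - variational_field x t h) \<le> L * norm (g - h)" for t g h
    unfolding variational_field_def drift_deriv_diff[symmetric] by (rule norm_drift_deriv)
qed (rule drift_lipschitz_pos)

abbreviation "H t x h \<equiv> flow (variational_field x) h t"

lemma variational_flow_bound: "norm (H t x h) \<le> exp (L * \<bar>t\<bar>) * norm h"
proof -
  interpret v: lipschitz_field "variational_field x" L by (rule variational_lipschitz)
  have "H t x 0 = 0"
    using v.flow_unique[of "\<lambda>t. 0" t] by (simp add: variational_field_def drift_deriv_def zero_vec_def[symmetric])
  then show ?thesis using v.flow_separation[of h t 0] by simp
qed

lemma variational_flow_linear: "linear (H t x)"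
proof -
  interpret v: lipschitz_field "variational_field x" L by (rule variational_lipschitz)
  note d = v.flow_has_vector_derivative
  show ?thesis
  proof (rule linearI)
    fix g h
    have "((\<lambda>t. H t x g + H t x h) has_vector_derivative variational_field x t (H t x g + H t x h)) (at t)" for t
      using has_vector_derivative_add[OF d[of g t] d[of h t]]
      by (simp add: variational_field_def drift_deriv_add)
    from v.flow_unique[where u = "\<lambda>t. H t x g + H t x h", OF this]
    show "H t x (g + h) = H t x g + H t x h" by simp
  next
    fix c h
    have "((\<lambda>t. c *\<^sub>R H t x h) has_vector_derivative variational_field x t (c *\<^sub>R H t x h)) (at t)" for t
      using bounded_linear.has_vector_derivative[OF bounded_linear_scaleR_right d[of h t]]
      by (simp add: variational_field_def drift_deriv_scaleR)
    from v.flow_unique[where u = "\<lambda>t. c *\<^sub>R H t x h", OF this]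
    show "H t x (c *\<^sub>R h) = c *\<^sub>R H t x h" by simp
  qed
qed

text \<open>The error solves the variational equation forced by the Taylor remainder of the drift,
  which is quadratic in the separation of the two trajectories.\<close>

lemma flow_remainder:
  assumes "t \<ge> 0"
  shows "norm (\<phi> t y - \<phi> t x - H t x (y - x)) \<le> exp ((L + 1) * t) * exp (2 * L * t) * (norm (y - x) * norm (y - x))"
proof -
  interpret v: lipschitz_field "variational_field x" L by (rule variational_lipschitz)
  define \<rho> where "\<rho> t = \<phi> t y - \<phi> t x - H t x (y - x)" for t
  define g where "g t = driven_field k \<alpha> \<zeta> t (\<phi> t y) - driven_field k \<alpha> \<zeta> t (\<phi> t x)
      - variational_field x t (H t x (y - x))" for t
  have "norm (\<rho> t) \<le> exp ((L + 1) * t) * (exp (2 * L * t) * (norm (y - x) * norm (y - x)))"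
  proof (rule perturbed_growth[where \<rho> = \<rho> and g = g])
    show "(\<rho> has_vector_derivative g s) (at s)" for s
      unfolding \<rho>_def g_def
      by (intro has_vector_derivative_diff flow_has_vector_derivative v.flow_has_vector_derivative)
    show "\<rho> 0 = 0" by (simp add: \<rho>_def)
    fix s assume s: "0 \<le> s" "s \<le> t"
    let ?a = "\<phi> s x + \<zeta> s" and ?b = "\<phi> s y + \<zeta> s"
    \<comment> \<open>The linearization at the base trajectory collects \<open>\<rho>\<close>; what
      is left is the Taylor remainder between the two trajectories, in whose increment \<zeta>
      cancels.\<close>
    have "g s = drift_deriv k ?a (\<rho> s) + (drift k \<alpha> ?b - drift k \<alpha> ?a - drift_deriv k ?a (?b - ?a))"
      by (simp add: g_def \<rho>_def driven_field_def variational_field_def drift_deriv_diff)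
    then have "norm (g s) \<le> L * norm (\<rho> s) + norm (?b - ?a) * norm (?b - ?a)"
      by (simp only:) (rule norm_triangle_le[OF add_mono[OF norm_drift_deriv drift_remainder]])
    moreover have "norm (?b - ?a) \<le> exp (L * t) * norm (y - x)"
    proof -
      have "norm (?b - ?a) \<le> exp (L * \<bar>s\<bar>) * norm (y - x)" using flow_separation[of y s x] by simp
      also have "\<dots> \<le> exp (L * t) * norm (y - x)"
        using s L_pos by (intro mult_right_mono) auto
      finally show ?thesis .
    qed
    then have "norm (?b - ?a) * norm (?b - ?a) \<le> (exp (L * t) * norm (y - x)) * (exp (L * t) * norm (y - x))"
      by (intro mult_mono) auto
    moreover have "\<dots> = exp (2 * L * t) * (norm (y - x) * norm (y - x))"
      by (simp add: mult.assoc exp_double power2_eq_square)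
    ultimately show "norm (g s) \<le> L * norm (\<rho> s) + exp (2 * L * t) * (norm (y - x) * norm (y - x))"
      by linarith
  qed (use assms L_pos in auto)
  then show ?thesis by (simp add: \<rho>_def mult.assoc)
qed

definition flow_jacobian :: "real \<Rightarrow> 'n rvec \<Rightarrow> ('n rvec, 'n) vec" where
  "flow_jacobian t x = matrix (H t x)"

lemma flow_jacobian_mult: "flow_jacobian t x *v h = H t x h"
  unfolding flow_jacobian_def by (rule matrix_works[OF variational_flow_linear[unfolded linear_matrix_vector_mul_eq[symmetric]]])

lemma flow_has_derivative:
  assumes "t \<ge> 0"
  shows "((\<phi> t) has_derivative (\<lambda>h. flow_jacobian t x *v h)) (at x)"
  unfolding flow_jacobian_mult
proof (rule has_derivativeI_sandwich[where e = 1])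
  let ?C = "exp ((L + 1) * t) * exp (2 * L * t)"
  show "bounded_linear (H t x)" by (rule linear_conv_bounded_linear[THEN iffD1, OF variational_flow_linear])
  show "norm (\<phi> t y - \<phi> t x - H t x (y - x)) / norm (y - x) \<le> ?C * norm (y - x)" if "y \<noteq> x" for y
    using flow_remainder[OF assms, of y x] that by (simp add: pos_divide_le_eq mult.assoc)
  show "((\<lambda>y. ?C * norm (y - x)) \<longlongrightarrow> 0) (at x)"
    by (rule tendsto_eq_intros tendsto_mult_right_zero refl | simp)+
qed auto

text \<open>The difference of two variational solutions is driven by the difference of their
  coefficients, at most the separation of the base trajectories. The rate \<open>3 * L + 1\<close>
  adds \<open>L + 1\<close> from \<open>perturbed_growth\<close>, \<open>L\<close> from that
  separation and \<open>L\<close> from the size of the variational solution.\<close>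

lemma variational_flow_lipschitz:
  assumes "t \<ge> 0"
  shows "norm (H t x h - H t y h) \<le> norm h * exp ((3 * L + 1) * t) * norm (x - y)"
proof -
  interpret v: lipschitz_field "variational_field x" L by (rule variational_lipschitz)
  interpret w: lipschitz_field "variational_field y" L by (rule variational_lipschitz)
  define \<rho> where "\<rho> t = H t x h - H t y h" for t
  define g where "g t = variational_field x t (H t x h) - variational_field y t (H t y h)" for t
  let ?e = "exp (L * t) * norm (x - y) * (exp (L * t) * norm h)"
  have "norm (\<rho> t) \<le> exp ((L + 1) * t) * ?e"
  proof (rule perturbed_growth[where \<rho> = \<rho> and g = g])
    show "(\<rho> has_vector_derivative g s) (at s)" for s
      unfolding \<rho>_def g_def
      by (intro has_vector_derivative_diff v.flow_has_vector_derivative w.flow_has_vector_derivative)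
    show "\<rho> 0 = 0" by (simp add: \<rho>_def)
    fix s assume s: "0 \<le> s" "s \<le> t"
    have e: "exp (L * \<bar>s\<bar>) \<le> exp (L * t)" using s L_pos by simp
    have "norm (\<phi> s x - \<phi> s y) \<le> exp (L * t) * norm (x - y)"
      using flow_separation[of x s y] mult_right_mono[OF e, of "norm (x - y)"] by simp
    moreover have "norm (H s y h) \<le> exp (L * t) * norm h"
      using variational_flow_bound[of y h s] mult_right_mono[OF e, of "norm h"] by simp
    ultimately have "norm (\<phi> s x - \<phi> s y) * norm (H s y h) \<le> ?e" by (intro mult_mono) auto
    moreover have g: "g s = drift_deriv k (\<phi> s x + \<zeta> s) (\<rho> s)
        + (drift_deriv k (\<phi> s x + \<zeta> s) (H s y h) - drift_deriv k (\<phi> s y + \<zeta> s) (H s y h))"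
      by (simp add: g_def \<rho>_def variational_field_def drift_deriv_diff)
    moreover have "norm (drift_deriv k (\<phi> s x + \<zeta> s) (\<rho> s)) \<le> L * norm (\<rho> s)" by (rule norm_drift_deriv)
    moreover have "norm (drift_deriv k (\<phi> s x + \<zeta> s) (H s y h) - drift_deriv k (\<phi> s y + \<zeta> s) (H s y h))
        \<le> norm (\<phi> s x - \<phi> s y) * norm (H s y h)"
      using drift_deriv_lipschitz[of k "\<phi> s x + \<zeta> s" "H s y h" "\<phi> s y + \<zeta> s"] by simp
    ultimately show "norm (g s) \<le> L * norm (\<rho> s) + ?e"
      using norm_triangle_ineq[of "drift_deriv k (\<phi> s x + \<zeta> s) (\<rho> s)"
        "drift_deriv k (\<phi> s x + \<zeta> s) (H s y h) - drift_deriv k (\<phi> s y + \<zeta> s) (H s y h)"]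
      unfolding g[symmetric] by linarith
  qed (use assms L_pos in auto)
  moreover have "exp ((L + 1) * t) * ?e = norm h * exp ((3 * L + 1) * t) * norm (x - y)"
  proof -
    have "(3 * L + 1) * t = (L + 1) * t + L * t + L * t" by (simp add: algebra_simps)
    then have "exp ((3 * L + 1) * t) = exp ((L + 1) * t) * exp (L * t) * exp (L * t)"
      by (simp only: exp_add)
    then show ?thesis by simp
  qed
  ultimately show ?thesis by (simp add: \<rho>_def)
qed

text \<open>Matrix entries are components of \<open>H t x\<close> on basis vectors, so joint
  continuity is checked for one fixed vector at a time.\<close>

lemma flow_jacobian_continuous: "continuous_on ({0..} \<times> UNIV) (\<lambda>(t, x). flow_jacobian t x)"
proof -
  have H: "continuous_on ({0..} \<times> UNIV) (\<lambda>(t, x). H t x h)" for h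
  proof (rule jointly_continuous[where C = "norm h" and c = "3 * L + 1"])
    show "continuous_on {0..} (\<lambda>t. H t x h)" for x
      by (rule lipschitz_field.flow_continuous[OF variational_lipschitz])
    show "dist (H t x h) (H t y h) \<le> norm h * exp ((3 * L + 1) * t) * dist x y" if "0 \<le> t" for t x y
      using variational_flow_lipschitz[OF that] by (simp add: dist_norm)
  qed (use L_pos in auto)
  show ?thesis
    unfolding flow_jacobian_def matrix_def case_prod_beta
    by (intro continuous_on_vec_lambda continuous_on_component H[unfolded case_prod_beta])
qed

lemma flow_jointly_continuous: "continuous_on ({0..} \<times> UNIV) (\<lambda>(t, x). \<phi> t x)"
proof (rule jointly_continuous[where C = 1 and c = L])
  show "continuous_on {0..} (\<lambda>t. \<phi> t x)" for x by (rule flow_continuous)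
  show "dist (\<phi> t x) (\<phi> t y) \<le> 1 * exp (L * t) * dist x y" if "0 \<le> t" for t x y
    using flow_separation[of x t y] that by (simp add: dist_norm)
qed (use L_pos in auto)

end

section \<open>Dissipation and order\<close>

abbreviation first_index :: "'n::{finite,linorder}" where
  "first_index \<equiv> Min UNIV"

text \<open>The exponent is the rank of \<open>i\<close> in the chain; comparison with the Euclidean
  norm therefore costs at most a factor \<open>2 ^ CARD('n)\<close>.\<close>

definition index_weight :: "'n::{finite,linorder} \<Rightarrow> real" where
  "index_weight i = (1 / 2) ^ card {l. l < i}"

definition energy :: "('n::{finite,linorder}) rvec \<Rightarrow> real" where
  "energy h = (\<Sum>i\<in>UNIV. index_weight i * (h $ i)\<^sup>2)"

text \<open>Distance from the diagonal with the first phase as reference. It does not change under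
  translation along the diagonal, so it captures the non-periodic part of a point of the
  quotient.\<close>

definition deviation :: "('n::{finite,linorder}) rvec \<Rightarrow> 'n rvec" where
  "deviation x = x - (x $ first_index) *\<^sub>R ones"

lemma ones_nth [simp]: "ones $ i = 1"
  by (simp add: ones_def)

lemma lessThan_pred_index:
  "i \<noteq> first_index \<Longrightarrow> {l. l < i} = insert (pred_index i) {l. l < pred_index i}"
  using pred_index_less[of i] le_pred_index[of _ i] by force

lemma card_lessThan_pred_index:
  "i \<noteq> first_index \<Longrightarrow> card {l. l < i} = Suc (card {l. l < pred_index i})"
  by (subst lessThan_pred_index) auto

lemma index_weight_pred: "i \<noteq> first_index \<Longrightarrow> index_weight (pred_index i) = 2 * index_weight i"
  by (simp add: index_weight_def card_lessThan_pred_index)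

lemma index_weight_pos: "index_weight i > 0"
  by (simp add: index_weight_def)

lemma index_weight_le_1: "index_weight i \<le> 1"
  by (simp add: index_weight_def power_le_one)

lemma index_weight_ge: "index_weight (i::'n::{finite,linorder}) \<ge> (1 / 2) ^ CARD('n)"
  unfolding index_weight_def by (rule power_decreasing) (auto intro: card_mono)

lemma energy_nonneg: "energy h \<ge> 0"
  unfolding energy_def by (intro sum_nonneg mult_nonneg_nonneg) (simp_all add: index_weight_pos less_imp_le)

lemma energy_le_norm: "energy h \<le> (norm h)\<^sup>2"
  unfolding energy_def power2_norm_vec
  by (intro sum_mono mult_left_le_one_le) (simp_all add: index_weight_pos less_imp_le index_weight_le_1)

lemma norm_le_energy:
  fixes h :: "('n::{finite,linorder}) rvec"
  shows "(norm h)\<^sup>2 \<le> 2 ^ CARD('n) * energy h"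
proof -
  have "(1 / 2) ^ CARD('n) * (norm h)\<^sup>2 \<le> energy h"
    unfolding energy_def power2_norm_vec sum_distrib_left
    by (intro sum_mono mult_right_mono index_weight_ge) auto
  then show ?thesis by (simp add: field_simps)
qed

lemma power2_add_le: "(a + b)\<^sup>2 \<le> 2 * a\<^sup>2 + 2 * b\<^sup>2" for a b :: real
  using sum_squares_bound[of a b] by (simp add: power2_sum)

lemma energy_diff_le: "energy (u - v) \<le> 2 * energy u + 2 * energy v"
proof -
  have "index_weight i * ((u - v) $ i)\<^sup>2 \<le> 2 * (index_weight i * (u $ i)\<^sup>2) + 2 * (index_weight i * (v $ i)\<^sup>2)" for i
  proof -
    have "((u - v) $ i)\<^sup>2 \<le> 2 * (u $ i)\<^sup>2 + 2 * (v $ i)\<^sup>2"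
      using zero_le_power2[of "u $ i + v $ i"] by (simp add: power2_eq_square algebra_simps)
    from mult_left_mono[OF this, of "index_weight i"] show ?thesis
      by (simp add: algebra_simps index_weight_pos less_imp_le)
  qed
  then show ?thesis
    unfolding energy_def sum_distrib_left sum.distrib[symmetric] by (intro sum_mono)
qed

lemma energy_continuous: "continuous_on S energy"
  unfolding energy_def by (intro continuous_intros)

lemma deviation_first [simp]: "deviation x $ first_index = 0"
  by (simp add: deviation_def)

lemma deviation_scaleR_ones [simp]: "deviation (c *\<^sub>R ones) = 0"
  by (simp add: deviation_def)

lemma energy_0 [simp]: "energy 0 = 0"
  by (simp add: energy_def)

lemma deviation_diff: "x $ first_index = y $ first_index \<Longrightarrow> x - y = deviation x - deviation y"
  by (simp add: deviation_def)

lemma deviation_continuous: "continuous_on S deviation"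
  unfolding deviation_def by (intro continuous_intros)

text \<open>
  Unidirectional coupling lets each component be damped against its predecessor only; halving the
  weight at each step makes the damping absorb the cross terms.
\<close>

lemma energy_dissipation:
  fixes h h' :: "('n::{finite,linorder}) rvec" and k R :: real
  assumes k: "k \<ge> 8" and h0: "h $ first_index = 0"
    and le: "\<And>i. i \<noteq> first_index \<Longrightarrow> \<bar>h' $ i - k * (h $ pred_index i - h $ i)\<bar> \<le> \<bar>h $ i\<bar> + R"
  shows "(\<Sum>i\<in>UNIV. index_weight i * (2 * (h $ i * h' $ i))) \<le> - energy h + CARD('n) * R\<^sup>2"
proof -
  let ?w = index_weight and ?F = "- {first_index :: 'n}"
  have "(\<Sum>i\<in>UNIV. ?w i * (2 * (h $ i * h' $ i))) = (\<Sum>i\<in>?F. ?w i * (2 * (h $ i * h' $ i)))"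
    by (rule sum.mono_neutral_right) (use h0 in auto)
  also have "\<dots> \<le> (\<Sum>i\<in>?F. k / 2 * (?w (pred_index i) * (h $ pred_index i)\<^sup>2)
      + (3 - k) * (?w i * (h $ i)\<^sup>2) + ?w i * R\<^sup>2)"
  proof (rule sum_mono)
    fix i assume i: "i \<in> ?F"
    define r where "r = h' $ i - k * (h $ pred_index i - h $ i)"
    have r: "\<bar>r\<bar> \<le> \<bar>h $ i\<bar> + R" unfolding r_def by (rule le) (use i in simp)
    have "h $ i * r \<le> \<bar>h $ i\<bar> * \<bar>r\<bar>" by (metis abs_ge_self abs_mult)
    also have "\<dots> \<le> \<bar>h $ i\<bar> * (\<bar>h $ i\<bar> + R)" using r by (rule mult_left_mono) simp
    finally have "2 * (h $ i * r) \<le> 2 * (h $ i)\<^sup>2 + 2 * \<bar>h $ i\<bar> * R"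
      by (simp add: power2_eq_square algebra_simps)
    moreover have "2 * \<bar>h $ i\<bar> * R \<le> (h $ i)\<^sup>2 + R\<^sup>2"
      using sum_squares_bound[of "\<bar>h $ i\<bar>" R] by simp
    moreover have "k * (2 * h $ i * h $ pred_index i) \<le> k * ((h $ i)\<^sup>2 + (h $ pred_index i)\<^sup>2)"
      using sum_squares_bound[of "h $ i" "h $ pred_index i"] k by (intro mult_left_mono) auto
    moreover have "2 * (h $ i * h' $ i) = k * (2 * h $ i * h $ pred_index i) - 2 * k * (h $ i)\<^sup>2 + 2 * (h $ i * r)"
      by (simp add: r_def power2_eq_square algebra_simps)
    \<comment> \<open>The coefficient 3 is 2 from the term \<open>|h $ i|\<close> in the bound on
      \<open>r\<close> plus 1 from splitting its product with \<open>R\<close>; the cross term uses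
      up half of the damping \<open>- 2 * k\<close>.\<close>
    ultimately have "2 * (h $ i * h' $ i) \<le> k * (h $ pred_index i)\<^sup>2 + (3 - k) * (h $ i)\<^sup>2 + R\<^sup>2"
      by (simp add: algebra_simps)
    from mult_left_mono[OF this, of "?w i"]
    show "?w i * (2 * (h $ i * h' $ i)) \<le> k / 2 * (?w (pred_index i) * (h $ pred_index i)\<^sup>2)
      + (3 - k) * (?w i * (h $ i)\<^sup>2) + ?w i * R\<^sup>2"
      using i by (simp add: index_weight_pred index_weight_pos less_imp_le algebra_simps)
  qed
  also have "\<dots> = k / 2 * (\<Sum>i\<in>?F. ?w (pred_index i) * (h $ pred_index i)\<^sup>2)
      + (3 - k) * (\<Sum>i\<in>?F. ?w i * (h $ i)\<^sup>2) + (\<Sum>i\<in>?F. ?w i * R\<^sup>2)"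
    by (simp add: sum.distrib sum_distrib_left)
  also have "(\<Sum>i\<in>?F. ?w i * (h $ i)\<^sup>2) = energy h"
    unfolding energy_def by (rule sum.mono_neutral_left) (use h0 in auto)
  \<comment> \<open>Each index is the predecessor of at most one other, so the predecessors
    contribute no more than the full energy.\<close>
  also have "k / 2 * (\<Sum>i\<in>?F. ?w (pred_index i) * (h $ pred_index i)\<^sup>2) \<le> k / 2 * energy h"
    unfolding energy_def using k
    by (intro mult_left_mono sum_pred_index_le[of "\<lambda>i. ?w i * (h $ i)\<^sup>2"]) (auto simp: index_weight_pos less_imp_le)
  also have "(\<Sum>i\<in>?F. ?w i * R\<^sup>2) \<le> (\<Sum>i\<in>(UNIV :: 'n set). R\<^sup>2)"
  proof -
    have "(\<Sum>i\<in>?F. ?w i * R\<^sup>2) \<le> (\<Sum>i\<in>?F. R\<^sup>2)"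
      by (intro sum_mono mult_left_le_one_le) (auto simp: index_weight_pos less_imp_le index_weight_le_1)
    also have "\<dots> \<le> (\<Sum>i\<in>(UNIV :: 'n set). R\<^sup>2)" by (rule sum_mono2) auto
    finally show ?thesis .
  qed
  finally have "(\<Sum>i\<in>UNIV. ?w i * (2 * (h $ i * h' $ i))) \<le> (3 - k / 2) * energy h + CARD('n) * R\<^sup>2"
    by (simp add: algebra_simps)
  moreover have "(3 - k / 2) * energy h \<le> (- 1) * energy h"
    using k energy_nonneg by (intro mult_right_mono) auto
  ultimately show ?thesis by simp
qed

lemma has_real_derivative_vec_nth:
  assumes "(u has_vector_derivative u') (at t)"
  shows "((\<lambda>t. u t $ i) has_real_derivative u' $ i) (at t)"
  unfolding has_real_derivative_iff_has_vector_derivative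
  by (rule bounded_linear.has_vector_derivative[OF bounded_linear_vec_nth assms])

lemma energy_has_derivative:
  assumes "(h has_vector_derivative h') (at t)"
  shows "((\<lambda>t. energy (h t)) has_real_derivative (\<Sum>i\<in>UNIV. index_weight i * (2 * (h t $ i * h' $ i)))) (at t)"
  unfolding energy_def
  by (rule DERIV_sum) (auto intro!: derivative_eq_intros has_real_derivative_vec_nth[OF assms])

lemma driven_field_nth:
  "driven_field k \<alpha> \<zeta> t x $ i =
     k * (if i = first_index then 0 else (x + \<zeta> t) $ pred_index i - (x + \<zeta> t) $ i)
       + (\<alpha> $ i - sin ((x + \<zeta> t) $ i)) + \<zeta> t $ i"
  by (simp add: driven_field_def drift_def coupling_mult)

section \<open>Temperedness of the driving path\<close>

text \<open>Weights \<open>q\<close> as below majorize \<open>\<integral> exp (- \<gamma> (t - r)) (1 + |\<zeta> r|\<^sup>2) dr\<close> over \<open>r \<le> t\<close>.\<close>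

definition tempering :: "real \<Rightarrow> (real \<Rightarrow> ('n::finite) rvec) \<Rightarrow> (real \<Rightarrow> real) \<Rightarrow> bool" where
  "tempering \<gamma> \<zeta> q \<longleftrightarrow> (\<forall>t. q t \<ge> 0) \<and>
     (\<forall>t. (q has_real_derivative - \<gamma> * q t + 1 + (norm (\<zeta> t))\<^sup>2) (at t))"

text \<open>Read backwards in time, discarding the nonnegative forcing leaves growth into the past
  at rate at most \<gamma>.\<close>

lemma tempering_growth:
  assumes q: "tempering \<gamma> \<zeta> q" and "t \<le> 0"
  shows "q t \<le> exp (- \<gamma> * t) * q 0"
proof -
  have "- q 0 \<le> exp (- \<gamma> * (0 - t)) * (- q t)"
  proof (rule linear_differential_inequality[OF \<open>t \<le> 0\<close>])
    show "((\<lambda>t. - q t) has_real_derivative - (- \<gamma> * q \<tau> + 1 + (norm (\<zeta> \<tau>))\<^sup>2)) (at \<tau>)" for \<tau>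
      by (rule DERIV_minus) (use q in \<open>simp add: tempering_def\<close>)
    show "- (- \<gamma> * q \<tau> + 1 + (norm (\<zeta> \<tau>))\<^sup>2) \<le> - \<gamma> * - q \<tau>" for \<tau>
      by (simp add: order_trans[OF _ zero_le_power2])
  qed
  then have "exp (- \<gamma> * t) * (exp (\<gamma> * t) * q t) \<le> exp (- \<gamma> * t) * q 0" by simp
  then show ?thesis by (simp add: mult.assoc[symmetric] exp_add[symmetric])
qed

lemma tempering_shift: "tempering \<gamma> \<zeta> q \<Longrightarrow> tempering \<gamma> (\<lambda>t. \<zeta> (s + t)) (\<lambda>t. q (s + t))"
  unfolding tempering_def by (auto simp: DERIV_shift[of q _ _ s, symmetric] add.commute)

text \<open>Every rate is demanded: the slow manifold uses a rate below that of the contraction, and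
  temperedness of the attractor uses arbitrarily small ones.\<close>

definition tempered_driver :: "(real \<Rightarrow> ('n::finite) rvec) \<Rightarrow> bool" where
  "tempered_driver \<zeta> \<longleftrightarrow> continuous_on UNIV \<zeta> \<and> (\<forall>\<gamma>>0. \<exists>q. tempering \<gamma> \<zeta> q)"

lemma tempered_driver_shift: "tempered_driver \<zeta> \<Longrightarrow> tempered_driver (\<lambda>t. \<zeta> (s + t))"
  unfolding tempered_driver_def
proof (intro conjI allI impI; elim conjE)
  assume "continuous_on UNIV \<zeta>"
  then show "continuous_on UNIV (\<lambda>t. \<zeta> (s + t))"
    by (rule continuous_on_compose2) (auto intro: continuous_intros)
next
  fix \<gamma> :: real assume "\<gamma> > 0" "\<forall>\<gamma>>0. \<exists>q. tempering \<gamma> \<zeta> q"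
  then show "\<exists>q. tempering \<gamma> (\<lambda>t. \<zeta> (s + t)) q" using tempering_shift by blast
qed

text \<open>Comes from squaring the bound
  \<open>(2 * k + 2) * norm (\<zeta> t) + (2 * norm \<alpha> + 2)\<close> on the terms that push a
  trajectory off the diagonal, once for each phase.\<close>

definition forcing_constant :: "real \<Rightarrow> ('n::finite) rvec \<Rightarrow> real" where
  "forcing_constant k \<alpha> = CARD('n) * (2 * (2 * k + 2)\<^sup>2 + 2 * (2 * norm \<alpha> + 2)\<^sup>2)"

lemma forcing_constant_nonneg: "forcing_constant k \<alpha> \<ge> 0"
  by (simp add: forcing_constant_def)

section \<open>Order, equivariance and contraction of the driven flow\<close>

context driven_system
begin

text \<open>No coupling enters the first component, so the difference obeys a scalar equation with
  the 1-Lipschitz sine, in both directions of time.\<close>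

lemma first_coordinate_growth:
  "\<bar>\<phi> t x $ first_index - \<phi> t y $ first_index\<bar> \<le> exp \<bar>t - s\<bar> * \<bar>\<phi> s x $ first_index - \<phi> s y $ first_index\<bar>"
proof -
  define h where "h t = \<phi> t x $ first_index - \<phi> t y $ first_index" for t
  have "norm (h t) \<le> exp (1 * \<bar>t - s\<bar>) * norm (h s)"
  proof (rule norm_growth_bound)
    show "(h has_vector_derivative driven_field k \<alpha> \<zeta> t (\<phi> t x) $ first_index
        - driven_field k \<alpha> \<zeta> t (\<phi> t y) $ first_index) (at t)" for t
      unfolding h_def has_real_derivative_iff_has_vector_derivative[symmetric]
      by (intro DERIV_diff has_real_derivative_vec_nth flow_has_vector_derivative)
    show "norm (driven_field k \<alpha> \<zeta> t (\<phi> t x) $ first_index - driven_field k \<alpha> \<zeta> t (\<phi> t y) $ first_index)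
        \<le> 1 * norm (h t)" for t
      using abs_sin_diff_le[of "\<phi> t y $ first_index + \<zeta> t $ first_index" "\<phi> t x $ first_index + \<zeta> t $ first_index"]
      by (simp add: driven_field_nth h_def abs_minus_commute)
  qed
  then show ?thesis by (simp add: h_def)
qed

lemma first_coordinate_cong:
  assumes "\<phi> s x $ first_index = \<phi> s y $ first_index"
  shows "\<phi> t x $ first_index = \<phi> t y $ first_index"
  using first_coordinate_growth[where s = s and t = t and x = x and y = y] assms by simp

lemma first_coordinate_forward:
  assumes "s \<le> t" "\<phi> s x $ first_index \<le> \<phi> s y $ first_index"
  shows "\<phi> t x $ first_index \<le> \<phi> t y $ first_index"
proof -
  have "0 \<le> \<phi> t y $ first_index - \<phi> t x $ first_index"
  proof (rule nonneg_preserved[OF \<open>s \<le> t\<close>, where L = 1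
        and h = "\<lambda>\<tau>. \<phi> \<tau> y $ first_index - \<phi> \<tau> x $ first_index"])
    fix \<tau>
    show "((\<lambda>\<tau>. \<phi> \<tau> y $ first_index - \<phi> \<tau> x $ first_index) has_real_derivative
       driven_field k \<alpha> \<zeta> \<tau> (\<phi> \<tau> y) $ first_index - driven_field k \<alpha> \<zeta> \<tau> (\<phi> \<tau> x) $ first_index) (at \<tau>)"
      by (intro DERIV_diff has_real_derivative_vec_nth flow_has_vector_derivative)
    assume "\<phi> \<tau> y $ first_index - \<phi> \<tau> x $ first_index < 0"
    then show "1 * (\<phi> \<tau> y $ first_index - \<phi> \<tau> x $ first_index)
        \<le> driven_field k \<alpha> \<zeta> \<tau> (\<phi> \<tau> y) $ first_index - driven_field k \<alpha> \<zeta> \<tau> (\<phi> \<tau> x) $ first_index"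
      using abs_sin_diff_le[of "\<phi> \<tau> y $ first_index + \<zeta> \<tau> $ first_index" "\<phi> \<tau> x $ first_index + \<zeta> \<tau> $ first_index"]
      by (simp add: driven_field_nth)
  qed (use assms in auto)
  then show ?thesis by simp
qed

text \<open>For negative \<open>t\<close>, a reversed order at time \<open>t\<close> would be
  carried forward to time 0, forcing equality there and hence at \<open>t\<close>.\<close>

lemma first_coordinate_mono:
  assumes "x $ first_index \<le> y $ first_index"
  shows "\<phi> t x $ first_index \<le> \<phi> t y $ first_index"
proof (cases "0 \<le> t")
  case True
  then show ?thesis using first_coordinate_forward[of 0 t x y] assms by simp
next
  case False
  show ?thesis
  proof (rule ccontr)
    assume n: "\<not> ?thesis"
    then have "y $ first_index \<le> x $ first_index"
      using first_coordinate_forward[of t 0 y x] False by simp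
    then have "\<phi> t x $ first_index = \<phi> t y $ first_index"
      using first_coordinate_cong[where s = 0 and x = x and y = y and t = t] assms by simp
    then show False using n by simp
  qed
qed

text \<open>Induction along the chain: where component \<open>i\<close> of the difference is
  negative, the predecessor being ordered already makes the coupling term nonnegative, and the sine
  alone limits the decrease.\<close>

lemma flow_mono:
  assumes "k \<ge> 0" "x \<le> y" "0 \<le> t"
  shows "\<phi> t x \<le> \<phi> t y"
proof -
  have "\<phi> t x $ i \<le> \<phi> t y $ i" if "0 \<le> t" for t i
    using that
  proof (induction "card {l. l < i}" arbitrary: i t rule: less_induct)
    case less
    show ?case
    proof (cases "i = first_index")
      case True
      then show ?thesis using first_coordinate_mono assms by (simp add: less_eq_vec_def)
    next
      case False
      let ?p = "pred_index i"
      have IH: "\<phi> t x $ ?p \<le> \<phi> t y $ ?p" if "0 \<le> t" for t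
        by (rule less.hyps[OF _ that]) (simp add: card_lessThan_pred_index[OF False])
      have "0 \<le> \<phi> t y $ i - \<phi> t x $ i"
      proof (rule nonneg_preserved[OF less.prems, where L = 1 and h = "\<lambda>\<tau>. \<phi> \<tau> y $ i - \<phi> \<tau> x $ i"])
        fix \<tau> :: real assume \<tau>: "0 \<le> \<tau>"
        show "((\<lambda>\<tau>. \<phi> \<tau> y $ i - \<phi> \<tau> x $ i) has_real_derivative
            driven_field k \<alpha> \<zeta> \<tau> (\<phi> \<tau> y) $ i - driven_field k \<alpha> \<zeta> \<tau> (\<phi> \<tau> x) $ i) (at \<tau>)"
          by (intro DERIV_diff has_real_derivative_vec_nth flow_has_vector_derivative)
        assume neg: "\<phi> \<tau> y $ i - \<phi> \<tau> x $ i < 0"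
        have "k * ((\<phi> \<tau> y $ ?p - \<phi> \<tau> x $ ?p) - (\<phi> \<tau> y $ i - \<phi> \<tau> x $ i)) \<ge> 0"
          using IH[OF \<tau>] neg \<open>k \<ge> 0\<close> by (intro mult_nonneg_nonneg) auto
        moreover have "sin (\<phi> \<tau> y $ i + \<zeta> \<tau> $ i) - sin (\<phi> \<tau> x $ i + \<zeta> \<tau> $ i) \<le> - (\<phi> \<tau> y $ i - \<phi> \<tau> x $ i)"
          using abs_sin_diff_le[of "\<phi> \<tau> y $ i + \<zeta> \<tau> $ i" "\<phi> \<tau> x $ i + \<zeta> \<tau> $ i"] neg by linarith
        moreover have "driven_field k \<alpha> \<zeta> \<tau> (\<phi> \<tau> y) $ i - driven_field k \<alpha> \<zeta> \<tau> (\<phi> \<tau> x) $ i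
            = k * ((\<phi> \<tau> y $ ?p - \<phi> \<tau> x $ ?p) - (\<phi> \<tau> y $ i - \<phi> \<tau> x $ i))
              - (sin (\<phi> \<tau> y $ i + \<zeta> \<tau> $ i) - sin (\<phi> \<tau> x $ i + \<zeta> \<tau> $ i))"
          using False by (simp add: driven_field_nth algebra_simps)
        ultimately show "1 * (\<phi> \<tau> y $ i - \<phi> \<tau> x $ i)
            \<le> driven_field k \<alpha> \<zeta> \<tau> (\<phi> \<tau> y) $ i - driven_field k \<alpha> \<zeta> \<tau> (\<phi> \<tau> x) $ i"
          by simp
      qed (use assms in \<open>simp add: less_eq_vec_def\<close>)
      then show ?thesis by simp
    qed
  qed
  then show ?thesis using assms by (simp add: less_eq_vec_def)
qed

text \<open>Diagonal translations cancel in the coupling, and multiples of \<open>2 * pi\<close> are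
  periods of the sine.\<close>

lemma flow_translate: "\<phi> t (x + (2 * pi * of_int m) *\<^sub>R ones) = \<phi> t x + (2 * pi * of_int m) *\<^sub>R ones"
proof -
  let ?c = "(2 * pi * of_int m) *\<^sub>R ones :: 'n rvec"
  have "driven_field k \<alpha> \<zeta> t (y + ?c) = driven_field k \<alpha> \<zeta> t y" for t y
  proof -
    have "sin (y $ i + 2 * pi * of_int m + \<zeta> t $ i) = sin (y $ i + \<zeta> t $ i)" for i
      using sin.plus_of_int[of "y $ i + \<zeta> t $ i" m] by (simp add: algebra_simps)
    then show ?thesis by (simp add: vec_eq_iff driven_field_nth)
  qed
  then have "((\<lambda>t. \<phi> t x + ?c) has_vector_derivative driven_field k \<alpha> \<zeta> t (\<phi> t x + ?c)) (at t)" for t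
    using flow_has_vector_derivative[of x t] by (auto intro!: derivative_eq_intros)
  from flow_unique[where u = "\<lambda>t. \<phi> t x + ?c" and t = t, OF this] show ?thesis by simp
qed

text \<open>Equality of the first components persists, so the difference satisfies
  \<open>energy_dissipation\<close> with \<open>R = 0\<close>. The times may be negative, as the
  pullback argument requires.\<close>

lemma energy_contraction:
  assumes k: "k \<ge> 8" and "s \<le> t" and eq: "x $ first_index = y $ first_index"
  shows "energy (\<phi> t x - \<phi> t y) \<le> exp (- (t - s)) * energy (\<phi> s x - \<phi> s y)"
proof -
  define h where "h t = \<phi> t x - \<phi> t y" for t
  define h' where "h' t = driven_field k \<alpha> \<zeta> t (\<phi> t x) - driven_field k \<alpha> \<zeta> t (\<phi> t y)" for t
  have "energy (h t) \<le> exp (- 1 * (t - s)) * energy (h s)"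
  proof (rule linear_differential_inequality[OF \<open>s \<le> t\<close>])
    fix \<tau>
    have "(h has_vector_derivative h' \<tau>) (at \<tau>)"
      unfolding h_def h'_def by (intro has_vector_derivative_diff flow_has_vector_derivative)
    then show "((\<lambda>t. energy (h t)) has_real_derivative
        (\<Sum>i\<in>UNIV. index_weight i * (2 * (h \<tau> $ i * h' \<tau> $ i)))) (at \<tau>)"
      by (rule energy_has_derivative)
    have "(\<Sum>i\<in>UNIV. index_weight i * (2 * (h \<tau> $ i * h' \<tau> $ i))) \<le> - energy (h \<tau>) + real CARD('n) * 0\<^sup>2"
    proof (rule energy_dissipation[OF k])
      show "h \<tau> $ first_index = 0"
        using first_coordinate_cong[where s = 0 and x = x and y = y and t = \<tau>] eq by (simp add: h_def)
      fix i :: 'n assume i: "i \<noteq> first_index"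
      have "h' \<tau> $ i - k * (h \<tau> $ pred_index i - h \<tau> $ i)
          = - (sin (\<phi> \<tau> x $ i + \<zeta> \<tau> $ i) - sin (\<phi> \<tau> y $ i + \<zeta> \<tau> $ i))"
        using i by (simp add: h_def h'_def driven_field_nth algebra_simps)
      then show "\<bar>h' \<tau> $ i - k * (h \<tau> $ pred_index i - h \<tau> $ i)\<bar> \<le> \<bar>h \<tau> $ i\<bar> + 0"
        using abs_sin_diff_le[of "\<phi> \<tau> x $ i + \<zeta> \<tau> $ i" "\<phi> \<tau> y $ i + \<zeta> \<tau> $ i"]
        by (simp add: h_def abs_minus_commute)
    qed
    then show "(\<Sum>i\<in>UNIV. index_weight i * (2 * (h \<tau> $ i * h' \<tau> $ i))) \<le> - 1 * energy (h \<tau>)" by simp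
  qed
  then show ?thesis by (simp add: h_def)
qed

text \<open>The diagonal is not invariant: driver, frequencies and sines force trajectories off it.
  The equation of \<open>q\<close> carries the same forcing, and with
  \<open>\<gamma> \<le> 1\<close> the difference of the energy and
  \<open>forcing_constant k \<alpha> * q\<close> still decays at rate 1.\<close>

lemma energy_deviation:
  assumes k: "k \<ge> 8" and "s \<le> t" and q: "tempering \<gamma> \<zeta> q" and \<gamma>: "\<gamma> \<le> 1"
  shows "energy (deviation (\<phi> t x)) \<le> forcing_constant k \<alpha> * q t + exp (- (t - s)) * energy (deviation (\<phi> s x))"
proof -
  let ?C = "forcing_constant k \<alpha>"
  define h where "h t = deviation (\<phi> t x)" for t
  define h' where "h' t = deviation (driven_field k \<alpha> \<zeta> t (\<phi> t x))" for t
  define e' where "e' t = (\<Sum>i\<in>UNIV. index_weight i * (2 * (h t $ i * h' t $ i)))" for t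
  have q0: "q t \<ge> 0" for t using q by (simp add: tempering_def)
  have "energy (h t) - ?C * q t \<le> exp (- 1 * (t - s)) * (energy (h s) - ?C * q s)"
  proof (rule linear_differential_inequality[OF \<open>s \<le> t\<close>])
    fix \<tau>
    have "(h has_vector_derivative h' \<tau>) (at \<tau>)"
      unfolding h_def h'_def deviation_def
      by (intro has_vector_derivative_diff flow_has_vector_derivative)
        (rule bounded_linear.has_vector_derivative[OF bounded_linear_scaleR_left]
          bounded_linear.has_vector_derivative[OF bounded_linear_vec_nth] flow_has_vector_derivative)+
    from energy_has_derivative[OF this]
    show "((\<lambda>t. energy (h t) - ?C * q t) has_real_derivative
        e' \<tau> - ?C * (- \<gamma> * q \<tau> + 1 + (norm (\<zeta> \<tau>))\<^sup>2)) (at \<tau>)"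
      unfolding e'_def by (intro DERIV_diff DERIV_cmult) (use q in \<open>simp_all add: tempering_def\<close>)
    define R where "R = (2 * k + 2) * norm (\<zeta> \<tau>) + (2 * norm \<alpha> + 2)"
    have "e' \<tau> \<le> - energy (h \<tau>) + CARD('n) * R\<^sup>2"
      unfolding e'_def
    proof (rule energy_dissipation[OF k])
      show "h \<tau> $ first_index = 0" by (simp add: h_def)
      fix i :: 'n assume i: "i \<noteq> first_index"
      have eq: "h' \<tau> $ i - k * (h \<tau> $ pred_index i - h \<tau> $ i)
          = k * (\<zeta> \<tau> $ pred_index i - \<zeta> \<tau> $ i) + (\<alpha> $ i - \<alpha> $ first_index)
            - (sin ((\<phi> \<tau> x + \<zeta> \<tau>) $ i) - sin ((\<phi> \<tau> x + \<zeta> \<tau>) $ first_index))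
            + (\<zeta> \<tau> $ i - \<zeta> \<tau> $ first_index)"
        using i by (simp add: h_def h'_def deviation_def driven_field_nth algebra_simps)
      have z: "\<bar>\<zeta> \<tau> $ j\<bar> \<le> norm (\<zeta> \<tau>)" "\<bar>\<alpha> $ j\<bar> \<le> norm \<alpha>" for j
        by (rule component_le_norm_cart)+
      have "\<bar>k * (\<zeta> \<tau> $ pred_index i - \<zeta> \<tau> $ i)\<bar> \<le> k * (2 * norm (\<zeta> \<tau>))"
        unfolding abs_mult using k z(1)[of i] z(1)[of "pred_index i"]
        by (intro mult_mono) auto
      moreover have "\<bar>\<alpha> $ i - \<alpha> $ first_index\<bar> \<le> 2 * norm \<alpha>"
        using z(2)[of i] z(2)[of first_index] by linarith
      moreover have "\<bar>\<zeta> \<tau> $ i - \<zeta> \<tau> $ first_index\<bar> \<le> 2 * norm (\<zeta> \<tau>)"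
        using z(1)[of i] z(1)[of first_index] by linarith
      moreover have "\<bar>sin ((\<phi> \<tau> x + \<zeta> \<tau>) $ i) - sin ((\<phi> \<tau> x + \<zeta> \<tau>) $ first_index)\<bar> \<le> 2"
        using abs_sin_le_one[of "(\<phi> \<tau> x + \<zeta> \<tau>) $ i"] abs_sin_le_one[of "(\<phi> \<tau> x + \<zeta> \<tau>) $ first_index"]
        by linarith
      moreover have "R = k * (2 * norm (\<zeta> \<tau>)) + 2 * norm \<alpha> + 2 * norm (\<zeta> \<tau>) + 2"
        by (simp add: R_def algebra_simps)
      ultimately have "\<bar>h' \<tau> $ i - k * (h \<tau> $ pred_index i - h \<tau> $ i)\<bar> \<le> R"
        unfolding eq by linarith
      then show "\<bar>h' \<tau> $ i - k * (h \<tau> $ pred_index i - h \<tau> $ i)\<bar> \<le> \<bar>h \<tau> $ i\<bar> + R" by simp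
    qed
    moreover have "CARD('n) * R\<^sup>2 \<le> ?C * (1 + (norm (\<zeta> \<tau>))\<^sup>2)"
    proof -
      let ?a = "(2 * k + 2)\<^sup>2" and ?b = "(2 * norm \<alpha> + 2)\<^sup>2" and ?z = "(norm (\<zeta> \<tau>))\<^sup>2"
      have "R\<^sup>2 \<le> 2 * ((2 * k + 2) * norm (\<zeta> \<tau>))\<^sup>2 + 2 * ?b"
        unfolding R_def by (rule power2_add_le)
      also have "\<dots> = 2 * ?a * ?z + 2 * ?b" by (simp add: power_mult_distrib)
      also have "\<dots> \<le> (2 * ?a + 2 * ?b) * (1 + ?z)"
        by (simp add: algebra_simps)
      finally have "CARD('n) * R\<^sup>2 \<le> CARD('n) * ((2 * ?a + 2 * ?b) * (1 + ?z))"
        by (rule mult_left_mono) simp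
      then show ?thesis by (simp add: forcing_constant_def mult.assoc)
    qed
    moreover have "?C * (\<gamma> * q \<tau>) \<le> ?C * q \<tau>"
      using mult_right_mono[OF \<gamma> q0[of \<tau>]] by (intro mult_left_mono forcing_constant_nonneg) simp
    ultimately show "e' \<tau> - ?C * (- \<gamma> * q \<tau> + 1 + (norm (\<zeta> \<tau>))\<^sup>2) \<le> - 1 * (energy (h \<tau>) - ?C * q \<tau>)"
      by (simp add: algebra_simps)
  qed
  also have "\<dots> \<le> exp (- 1 * (t - s)) * energy (h s)"
    using q0[of s] by (intro mult_left_mono) (auto simp: forcing_constant_nonneg)
  finally show ?thesis by (simp add: h_def)
qed

end

section \<open>The slow manifold\<close>

lemma driven_field_shift:
  "driven_field k \<alpha> (\<lambda>t. \<zeta> (s + t)) = (\<lambda>t. driven_field k \<alpha> \<zeta> (s + t))"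
  by (simp add: driven_field_def fun_eq_iff)

context driven_system
begin

lemma driven_system_shift: "driven_system (\<lambda>t. \<zeta> (s + t))"
proof
  show "continuous_on UNIV (\<lambda>t. \<zeta> (s + t))"
    by (rule continuous_on_compose2[OF driver_continuous]) (auto intro: continuous_intros)
qed

lemma flow_shift:
  "\<phi> (s + t) x = flow (driven_field k \<alpha> (\<lambda>t. \<zeta> (s + t))) (\<phi> s x) t"
  unfolding driven_field_shift by (rule flow_cocycle)

lemma flow_shift_inverse:
  "\<phi> s (flow (driven_field k \<alpha> (\<lambda>t. \<zeta> (s + t))) y (- s)) = y"
proof -
  interpret sh: driven_system k \<alpha> "\<lambda>t. \<zeta> (s + t)" by (rule driven_system_shift)
  show ?thesis using sh.flow_shift[where s = "- s" and t = s and x = y] by simp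
qed

end

text \<open>The backward flow locates the first phase at time \<open>- n\<close>; the state is then
  reset to the diagonal and run forward in the time frame shifted by \<open>- n\<close>.\<close>

definition pullback ::
    "real \<Rightarrow> ('n::{finite,linorder}) rvec \<Rightarrow> (real \<Rightarrow> 'n rvec) \<Rightarrow> nat \<Rightarrow> real \<Rightarrow> 'n rvec" where
  "pullback k \<alpha> \<zeta> n a = flow (driven_field k \<alpha> (\<lambda>t. \<zeta> (- real n + t)))
     ((flow (driven_field k \<alpha> \<zeta>) (a *\<^sub>R ones) (- real n) $ first_index) *\<^sub>R ones) (real n)"

definition slow_manifold ::
    "real \<Rightarrow> ('n::{finite,linorder}) rvec \<Rightarrow> (real \<Rightarrow> 'n rvec) \<Rightarrow> real \<Rightarrow> 'n rvec" where
  "slow_manifold k \<alpha> \<zeta> a = lim (\<lambda>n. pullback k \<alpha> \<zeta> n a)"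

locale tempered_system =
  fixes k :: real and \<alpha> :: "('n::{finite,linorder}) rvec" and \<zeta> :: "real \<Rightarrow> 'n rvec"
  assumes coupling_large: "k \<ge> 8" and tempered: "tempered_driver \<zeta>"
begin

sublocale driven_system k \<alpha> \<zeta>
  by standard (use tempered in \<open>simp add: tempered_driver_def\<close>)

abbreviation "G \<equiv> slow_manifold k \<alpha> \<zeta>"
abbreviation "C \<equiv> forcing_constant k \<alpha>"

lemma tempered_system_shift: "tempered_system k (\<lambda>t. \<zeta> (s + t))"
  by standard (rule coupling_large tempered_driver_shift[OF tempered])+

text \<open>Undoing the forward run presents the pullback state as the time 0 value of a trajectory
  of the unshifted flow that lies on the diagonal at time \<open>- n\<close>.\<close>

lemma pullback_past:
  "\<phi> (- real n) (pullback k \<alpha> \<zeta> n a) = (\<phi> (- real n) (a *\<^sub>R ones) $ first_index) *\<^sub>R ones"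
  unfolding pullback_def using flow_shift_inverse[of "- real n"] by simp

lemma pullback_first: "pullback k \<alpha> \<zeta> n a $ first_index = a"
  using first_coordinate_cong[where s = "- real n" and t = 0 and x = "pullback k \<alpha> \<zeta> n a" and y = "a *\<^sub>R ones"]
  by (simp add: pullback_past)

lemma pullback_deviation:
  assumes "tempering \<gamma> \<zeta> q" "\<gamma> \<le> 1" "- real n \<le> t"
  shows "energy (deviation (\<phi> t (pullback k \<alpha> \<zeta> n a))) \<le> C * q t"
  using energy_deviation[OF coupling_large assms(3,1,2), of "pullback k \<alpha> \<zeta> n a"]
  by (simp add: pullback_past)

text \<open>At time \<open>- n\<close> one trajectory is on the diagonal and the other has left it
  by a deviation of energy at most \<open>C * q (- n)\<close>, which grows like
  \<open>exp (n / 2)\<close>. Both share their first component, so contraction up to time 0 gains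
  \<open>exp (- n)\<close>.\<close>

lemma pullback_diff:
  assumes q: "tempering (1 / 2) \<zeta> q" and nm: "n \<le> m"
  shows "energy (pullback k \<alpha> \<zeta> m a - pullback k \<alpha> \<zeta> n a) \<le> C * q 0 * exp (- real n / 2)"
proof -
  let ?x = "pullback k \<alpha> \<zeta> m a" and ?y = "pullback k \<alpha> \<zeta> n a"
  have eq: "?x $ first_index = ?y $ first_index" by (simp add: pullback_first)
  have "energy (?x - ?y) \<le> exp (- real n) * energy (\<phi> (- real n) ?x - \<phi> (- real n) ?y)"
    using energy_contraction[OF coupling_large _ eq, of "- real n" 0] by simp
  also have "\<phi> (- real n) ?x - \<phi> (- real n) ?y = deviation (\<phi> (- real n) ?x)"
  proof -
    have "\<phi> (- real n) ?x $ first_index = \<phi> (- real n) ?y $ first_index"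
      by (rule first_coordinate_cong[where s = 0]) (use eq in simp)
    from deviation_diff[OF this] show ?thesis by (simp add: pullback_past)
  qed
  also have "exp (- real n) * energy \<dots> \<le> exp (- real n) * (C * (exp (real n / 2) * q 0))"
  proof (intro mult_left_mono)
    have "energy (deviation (\<phi> (- real n) ?x)) \<le> C * q (- real n)"
      using pullback_deviation[OF q, of m "- real n" a] nm by simp
    also have "\<dots> \<le> C * (exp (real n / 2) * q 0)"
      using tempering_growth[OF q, of "- real n"]
      by (intro mult_left_mono forcing_constant_nonneg) simp
    finally show "energy (deviation (\<phi> (- real n) ?x)) \<le> C * (exp (real n / 2) * q 0)" .
  qed simp
  also have "\<dots> = C * q 0 * (exp (- real n) * exp (real n / 2))" by simp
  also have "exp (- real n) * exp (real n / 2) = exp (- real n / 2)"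
    by (simp add: exp_add[symmetric])
  finally show ?thesis .
qed

text \<open>The bound in \<open>pullback_diff\<close> does not involve \<open>a\<close>, so the
  Cauchy property is uniform over the line; continuity of the limit rests on this.\<close>

lemma pullback_uniform_limit: "uniform_limit UNIV (pullback k \<alpha> \<zeta>) G sequentially"
proof -
  obtain q where q: "tempering (1 / 2) \<zeta> q"
    using tempered by (auto simp: tempered_driver_def dest: spec[of _ "1 / 2"])
  define K where "K = 2 ^ CARD('n) * (C * q 0)"
  have b: "(norm (pullback k \<alpha> \<zeta> m a - pullback k \<alpha> \<zeta> n a))\<^sup>2 \<le> K * exp (- real n / 2)" if "n \<le> m" for m n a
  proof -
    have "(norm (pullback k \<alpha> \<zeta> m a - pullback k \<alpha> \<zeta> n a))\<^sup>2
        \<le> 2 ^ CARD('n) * energy (pullback k \<alpha> \<zeta> m a - pullback k \<alpha> \<zeta> n a)" by (rule norm_le_energy)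
    also have "\<dots> \<le> 2 ^ CARD('n) * (C * q 0 * exp (- real n / 2))"
      by (intro mult_left_mono pullback_diff[OF q that]) simp
    finally show ?thesis by (simp add: K_def mult.assoc)
  qed
  have lim: "(\<lambda>n. K * exp (- real n / 2)) \<longlonglongrightarrow> 0"
  proof (rule tendsto_mult_right_zero)
    have "(\<lambda>n. exp (- (1 / 2) :: real) ^ n) \<longlonglongrightarrow> 0"
      by (rule LIMSEQ_power_zero) simp
    moreover have "exp (- (1 / 2) :: real) ^ n = exp (- real n / 2)" for n
      by (simp add: exp_of_nat_mult[symmetric])
    ultimately show "(\<lambda>n. exp (- real n / 2)) \<longlonglongrightarrow> 0" by simp
  qed
  have "uniformly_Cauchy_on UNIV (pullback k \<alpha> \<zeta>)"
  proof (rule uniformly_Cauchy_onI')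
    fix e :: real assume "e > 0"
    then have "\<forall>\<^sub>F n in sequentially. K * exp (- real n / 2) < e\<^sup>2"
      by (intro order_tendstoD(2)[OF lim]) simp
    then obtain N where N: "\<And>n. n \<ge> N \<Longrightarrow> K * exp (- real n / 2) < e\<^sup>2"
      unfolding eventually_sequentially by blast
    have "dist (pullback k \<alpha> \<zeta> m a) (pullback k \<alpha> \<zeta> n a) < e" if "m \<ge> N" "n > m" for m n a
    proof -
      have "(dist (pullback k \<alpha> \<zeta> m a) (pullback k \<alpha> \<zeta> n a))\<^sup>2 < e\<^sup>2"
        using b[of m n a] N[OF that(1)] that(2) by (simp add: dist_norm norm_minus_commute)
      then show ?thesis by (rule power2_less_imp_less) (use \<open>e > 0\<close> in simp)
    qed
    then show "\<exists>N. \<forall>a\<in>UNIV. \<forall>m\<ge>N. \<forall>n>m. dist (pullback k \<alpha> \<zeta> m a) (pullback k \<alpha> \<zeta> n a) < e"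
      by blast
  qed
  then obtain l where l: "uniform_limit UNIV (pullback k \<alpha> \<zeta>) l sequentially"
    using Cauchy_uniformly_convergent uniformly_convergent_on_def by metis
  have "G = l"
  proof
    fix a
    have "(\<lambda>n. pullback k \<alpha> \<zeta> n a) \<longlonglongrightarrow> l a" by (rule tendsto_uniform_limitI[OF l]) simp
    then show "G a = l a" unfolding slow_manifold_def by (rule limI)
  qed
  with l show ?thesis by simp
qed

lemma pullback_tendsto: "(\<lambda>n. pullback k \<alpha> \<zeta> n a) \<longlonglongrightarrow> G a"
  by (rule tendsto_uniform_limitI[OF pullback_uniform_limit]) simp

lemma flow_continuous_initial: "continuous_on S (\<phi> t)"
  by (rule lipschitz_on_continuous_on[OF lipschitz_onI[where L = "exp (L * \<bar>t\<bar>)"]])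
    (use flow_separation in \<open>auto simp: dist_norm\<close>)

lemma slow_manifold_continuous: "continuous_on S G"
proof -
  have "continuous_on UNIV (pullback k \<alpha> \<zeta> n)" for n
  proof -
    interpret sh: tempered_system k \<alpha> "\<lambda>t. \<zeta> (- real n + t)" by (rule tempered_system_shift)
    have c: "continuous_on UNIV (\<lambda>a. (\<phi> (- real n) (a *\<^sub>R ones) $ first_index) *\<^sub>R (ones :: 'n rvec))"
      by (intro continuous_on_scaleR continuous_on_component continuous_on_const
          continuous_on_compose2[OF flow_continuous_initial[of UNIV]] continuous_on_id) auto
    show ?thesis
      unfolding pullback_def by (rule continuous_on_compose2[OF sh.flow_continuous_initial[of UNIV] c]) simp
  qed
  then have "continuous_on UNIV G"
    by (intro uniform_limit_theorem[OF _ pullback_uniform_limit]) auto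
  then show ?thesis by (rule continuous_on_subset) simp
qed

lemma slow_manifold_first [simp]: "G a $ first_index = a"
proof -
  have "(\<lambda>n. pullback k \<alpha> \<zeta> n a $ first_index) \<longlonglongrightarrow> G a $ first_index"
    by (intro tendsto_vec_nth pullback_tendsto)
  then show ?thesis by (simp add: pullback_first LIMSEQ_const_iff)
qed

text \<open>For fixed \<open>t\<close> the bound holds for the pullback states once
  \<open>n \<ge> - t\<close>, and it passes to the limit.\<close>

lemma slow_manifold_deviation:
  assumes "tempering \<gamma> \<zeta> q" "\<gamma> \<le> 1"
  shows "energy (deviation (\<phi> t (G a))) \<le> C * q t"
proof (rule LIMSEQ_le_const2)
  have "continuous_on UNIV (\<lambda>x. energy (deviation (\<phi> t x)))"
    by (intro continuous_on_compose2[OF energy_continuous[of UNIV]]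
        continuous_on_compose2[OF deviation_continuous[of UNIV]] flow_continuous_initial) auto
  then show "(\<lambda>n. energy (deviation (\<phi> t (pullback k \<alpha> \<zeta> n a)))) \<longlonglongrightarrow> energy (deviation (\<phi> t (G a)))"
    by (rule continuous_on_tendsto_compose[OF _ pullback_tendsto]) auto
  obtain N where "- t \<le> real N" using real_arch_simple by blast
  then show "\<exists>N. \<forall>n\<ge>N. energy (deviation (\<phi> t (pullback k \<alpha> \<zeta> n a))) \<le> C * q t"
    using pullback_deviation[OF assms] by (intro exI[of _ N]) force
qed

text \<open>The slow manifold consists of the states whose past deviation grows slower than the contraction.\<close>

lemma slow_manifold_unique:
  assumes "\<forall>\<^sub>F s in at_bot. energy (deviation (\<phi> s x)) \<le> M * exp (- s / 2)"
  shows "x = G (x $ first_index)"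
proof -
  let ?y = "G (x $ first_index)"
  obtain q where q: "tempering (1 / 2) \<zeta> q"
    using tempered by (auto simp: tempered_driver_def dest: spec[of _ "1 / 2"])
  let ?M = "2 * M + 2 * (C * q 0)"
  have "\<forall>\<^sub>F s in at_bot. energy (x - ?y) \<le> ?M * exp (s / 2)"
    using assms eventually_le_at_bot[of 0]
  proof eventually_elim
    case (elim s)
    have eq: "x $ first_index = ?y $ first_index" by simp
    have eqs: "\<phi> s x $ first_index = \<phi> s ?y $ first_index"
      by (rule first_coordinate_cong[where s = 0]) simp
    have "energy (deviation (\<phi> s ?y)) \<le> C * q s" using slow_manifold_deviation[OF q] by simp
    also have "\<dots> \<le> C * (exp (- s / 2) * q 0)"
      using tempering_growth[OF q, of s] elim(2) by (intro mult_left_mono forcing_constant_nonneg) simp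
    finally have "energy (deviation (\<phi> s ?y)) \<le> C * q 0 * exp (- s / 2)" by (simp add: mult_ac)
    then have "energy (\<phi> s x - \<phi> s ?y) \<le> ?M * exp (- s / 2)"
      using energy_diff_le[of "deviation (\<phi> s x)" "deviation (\<phi> s ?y)"] elim(1)
      unfolding deviation_diff[OF eqs] by (simp add: algebra_simps)
    \<comment> \<open>Contraction from \<open>s\<close> to 0 gains \<open>exp s\<close> against a
      growth of \<open>exp (- s / 2)\<close>, so nothing remains as \<open>s\<close> tends to minus
      infinity.\<close>
    then have "exp s * energy (\<phi> s x - \<phi> s ?y) \<le> exp s * (?M * exp (- s / 2))" by simp
    also have "\<dots> = ?M * (exp s * exp (- s / 2))" by simp
    also have "exp s * exp (- s / 2) = exp (s / 2)" by (simp add: exp_add[symmetric])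
    finally show ?case using energy_contraction[OF coupling_large elim(2) eq] by simp
  qed
  moreover have "((\<lambda>s. ?M * exp (s / 2)) \<longlongrightarrow> 0) at_bot"
  proof (intro tendsto_mult_right_zero filterlim_compose[OF exp_at_bot])
    show "filterlim (\<lambda>s::real. s / 2) at_bot at_bot"
      unfolding filterlim_at_bot eventually_at_bot_linorder
    proof (intro allI exI impI)
      show "s / 2 \<le> Z" if "s \<le> 2 * Z" for s Z :: real using that by simp
    qed
  qed
  ultimately have "energy (x - ?y) \<le> 0"
    by (intro tendsto_lowerbound) auto
  then have "energy (x - ?y) = 0" using energy_nonneg[of "x - ?y"] by linarith
  then have "(norm (x - ?y))\<^sup>2 \<le> 0"
    using norm_le_energy[of "x - ?y"] by simp
  then show ?thesis by simp
qed

text \<open>Slow backward growth of the deviation is a property of the whole trajectory. Moving the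
  time origin by \<open>t\<close> costs the constant factor \<open>exp (- t / 2)\<close>, and the
  uniqueness criterion applies to the shifted system.\<close>

lemma slow_manifold_invariant:
  "\<phi> t (G a) = slow_manifold k \<alpha> (\<lambda>r. \<zeta> (t + r)) (\<phi> t (G a) $ first_index)"
proof -
  interpret sh: tempered_system k \<alpha> "\<lambda>r. \<zeta> (t + r)" by (rule tempered_system_shift)
  obtain q where q: "tempering (1 / 2) \<zeta> q"
    using tempered by (auto simp: tempered_driver_def dest: spec[of _ "1 / 2"])
  have "\<forall>\<^sub>F s in at_bot. energy (deviation (sh.\<phi> s (\<phi> t (G a)))) \<le> C * exp (- t / 2) * q 0 * exp (- s / 2)"
    using eventually_le_at_bot[of "- t"]
  proof eventually_elim
    case (elim s)
    have "energy (deviation (sh.\<phi> s (\<phi> t (G a)))) = energy (deviation (\<phi> (t + s) (G a)))"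
      by (simp add: flow_shift)
    also have "\<dots> \<le> C * q (t + s)" using slow_manifold_deviation[OF q] by simp
    also have "\<dots> \<le> C * (exp (- (t + s) / 2) * q 0)"
      using tempering_growth[OF q, of "t + s"] elim
      by (intro mult_left_mono forcing_constant_nonneg) (simp add: minus_divide_left[symmetric] del: minus_add_distrib)
    also have "exp (- (t + s) / 2) = exp (- t / 2) * exp (- s / 2)"
      by (simp add: exp_add[symmetric] add_divide_distrib)
    finally show ?case by (simp add: mult_ac)
  qed
  then show ?thesis by (rule sh.slow_manifold_unique)
qed

text \<open>For the inclusion from right to left, a point of the shifted manifold is carried by time
  \<open>- t\<close>, for which invariance holds as well.\<close>

lemma slow_manifold_invariant_range: "\<phi> t ` range G = range (slow_manifold k \<alpha> (\<lambda>r. \<zeta> (t + r)))"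
proof (intro equalityI subsetI)
  fix y assume "y \<in> \<phi> t ` range G"
  then show "y \<in> range (slow_manifold k \<alpha> (\<lambda>r. \<zeta> (t + r)))" using slow_manifold_invariant by blast
next
  interpret sh: tempered_system k \<alpha> "\<lambda>r. \<zeta> (t + r)" by (rule tempered_system_shift)
  fix y assume "y \<in> range (slow_manifold k \<alpha> (\<lambda>r. \<zeta> (t + r)))"
  then obtain b where y: "y = sh.G b" by blast
  have "sh.\<phi> (- t) y \<in> range G"
    using sh.slow_manifold_invariant[where t = "- t" and a = b] unfolding y by simp
  moreover have "\<phi> t (sh.\<phi> (- t) y) = y" by (rule flow_shift_inverse)
  ultimately show "y \<in> \<phi> t ` range G" by (metis image_eqI)
qed

lemma slow_manifold_translate: "G (a + 2 * pi * of_int m) = G a + (2 * pi * of_int m) *\<^sub>R ones"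
proof -
  have "pullback k \<alpha> \<zeta> n (a + 2 * pi * of_int m) = pullback k \<alpha> \<zeta> n a + (2 * pi * of_int m) *\<^sub>R ones" for n
  proof -
    interpret sh: tempered_system k \<alpha> "\<lambda>t. \<zeta> (- real n + t)" by (rule tempered_system_shift)
    show ?thesis unfolding pullback_def scaleR_add_left flow_translate
      using sh.flow_translate by (simp add: scaleR_add_left)
  qed
  then have "(\<lambda>n. pullback k \<alpha> \<zeta> n a + (2 * pi * of_int m) *\<^sub>R ones) \<longlonglongrightarrow> G (a + 2 * pi * of_int m)"
    using pullback_tendsto[of "a + 2 * pi * of_int m"] by simp
  then show ?thesis
    using tendsto_add[OF pullback_tendsto[of a] tendsto_const] LIMSEQ_unique by blast
qed

text \<open>Order survives each stage of the pullback: the scalar flow backward, the placement on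
  the diagonal and the cooperative flow forward.\<close>

lemma slow_manifold_mono: "a \<le> b \<Longrightarrow> G a \<le> G b"
proof -
  assume "a \<le> b"
  have "pullback k \<alpha> \<zeta> n a \<le> pullback k \<alpha> \<zeta> n b" for n
  proof -
    interpret sh: tempered_system k \<alpha> "\<lambda>t. \<zeta> (- real n + t)" by (rule tempered_system_shift)
    have "\<phi> (- real n) (a *\<^sub>R ones) $ first_index \<le> \<phi> (- real n) (b *\<^sub>R ones) $ first_index"
      by (rule first_coordinate_mono) (use \<open>a \<le> b\<close> in simp)
    then show ?thesis unfolding pullback_def
      by (intro sh.flow_mono) (use coupling_large in \<open>auto simp: less_eq_vec_def\<close>)
  qed
  then have "pullback k \<alpha> \<zeta> n a $ i \<le> pullback k \<alpha> \<zeta> n b $ i" for n i by (simp add: less_eq_vec_def)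
  then have "G a $ i \<le> G b $ i" for i
    by (intro LIMSEQ_le[OF tendsto_vec_nth[OF pullback_tendsto] tendsto_vec_nth[OF pullback_tendsto]]) auto
  then show ?thesis by (simp add: less_eq_vec_def)
qed

text \<open>Compares \<open>x\<close> with the point of the manifold having the same first
  component; by invariance its image lies on the shifted manifold and supplies the witness.\<close>

lemma slow_manifold_attracts:
  assumes "tempering \<gamma> \<zeta> q" "\<gamma> \<le> 1" "0 \<le> t"
  shows "\<exists>a. (norm (\<phi> t x - slow_manifold k \<alpha> (\<lambda>r. \<zeta> (t + r)) a))\<^sup>2
    \<le> 2 ^ CARD('n) * exp (- t) * (2 * energy (deviation x) + 2 * (C * q 0))"
proof (intro exI)
  let ?y = "G (x $ first_index)" and ?a = "\<phi> t (G (x $ first_index)) $ first_index"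
  have eq: "x $ first_index = ?y $ first_index" by simp
  have "energy (\<phi> t x - \<phi> t ?y) \<le> exp (- t) * energy (x - ?y)"
    using energy_contraction[OF coupling_large assms(3) eq] by simp
  also have "energy (x - ?y) \<le> 2 * energy (deviation x) + 2 * energy (deviation ?y)"
    unfolding deviation_diff[OF eq] by (rule energy_diff_le)
  also have "energy (deviation ?y) \<le> C * q 0"
    using slow_manifold_deviation[OF assms(1,2), where t = 0] by simp
  finally have "energy (\<phi> t x - \<phi> t ?y) \<le> exp (- t) * (2 * energy (deviation x) + 2 * (C * q 0))"
    by simp
  then have "(norm (\<phi> t x - \<phi> t ?y))\<^sup>2
      \<le> 2 ^ CARD('n) * (exp (- t) * (2 * energy (deviation x) + 2 * (C * q 0)))"
    by (intro order_trans[OF norm_le_energy] mult_left_mono) simp_all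
  then show "(norm (\<phi> t x - slow_manifold k \<alpha> (\<lambda>r. \<zeta> (t + r)) ?a))\<^sup>2
    \<le> 2 ^ CARD('n) * exp (- t) * (2 * energy (deviation x) + 2 * (C * q 0))"
    unfolding slow_manifold_invariant[symmetric] by (simp only: mult.assoc)
qed

end

section \<open>Periodic curves in the quotient\<close>

lemma dist_wrap_le_dist: "dist (wrap x) (wrap y) \<le> dist x y"
  using dist_wrap_le[of x y 0] by (simp add: dist_norm)

lemma wrap_continuous: "continuous_on S wrap"
proof (rule lipschitz_on_continuous_on[OF lipschitz_onI])
  show "dist (wrap x) (wrap y) \<le> 1 * dist x y" for x y :: "real ^ 'a"
    using dist_wrap_le_dist[of x y] by simp
qed simp

lemma second_countable_euclidean:
  "second_countable (euclidean :: 'a::second_countable_topology topology)"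
proof -
  obtain B :: "'a set set" where B: "countable B" "topological_basis B"
    using ex_countable_basis by blast
  show ?thesis
    unfolding second_countable_def
  proof (intro exI[of _ B] conjI allI impI ballI)
    show "openin euclidean V" if "V \<in> B" for V using topological_basis_open[OF B(2) that] by simp
    show "\<exists>V\<in>B. x \<in> V \<and> V \<subseteq> U" if "openin euclidean U \<and> x \<in> U" for U x
      using topological_basisE[OF B(2), of U x] that by (metis open_openin)
  qed (rule B(1))
qed

text \<open>Isolates the topology of the quotient curve. Coordinate \<open>f\<close> recovers the
  parameter, so distances in space control distances between parameters.\<close>

locale periodic_curve =
  fixes G :: "real \<Rightarrow> real ^ 'n::finite" and f :: 'n
  assumes curve_continuous: "continuous_on UNIV G"
    and curve_coordinate: "G a $ f = a"
    and curve_translate: "G (a + 2 * pi * of_int m) = G a + (2 * pi * of_int m) *\<^sub>R ones"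
begin

definition wrapped :: "real \<Rightarrow> 'n cyl" where
  "wrapped a = wrap (G a)"

lemma wrapped_translate: "wrapped (a + 2 * pi * of_int m) = wrapped a"
  unfolding wrapped_def curve_translate wrap_eq_iff period_rel_def
  by (rule exI[of _ "- m"]) simp

lemma wrapped_continuous: "continuous_on S wrapped"
  unfolding wrapped_def
  by (rule continuous_on_compose2[OF wrap_continuous[of UNIV] continuous_on_subset[OF curve_continuous]]) auto

lemma range_wrapped: "range wrapped = wrap ` range G"
  by (auto simp: wrapped_def)

lemma wrapped_surjective_bounded: "\<exists>b\<in>{0..2 * pi}. wrapped a = wrapped b"
proof -
  define m where "m = \<lfloor>a / (2 * pi)\<rfloor>"
  have "of_int m \<le> a / (2 * pi)" "a / (2 * pi) \<le> of_int m + 1"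
    unfolding m_def by linarith+
  then have "0 \<le> a + 2 * pi * of_int (- m)" "a + 2 * pi * of_int (- m) \<le> 2 * pi"
    by (simp_all add: field_simps)
  then show ?thesis using wrapped_translate[of a "- m", symmetric] by (intro bexI[of _ "a + 2 * pi * of_int (- m)"]) auto
qed

lemma compact_range_wrapped: "compact (range wrapped)"
proof -
  have "range wrapped = wrapped ` {0..2 * pi}" using wrapped_surjective_bounded by blast
  then show ?thesis by (simp only: compact_continuous_image[OF wrapped_continuous compact_Icc])
qed

lemma dist_wrapped:
  assumes "dist (wrap y) (wrapped b) < e"
  obtains m :: int where "norm (y - G (b + 2 * pi * of_int m)) < e"
proof -
  obtain m :: int where "norm (y - G b + (2 * pi * of_int m) *\<^sub>R ones) < e"
    using dist_wrap_ex assms unfolding wrapped_def by blast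
  then have "norm (y - G (b + 2 * pi * of_int (- m))) < e"
    unfolding curve_translate by (simp add: algebra_simps)
  then show thesis by (rule that)
qed

text \<open>\<open>range G\<close> contains all representatives of the points of the quotient curve,
  so both distances agree. Measurability of the attractor thereby becomes a question about
  \<open>G\<close>.\<close>

lemma infdist_wrapped: "infdist (wrap y) (range wrapped) = infdist y (range G)"
proof (rule antisym)
  have "infdist (wrap y) (range wrapped) \<le> dist y (G a)" for a
    using dist_wrap_le_dist[of y "G a"] by (intro infdist_le2[of "wrapped a"]) (auto simp: wrapped_def)
  then show "infdist (wrap y) (range wrapped) \<le> infdist y (range G)"
    unfolding infdist_notempty[of "range G", simplified] by (intro cINF_greatest) auto
  have "infdist y (range G) \<le> dist (wrap y) (wrapped b)" for b
  proof (rule ccontr)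
    assume "\<not> infdist y (range G) \<le> dist (wrap y) (wrapped b)"
    then have "dist (wrap y) (wrapped b) < infdist y (range G)" by simp
    then obtain m :: int where "norm (y - G (b + 2 * pi * of_int m)) < infdist y (range G)"
      by (rule dist_wrapped)
    moreover have "infdist y (range G) \<le> dist y (G (b + 2 * pi * of_int m))" by (rule infdist_le) simp
    ultimately show False by (simp add: dist_norm)
  qed
  then show "infdist y (range G) \<le> infdist (wrap y) (range wrapped)"
    unfolding infdist_notempty[of "range wrapped", simplified] by (intro cINF_greatest) auto
qed

text \<open>A countable infimum preserves measurability in the path; density of the rationals and
  continuity of \<open>G\<close> justify it.\<close>

lemma infdist_rational: "infdist y (range G) = (INF a\<in>\<rat>. dist y (G a))"
proof -
  have ne: "G ` \<rat> \<noteq> {}" using Rats_0 by blast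
  have "infdist y (range G) = infdist y (G ` \<rat>)"
  proof (rule antisym)
    show "infdist y (range G) \<le> infdist y (G ` \<rat>)" by (rule infdist_mono) (use ne in auto)
    have "infdist y (G ` \<rat>) \<le> dist y (G a)" for a
    proof (rule continuous_ge_on_closure[where S = \<rat> and f = "\<lambda>a. dist y (G a)"])
      show "continuous_on (closure \<rat>) (\<lambda>a. dist y (G a))"
        by (intro continuous_on_dist continuous_on_const continuous_on_subset[OF curve_continuous]) simp
    qed (auto simp: Rats_closure_real intro: infdist_le)
    then show "infdist y (G ` \<rat>) \<le> infdist y (range G)"
      unfolding infdist_notempty[of "range G", simplified] by (intro cINF_greatest) auto
  qed
  then show ?thesis using infdist_notempty[OF ne, of y] by (simp add: image_image)
qed

text \<open>A point of the quotient curve near \<open>wrapped a\<close> has a lift on the curve near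
  \<open>G a\<close>. Reading off coordinate \<open>f\<close> does not increase distances, so a
  parameter of the lift lies near \<open>a\<close>.\<close>

lemma open_map_wrapped:
  assumes "open U"
  shows "openin (top_of_set (range wrapped)) (wrapped ` U)"
  unfolding openin_contains_ball
proof (intro conjI ballI)
  fix p assume "p \<in> wrapped ` U"
  then obtain a where a: "a \<in> U" "p = wrapped a" by blast
  obtain d where d: "d > 0" "ball a d \<subseteq> U" using assms a(1) open_contains_ball by blast
  have "ball p d \<inter> range wrapped \<subseteq> wrapped ` U"
  proof
    fix s assume "s \<in> ball p d \<inter> range wrapped"
    then obtain b where b: "s = wrapped b" "dist (wrap (G a)) (wrapped b) < d"
      by (auto simp: a wrapped_def)
    obtain m :: int where m: "norm (G a - G (b + 2 * pi * of_int m)) < d"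
      using dist_wrapped[OF b(2)] .
    have "\<bar>(G a - G (b + 2 * pi * of_int m)) $ f\<bar> < d"
      using component_le_norm_cart m by (rule order.strict_trans1)
    then have "b + 2 * pi * of_int m \<in> ball a d"
      by (simp add: curve_coordinate dist_real_def)
    then have "b + 2 * pi * of_int m \<in> U" using d(2) by blast
    then show "s \<in> wrapped ` U" unfolding b(1) wrapped_translate[of b m, symmetric] by (rule imageI)
  qed
  then show "\<exists>e>0. ball p e \<inter> range wrapped \<subseteq> wrapped ` U" using d(1) by blast
qed auto

text \<open>The window has length 2, less than the period \<open>2 * pi\<close>.\<close>

lemma wrapped_inj: "inj_on wrapped {c - 1<..<c + 1}"
proof (rule inj_onI)
  fix a b assume ab: "a \<in> {c - 1<..<c + 1}" "b \<in> {c - 1<..<c + 1}" "wrapped a = wrapped b"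
  then obtain m :: int where "G b = G a + (2 * pi * of_int m) *\<^sub>R ones"
    unfolding wrapped_def wrap_eq_iff period_rel_def by blast
  then have "G b $ f = G a $ f + 2 * pi * of_int m" by (simp add: ones_def)
  then have eq: "b = a + 2 * pi * of_int m" by (simp add: curve_coordinate)
  have "m = 0"
  proof (rule ccontr)
    assume "m \<noteq> 0"
    then have "1 \<le> \<bar>real_of_int m\<bar>" by linarith
    then have "2 * pi * 1 \<le> 2 * pi * \<bar>real_of_int m\<bar>" by (intro mult_left_mono) auto
    also have "\<dots> = \<bar>b - a\<bar>" using eq by (simp add: abs_mult)
    also have "\<dots> < 2" using ab by auto
    finally show False using pi_gt3 by simp
  qed
  then show "a = b" using eq by simp
qed

text \<open>An open continuous map that is injective on short windows restricts there to
  homeomorphisms, and it carries second countability over from the line.\<close>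

lemma one_dim_manifold_wrapped: "one_dim_manifold (range wrapped)"
  unfolding one_dim_manifold_def
proof (intro conjI ballI)
  show "Hausdorff_space (top_of_set (range wrapped))"
    by (simp add: Hausdorff_space_subtopology)
  show "second_countable (top_of_set (range wrapped))"
  proof (rule second_countable_open_map_image[where X = euclideanreal and f = wrapped])
    show "continuous_map euclideanreal (top_of_set (range wrapped)) wrapped"
      using wrapped_continuous[of UNIV] by (simp add: continuous_map_in_subtopology)
    show "open_map euclideanreal (top_of_set (range wrapped)) wrapped"
      by (simp add: open_map_def open_map_wrapped)
    show "second_countable euclideanreal" by (rule second_countable_euclidean)
  qed simp
  fix p assume "p \<in> range wrapped"
  then obtain c where p: "p = wrapped c" by blast
  let ?V = "{c - 1<..<c + 1}"
  have "open ?V" by simp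
  have o: "openin (top_of_set (range wrapped)) (wrapped ` W)" if "openin (top_of_set ?V) W" for W
    by (rule open_map_wrapped[OF openin_open_trans[OF that \<open>open ?V\<close>]])
  obtain g where "homeomorphism ?V (wrapped ` ?V) wrapped g"
  proof (rule homeomorphism_injective_open_map[OF wrapped_continuous refl wrapped_inj])
    show "openin (top_of_set (wrapped ` ?V)) (wrapped ` W)" if "openin (top_of_set ?V) W" for W
      by (rule openin_subset_trans[OF o[OF that]]) (use openin_imp_subset[OF that] in \<open>auto simp del: greaterThanLessThan_iff\<close>)
  qed
  then have "wrapped ` ?V homeomorphic ?V" using homeomorphic_def homeomorphic_sym by blast
  moreover have "openin (top_of_set (range wrapped)) (wrapped ` ?V)" by (rule open_map_wrapped) simp
  ultimately show "\<exists>U. openin (top_of_set (range wrapped)) U \<and> p \<in> U \<and> (\<exists>V::real set. open V \<and> U homeomorphic V)"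
    using \<open>open ?V\<close> unfolding p
    by (intro exI[of _ "wrapped ` ?V"] exI[of _ ?V] conjI) (simp_all del: open_greaterThanLessThan)
qed

lemma vimage_wrapped: "wrap -` range wrapped = range G"
proof (intro equalityI subsetI)
  fix x assume "x \<in> wrap -` range wrapped"
  then obtain a where "wrap (G a) = wrap x" by (auto simp: wrapped_def)
  then obtain m :: int where "x = G a + (2 * pi * of_int m) *\<^sub>R ones"
    unfolding wrap_eq_iff period_rel_def by blast
  then show "x \<in> range G" by (metis curve_translate rangeI)
qed (auto simp: wrapped_def)

lemma totally_ordered_wrapped:
  assumes "\<And>a b. a \<le> b \<Longrightarrow> G a \<le> G b"
  shows "totally_ordered (wrap -` range wrapped)"
  unfolding vimage_wrapped totally_ordered_def
proof (intro conjI ballI impI)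
  fix x y assume "x \<in> range G" "y \<in> range G"
  then obtain a b where "x = G a" "y = G b" by blast
  then have "0 \<le> x - y \<or> 0 \<le> y - x" using assms[of a b] assms[of b a] by (cases "a \<le> b") (auto simp: less_eq_vec_def)
  then show "x - y \<in> {v. 0 \<le> v} \<union> uminus ` {v. 0 \<le> v}"
  proof
    assume "0 \<le> y - x"
    then have "- (y - x) \<in> uminus ` {v. 0 \<le> v}" by blast
    then show ?thesis by simp
  qed simp
qed simp

end

section \<open>Tame paths and the Ornstein-Uhlenbeck process\<close>

lemma integrable_inverse_1_plus_square_lborel:
  "integrable lborel (\<lambda>r::real. inverse (1 + r\<^sup>2))"
  using integrable_inverse_1_plus_square by (simp add: set_integrable_def)

text \<open>The closed intervals can overlap or leave a gap only at 0 and \<open>t\<close>, a null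
  set.\<close>

lemma signed_indicator_half_line:
  "AE u in lborel. indicator {..t} u = indicator {..0} u + signed_indicator t u"
proof -
  have "AE u in lborel. u \<noteq> 0 \<and> u \<noteq> t"
    using AE_lborel_singleton[of 0] AE_lborel_singleton[of t] by eventually_elim simp
  then show ?thesis
    by eventually_elim (auto simp: signed_indicator_def indicator_def)
qed

lemma half_line_integral:
  fixes g :: "real \<Rightarrow> 'a::euclidean_space"
  assumes c: "continuous_on UNIV g" and i: "set_integrable lborel {..0} g"
  shows "set_integrable lborel {..t} g"
    and "(LINT u:{..t}|lborel. g u) = (LINT u:{..0}|lborel. g u) + primitive g t"
proof -
  have [measurable]: "g \<in> borel_measurable borel"
    using c by (rule borel_measurable_continuous_onI)
  have [measurable]: "signed_indicator t \<in> borel_measurable borel"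
    unfolding signed_indicator_def by measurable
  have sum: "integrable lborel (\<lambda>u. indicator {..0} u *\<^sub>R g u + signed_indicator t u *\<^sub>R g u)"
    using i signed_indicator_integrable[OF c] unfolding set_integrable_def
    by (rule Bochner_Integration.integrable_add)
  have ae: "AE u in lborel. indicator {..0} u *\<^sub>R g u + signed_indicator t u *\<^sub>R g u = indicator {..t} u *\<^sub>R g u"
    using signed_indicator_half_line[of t] by eventually_elim (simp add: scaleR_add_left)
  show "set_integrable lborel {..t} g"
    unfolding set_integrable_def by (rule integrable_cong_AE_imp[OF sum _ ae]) measurable
  have "(LINT u:{..t}|lborel. g u) = (LINT u|lborel. indicator {..0} u *\<^sub>R g u + signed_indicator t u *\<^sub>R g u)"
    unfolding set_lebesgue_integral_def
    by (rule integral_cong_AE) (use ae in \<open>auto elim: eventually_mono\<close>)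
  also have "\<dots> = (LINT u:{..0}|lborel. g u) + primitive g t"
    unfolding set_lebesgue_integral_def primitive_def
    by (rule Bochner_Integration.integral_add)
      (use i signed_indicator_integrable[OF c] in \<open>auto simp: set_integrable_def\<close>)
  finally show "(LINT u:{..t}|lborel. g u) = (LINT u:{..0}|lborel. g u) + primitive g t" .
qed

lemma half_line_has_vector_derivative:
  fixes g :: "real \<Rightarrow> 'a::euclidean_space"
  assumes c: "continuous_on UNIV g" and i: "set_integrable lborel {..0} g"
  shows "((\<lambda>t. LINT u:{..t}|lborel. g u) has_vector_derivative g t) (at t)"
proof -
  have "(\<lambda>t. LINT u:{..t}|lborel. g u) = (\<lambda>t. (LINT u:{..0}|lborel. g u) + primitive g t)"
    by (rule ext) (rule half_line_integral(2)[OF c i])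
  then show ?thesis
    using has_vector_derivative_add[OF has_vector_derivative_const primitive_has_vector_derivative[OF c]] by simp
qed

section \<open>Polynomial weights and tame paths\<close>

lemma square_weight_pos: "0 < (1 + x\<^sup>2)\<^sup>2" for x :: real
  by (intro zero_less_power add_pos_nonneg) auto

text \<open>With \<open>s = - u\<close>, the fourth power of
  \<open>1 + s \<le> m * exp (c * s / 4)\<close>. The base \<open>max 1 (4 / c)\<close> is chosen so
  that \<open>m \<ge> 1\<close> and \<open>m * (c / 4) \<ge> 1\<close>.\<close>

lemma exp_times_power_bound:
  fixes c u :: real
  assumes "c > 0" "u \<le> 0"
  shows "exp (c * u) \<le> (max 1 (4 / c)) ^ 4 / (1 + u\<^sup>2)\<^sup>2"
proof -
  define m where "m = max 1 (4 / c)"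
  define s where "s = - u"
  have s: "s \<ge> 0" using assms by (simp add: s_def)
  have m: "m \<ge> 1" "m * (c / 4) \<ge> 1"
    using assms mult_right_mono[of "4 / c" m "c / 4"] by (auto simp: m_def)
  have "1 + s \<le> m * (1 + c * s / 4)"
    using mult_right_mono[OF m(2) s] m(1) by (simp add: algebra_simps)
  also have "\<dots> \<le> m * exp (c * s / 4)" using m by (intro mult_left_mono exp_ge_add_one_self) auto
  finally have "(1 + s) ^ 4 \<le> (m * exp (c * s / 4)) ^ 4" using s by (intro power_mono) auto
  also have "\<dots> = m ^ 4 * exp (c * s)" by (simp add: power_mult_distrib exp_of_nat_mult[symmetric])
  finally have 1: "(1 + s) ^ 4 \<le> m ^ 4 * exp (c * s)" .
  have "1 + u\<^sup>2 \<le> (1 + s)\<^sup>2" using s by (simp add: s_def power2_eq_square algebra_simps)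
  then have "(1 + u\<^sup>2)\<^sup>2 \<le> ((1 + s)\<^sup>2)\<^sup>2" by (intro power_mono) auto
  with 1 have "(1 + u\<^sup>2)\<^sup>2 \<le> m ^ 4 * exp (c * s)" by (simp flip: power_mult)
  then have "exp (c * u) * (1 + u\<^sup>2)\<^sup>2 \<le> m ^ 4 * (exp (c * s) * exp (c * u))"
    by (simp add: mult.commute mult.left_commute)
  also have "exp (c * s) * exp (c * u) = 1" by (simp add: s_def exp_add[symmetric])
  finally show ?thesis
    by (simp add: m_def pos_le_divide_eq[OF square_weight_pos])
qed

text \<open>
  A single polynomial weight dominates all the exponential ones, and makes the condition both
  measurable and invariant under shifts.
\<close>

definition tame_path :: "('n::finite) path \<Rightarrow> bool" where
  "tame_path \<omega> \<longleftrightarrow> \<omega> \<in> wiener_paths \<and> integrable lborel (\<lambda>r. (norm (\<omega> r))\<^sup>2 / (1 + r\<^sup>2)\<^sup>2)"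

lemma wiener_paths_continuous: "\<omega> \<in> wiener_paths \<Longrightarrow> continuous_on S \<omega>"
  unfolding wiener_paths_def using continuous_on_subset by blast

lemma shift_in_wiener_paths: "\<omega> \<in> wiener_paths \<Longrightarrow> shift t \<omega> \<in> wiener_paths"
  unfolding shift_def by (auto simp: wiener_paths_def intro!: continuous_intros continuous_on_compose2[of UNIV \<omega>])

lemma shift_shift: "shift t (shift s \<omega>) = shift (s + t) \<omega>"
  by (simp add: shift_def fun_eq_iff add.assoc)

lemma shift_0: "\<omega> \<in> wiener_paths \<Longrightarrow> shift 0 \<omega> = \<omega>"
  by (simp add: shift_def wiener_paths_def)

lemma integrable_inverse_square_weight: "integrable lborel (\<lambda>r::real. 1 / (1 + r\<^sup>2)\<^sup>2)"
proof (rule Bochner_Integration.integrable_bound[OF integrable_inverse_1_plus_square_lborel])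
  show "AE r in lborel. norm (1 / (1 + r\<^sup>2)\<^sup>2 :: real) \<le> norm (inverse (1 + r\<^sup>2))"
  proof (intro AE_I2)
    fix r :: real
    have "(1 + r\<^sup>2) * 1 \<le> (1 + r\<^sup>2) * (1 + r\<^sup>2)" by (intro mult_left_mono) auto
    then show "norm (1 / (1 + r\<^sup>2)\<^sup>2 :: real) \<le> norm (inverse (1 + r\<^sup>2))"
      by (simp add: power2_eq_square[of "1 + r\<^sup>2"] divide_inverse[symmetric] inverse_eq_divide add_pos_nonneg frac_le)
  qed
qed measurable

text \<open>Since \<open>1 + (t + r)\<^sup>2 \<le> 2 * (1 + t\<^sup>2) * (1 + r\<^sup>2)\<close>,
  shifting the argument costs only a constant factor in the weight; the subtracted constant
  \<open>\<omega> t\<close> is harmless because the weight itself is integrable.\<close>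

lemma tame_path_shift:
  assumes "tame_path \<omega>"
  shows "tame_path (shift t \<omega>)"
  unfolding tame_path_def
proof
  have w: "\<omega> \<in> wiener_paths" and i: "integrable lborel (\<lambda>r. (norm (\<omega> r))\<^sup>2 / (1 + r\<^sup>2)\<^sup>2)"
    using assms by (auto simp: tame_path_def)
  show w': "shift t \<omega> \<in> wiener_paths" by (rule shift_in_wiener_paths[OF w])
  have [measurable]: "shift t \<omega> \<in> borel_measurable borel"
    by (rule borel_measurable_continuous_onI[OF wiener_paths_continuous[OF w']])
  let ?K = "2 * (4 * (1 + t\<^sup>2)\<^sup>2)"
  have "integrable lborel (\<lambda>r. (norm (\<omega> (t + 1 * r)))\<^sup>2 / (1 + (t + 1 * r)\<^sup>2)\<^sup>2)"
    using lborel_integrable_real_affine[OF i, of 1 t] by simp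
  then have i': "integrable lborel (\<lambda>r. ?K * ((norm (\<omega> (t + r)))\<^sup>2 / (1 + (t + r)\<^sup>2)\<^sup>2)
      + 2 * (norm (\<omega> t))\<^sup>2 * (1 / (1 + r\<^sup>2)\<^sup>2))"
    by (intro Bochner_Integration.integrable_add integrable_mult_right integrable_inverse_square_weight) simp
  show "integrable lborel (\<lambda>r. (norm (shift t \<omega> r))\<^sup>2 / (1 + r\<^sup>2)\<^sup>2)"
  proof (rule Bochner_Integration.integrable_bound[OF i'])
    show "AE r in lborel. norm ((norm (shift t \<omega> r))\<^sup>2 / (1 + r\<^sup>2)\<^sup>2)
      \<le> norm (?K * ((norm (\<omega> (t + r)))\<^sup>2 / (1 + (t + r)\<^sup>2)\<^sup>2) + 2 * (norm (\<omega> t))\<^sup>2 * (1 / (1 + r\<^sup>2)\<^sup>2))"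
    proof (intro AE_I2)
      fix r
      let ?A = "(norm (\<omega> (t + r)))\<^sup>2" and ?B = "(norm (\<omega> t))\<^sup>2"
      have "norm (shift t \<omega> r) \<le> norm (\<omega> (t + r)) + norm (\<omega> t)"
        unfolding shift_def by (rule norm_triangle_ineq4)
      then have "(norm (shift t \<omega> r))\<^sup>2 \<le> (norm (\<omega> (t + r)) + norm (\<omega> t))\<^sup>2"
        by (intro power_mono) auto
      also have "\<dots> \<le> 2 * ?A + 2 * ?B" by (rule power2_add_le)
      finally have 1: "(norm (shift t \<omega> r))\<^sup>2 / (1 + r\<^sup>2)\<^sup>2 \<le> (2 * ?A + 2 * ?B) / (1 + r\<^sup>2)\<^sup>2"
        by (intro divide_right_mono) auto
      have "1 + (t + r)\<^sup>2 \<le> 2 * (1 + t\<^sup>2) * (1 + r\<^sup>2)"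
        proof -
        have "0 \<le> t\<^sup>2 * r\<^sup>2" by simp
        moreover have "2 * (1 + t\<^sup>2) * (1 + r\<^sup>2) = 2 + 2 * t\<^sup>2 + 2 * r\<^sup>2 + 2 * (t\<^sup>2 * r\<^sup>2)"
          by (simp add: algebra_simps)
        ultimately show ?thesis using power2_add_le[of t r] by linarith
      qed
      then have "(1 + (t + r)\<^sup>2)\<^sup>2 \<le> (2 * (1 + t\<^sup>2) * (1 + r\<^sup>2))\<^sup>2" by (intro power_mono) auto
      then have "(1 + (t + r)\<^sup>2)\<^sup>2 \<le> 4 * (1 + t\<^sup>2)\<^sup>2 * (1 + r\<^sup>2)\<^sup>2" by (simp only: power_mult_distrib) simp
      then have "1 / (1 + r\<^sup>2)\<^sup>2 \<le> 4 * (1 + t\<^sup>2)\<^sup>2 / (1 + (t + r)\<^sup>2)\<^sup>2"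
        by (simp add: pos_le_divide_eq[OF square_weight_pos] pos_divide_le_eq[OF square_weight_pos] del: zero_less_power2)
      from mult_left_mono[OF this, of "2 * ?A"]
      have "2 * ?A / (1 + r\<^sup>2)\<^sup>2 \<le> ?K * (?A / (1 + (t + r)\<^sup>2)\<^sup>2)" by (simp add: mult_ac)
      with 1 have "(norm (shift t \<omega> r))\<^sup>2 / (1 + r\<^sup>2)\<^sup>2
          \<le> ?K * (?A / (1 + (t + r)\<^sup>2)\<^sup>2) + 2 * ?B * (1 / (1 + r\<^sup>2)\<^sup>2)"
        by (simp add: add_divide_distrib)
      then show "norm ((norm (shift t \<omega> r))\<^sup>2 / (1 + r\<^sup>2)\<^sup>2)
        \<le> norm (?K * (?A / (1 + (t + r)\<^sup>2)\<^sup>2) + 2 * ?B * (1 / (1 + r\<^sup>2)\<^sup>2))" by simp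
    qed
  qed measurable
qed

lemma tame_path_shift_iff: "\<omega> \<in> wiener_paths \<Longrightarrow> tame_path (shift t \<omega>) \<longleftrightarrow> tame_path \<omega>"
  using tame_path_shift[of "shift t \<omega>" "- t"] tame_path_shift[of \<omega> t] by (auto simp: shift_shift shift_0)

lemma half_line_integrable_bound:
  fixes f :: "real \<Rightarrow> 'a::euclidean_space" and g :: "real \<Rightarrow> real"
  assumes "set_integrable lborel {..0} g" and [measurable]: "f \<in> borel_measurable borel"
    and le: "\<And>u. u \<le> 0 \<Longrightarrow> norm (f u) \<le> g u"
  shows "set_integrable lborel {..0} f"
  unfolding set_integrable_def
proof (rule Bochner_Integration.integrable_bound[OF assms(1)[unfolded set_integrable_def]])
  show "AE u in lborel. norm (indicator {..0} u *\<^sub>R f u) \<le> norm (indicator {..0} u *\<^sub>R g u)"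
    using le by (intro AE_I2) (auto simp: indicator_def intro: order_trans[OF _ abs_ge_self])
qed measurable

lemma integrable_imp_half_line_integrable:
  fixes f :: "real \<Rightarrow> real"
  shows "integrable lborel f \<Longrightarrow> set_integrable lborel {..0} f"
  unfolding set_integrable_def by (rule integrable_mult_indicator) simp_all

lemma set_integrable_exp_half_line:
  assumes "(c::real) > 0"
  shows "set_integrable lborel {..0} (\<lambda>u. exp (c * u))"
proof (rule half_line_integrable_bound[OF integrable_imp_half_line_integrable])
  let ?K = "(max 1 (4 / c)) ^ 4"
  show "integrable lborel (\<lambda>r::real. ?K * (1 / (1 + r\<^sup>2)\<^sup>2))"
    by (intro integrable_mult_right integrable_inverse_square_weight)
  show "norm (exp (c * u)) \<le> ?K * (1 / (1 + u\<^sup>2)\<^sup>2)" if "u \<le> 0" for u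
    using exp_times_power_bound[OF assms that] by simp
qed measurable

text \<open>On the negative half-line the polynomial weight dominates every
  \<open>exp (c * u)\<close> up to a constant. The summand 1 also covers terms linear in the
  norm.\<close>

lemma tame_path_integrable:
  assumes "tame_path \<omega>" "c > 0"
  shows "set_integrable lborel {..0} (\<lambda>u. exp (c * u) * (1 + (norm (\<omega> u))\<^sup>2))"
proof -
  have w: "\<omega> \<in> wiener_paths" and i: "integrable lborel (\<lambda>r. (norm (\<omega> r))\<^sup>2 / (1 + r\<^sup>2)\<^sup>2)"
    using assms by (auto simp: tame_path_def)
  have [measurable]: "\<omega> \<in> borel_measurable borel"
    by (rule borel_measurable_continuous_onI[OF wiener_paths_continuous[OF w]])
  let ?K = "(max 1 (4 / c)) ^ 4"
  have "set_integrable lborel {..0} (\<lambda>u. exp (c * u) * (norm (\<omega> u))\<^sup>2)"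
  proof (rule half_line_integrable_bound[OF integrable_imp_half_line_integrable])
    show "integrable lborel (\<lambda>r. ?K * ((norm (\<omega> r))\<^sup>2 / (1 + r\<^sup>2)\<^sup>2))"
      by (intro integrable_mult_right i)
    show "norm (exp (c * u) * (norm (\<omega> u))\<^sup>2) \<le> ?K * ((norm (\<omega> u))\<^sup>2 / (1 + u\<^sup>2)\<^sup>2)" if "u \<le> 0" for u
      using mult_right_mono[OF exp_times_power_bound[OF assms(2) that], of "(norm (\<omega> u))\<^sup>2"] by simp
  qed measurable
  then show ?thesis
    using set_integral_add(1)[OF set_integrable_exp_half_line[OF assms(2)]] by (simp add: distrib_left)
qed

lemma le_one_plus_square: "x \<le> 1 + x\<^sup>2" for x :: real
  using zero_le_power2[of "x - 1 / 2"] by (simp add: power2_eq_square algebra_simps)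

lemma tame_path_integrable_linear:
  assumes "tame_path \<omega>" "c > 0"
  shows "set_integrable lborel {..0} (\<lambda>u. exp (c * u) *\<^sub>R \<omega> u)"
    and "set_integrable lborel {..0} (\<lambda>u. exp (c * u) * norm (\<omega> u))"
proof -
  have w: "\<omega> \<in> wiener_paths" using assms by (auto simp: tame_path_def)
  have [measurable]: "\<omega> \<in> borel_measurable borel"
    by (rule borel_measurable_continuous_onI[OF wiener_paths_continuous[OF w]])
  have b: "exp (c * u) * norm (\<omega> u) \<le> exp (c * u) * (1 + (norm (\<omega> u))\<^sup>2)" for u
    using le_one_plus_square[of "norm (\<omega> u)"] by simp
  show "set_integrable lborel {..0} (\<lambda>u. exp (c * u) * norm (\<omega> u))"
    by (rule half_line_integrable_bound[OF tame_path_integrable[OF assms]]) (use b in simp_all)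
  show "set_integrable lborel {..0} (\<lambda>u. exp (c * u) *\<^sub>R \<omega> u)"
    by (rule half_line_integrable_bound[OF tame_path_integrable[OF assms]]) (use b in simp_all)
qed

section \<open>The Ornstein-Uhlenbeck process as a functional of the path\<close>

text \<open>
  The average \<open>y t = \<integral> exp r \<omega> (t + r) dr\<close> over \<open>r \<le> 0\<close> solves \<open>y' = \<omega> - y\<close>, so
  that \<open>\<epsilon> (\<omega> - y)\<close> is the stationary Ornstein-Uhlenbeck process.
\<close>

definition path_average :: "('n::finite) path \<Rightarrow> real \<Rightarrow> real ^ 'n" where
  "path_average \<omega> t = (LINT r:{..0}|lborel. exp r *\<^sub>R \<omega> (t + r))"

text \<open>
  The value \<open>0\<close> off the shift-invariant set of tame paths makes the driver continuous and tempered on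
  the whole path space, so that no exceptional set has to be treated separately.
\<close>

definition ou_process :: "real ^ 'n \<Rightarrow> ('n::finite) path \<Rightarrow> real ^ 'n" where
  "ou_process \<epsilon> \<omega> = (if tame_path \<omega> then - noise \<epsilon> (path_average \<omega> 0) else 0)"

definition ou_driver :: "real ^ 'n \<Rightarrow> ('n::finite) path \<Rightarrow> real \<Rightarrow> real ^ 'n" where
  "ou_driver \<epsilon> \<omega> t = ou_process \<epsilon> (shift t \<omega>)"

lemma noise_norm: "norm (noise \<epsilon> x) \<le> norm \<epsilon> * norm x"
proof -
  have "norm (noise \<epsilon> x) \<le> norm (norm \<epsilon> *\<^sub>R x)"
    by (rule norm_le_componentwise_cart)
      (auto simp: noise_def abs_mult intro!: mult_right_mono component_le_norm_cart)
  then show ?thesis by simp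
qed

lemma noise_bounded_linear: "bounded_linear (noise \<epsilon>)"
proof (rule bounded_linear_intro[where K = "norm \<epsilon>"])
  show "norm (noise \<epsilon> x) \<le> norm x * norm \<epsilon>" for x
    using noise_norm[of \<epsilon> x] by (simp add: mult.commute)
qed (auto simp: noise_def vec_eq_iff algebra_simps)

lemma noise_diff: "noise \<epsilon> (x - y) = noise \<epsilon> x - noise \<epsilon> y"
  by (simp add: noise_def vec_eq_iff algebra_simps)

lemma half_line_exp_substitution:
  fixes g :: "real \<Rightarrow> 'a::euclidean_space"
  shows "(LINT u:{..t}|lborel. exp u *\<^sub>R g u) = exp t *\<^sub>R (LINT r:{..0}|lborel. exp r *\<^sub>R g (t + r))"
proof -
  have "(LINT u:{..t}|lborel. exp u *\<^sub>R g u) = (LINT u|lborel. indicator {..t} u *\<^sub>R exp u *\<^sub>R g u)"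
    by (simp add: set_lebesgue_integral_def)
  also have "\<dots> = (LINT r|lborel. indicator {..t} (t + r) *\<^sub>R exp (t + r) *\<^sub>R g (t + r))"
    using lborel_integral_real_affine[of 1 "\<lambda>u. indicator {..t} u *\<^sub>R exp u *\<^sub>R g u" t] by simp
  also have "\<dots> = (LINT r|lborel. exp t *\<^sub>R (indicator {..0} r *\<^sub>R exp r *\<^sub>R g (t + r)))"
    by (rule Bochner_Integration.integral_cong) (auto simp: indicator_def exp_add)
  also have "\<dots> = exp t *\<^sub>R (LINT r:{..0}|lborel. exp r *\<^sub>R g (t + r))"
    unfolding set_lebesgue_integral_def by (rule integral_scaleR_right)
  finally show ?thesis .
qed

text \<open>Both sides of \<open>\<integral> exp u du = exp t \<cdot> I\<close>, over \<open>u \<le> t\<close>, have derivatives \<open>1\<close> and \<open>I\<close> at \<open>0\<close>.\<close>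

lemma LINT_exp_half_line: "(LINT r:{..0}|lborel. exp r) = (1::real)"
proof -
  let ?I = "LINT r:{..0::real}|lborel. exp r"
  have c: "continuous_on UNIV (exp :: real \<Rightarrow> real)" by (intro continuous_intros)
  have i: "set_integrable lborel {..0} (exp :: real \<Rightarrow> real)"
    using set_integrable_exp_half_line[of 1] by simp
  have "((\<lambda>t. LINT u:{..t}|lborel. exp u) has_real_derivative exp 0) (at (0::real))"
    unfolding has_real_derivative_iff_has_vector_derivative by (rule half_line_has_vector_derivative[OF c i])
  moreover have "(LINT u:{..t}|lborel. exp u) = exp t * ?I" for t :: real
    using half_line_exp_substitution[where g = "\<lambda>_. 1 :: real" and t = t] by simp
  then have "(\<lambda>t. LINT u:{..t}|lborel. exp u) = (\<lambda>t::real. exp t * ?I)" by (rule ext)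
  moreover have "((\<lambda>t. exp t * ?I) has_real_derivative ?I) (at 0)"
    by (rule derivative_eq_intros refl | simp)+
  ultimately show ?thesis using DERIV_unique by (metis exp_zero)
qed

text \<open>Moves \<open>t\<close> from the argument of the path to the endpoint of the integral,
  where it can be differentiated although \<omega> need not be differentiable.\<close>

lemma path_average_eq: "path_average \<omega> t = exp (- t) *\<^sub>R (LINT u:{..t}|lborel. exp u *\<^sub>R \<omega> u)"
  unfolding half_line_exp_substitution[where t = t] path_average_def by (simp add: exp_minus)

lemma path_average_has_derivative:
  assumes "tame_path \<omega>"
  shows "(path_average \<omega> has_vector_derivative \<omega> t - path_average \<omega> t) (at t)"
proof -
  have w: "continuous_on UNIV \<omega>" using assms wiener_paths_continuous by (auto simp: tame_path_def)
  have c: "continuous_on UNIV (\<lambda>u. exp u *\<^sub>R \<omega> u)" by (intro continuous_intros w)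
  have i: "set_integrable lborel {..0} (\<lambda>u. exp u *\<^sub>R \<omega> u)"
    using tame_path_integrable_linear(1)[OF assms, of 1] by simp
  have "((\<lambda>t. exp (- t)) has_real_derivative - exp (- t)) (at t)"
    by (auto intro!: derivative_eq_intros)
  from has_vector_derivative_scaleR[OF this half_line_has_vector_derivative[OF c i]]
  have "((\<lambda>t. exp (- t) *\<^sub>R (LINT u:{..t}|lborel. exp u *\<^sub>R \<omega> u)) has_vector_derivative
      \<omega> t - path_average \<omega> t) (at t)"
    by (simp add: path_average_eq exp_minus)
  then show ?thesis by (simp add: path_average_eq[abs_def])
qed

text \<open>Shifting the path subtracts \<open>\<omega> t\<close> under the integral, and the kernel
  \<open>exp\<close> has total mass 1 on the half-line.\<close>

lemma ou_driver_eq: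
  assumes "tame_path \<omega>"
  shows "ou_driver \<epsilon> \<omega> t = noise \<epsilon> (\<omega> t - path_average \<omega> t)"
proof -
  have t: "tame_path (shift t \<omega>)" by (rule tame_path_shift[OF assms])
  have i1: "set_integrable lborel {..0} (\<lambda>r. exp r *\<^sub>R shift t \<omega> r)"
    using tame_path_integrable_linear(1)[OF t, of 1] by simp
  have i2: "set_integrable lborel {..0} (\<lambda>r. exp r *\<^sub>R \<omega> t)"
  proof -
    have "integrable lborel (\<lambda>r. (indicator {..0} r *\<^sub>R exp r) *\<^sub>R \<omega> t)"
      using set_integrable_exp_half_line[of 1] by (intro integrable_scaleR_left) (simp add: set_integrable_def)
    then show ?thesis by (simp add: set_integrable_def)
  qed
  have "path_average \<omega> t = (LINT r:{..0}|lborel. exp r *\<^sub>R shift t \<omega> r + exp r *\<^sub>R \<omega> t)"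
    by (simp add: path_average_def shift_def scaleR_add_right[symmetric])
  also have "\<dots> = path_average (shift t \<omega>) 0 + (LINT r:{..0}|lborel. exp r *\<^sub>R \<omega> t)"
    using set_integral_add(2)[OF i1 i2] by (simp add: path_average_def)
  also have "(LINT r:{..0}|lborel. exp r *\<^sub>R \<omega> t) = (LINT r:{..0}|lborel. exp r) *\<^sub>R \<omega> t"
    unfolding set_lebesgue_integral_def scaleR_scaleR[symmetric]
    using set_integrable_exp_half_line[of 1]
    by (subst integral_scaleR_left[symmetric]) (auto simp: set_integrable_def)
  finally have "path_average (shift t \<omega>) 0 = path_average \<omega> t - \<omega> t" by (simp add: LINT_exp_half_line)
  then show ?thesis using t by (simp add: ou_driver_def ou_process_def noise_diff)
qed

lemma ou_driver_not_tame:
  "\<omega> \<in> wiener_paths \<Longrightarrow> \<not> tame_path \<omega> \<Longrightarrow> ou_driver \<epsilon> \<omega> t = 0"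
  by (simp add: ou_driver_def ou_process_def tame_path_shift_iff)

lemma ou_driver_shift: "ou_driver \<epsilon> (shift s \<omega>) t = ou_driver \<epsilon> \<omega> (s + t)"
  by (simp add: ou_driver_def shift_shift)

lemma path_average_continuous: "tame_path \<omega> \<Longrightarrow> continuous_on S (path_average \<omega>)"
  by (rule has_vector_derivative_imp_continuous_on) (rule path_average_has_derivative)

lemma ou_driver_continuous:
  assumes "\<omega> \<in> wiener_paths"
  shows "continuous_on UNIV (ou_driver \<epsilon> \<omega>)"
proof (cases "tame_path \<omega>")
  case True
  have "continuous_on UNIV (\<lambda>t. noise \<epsilon> (\<omega> t - path_average \<omega> t))"
    by (intro bounded_linear.continuous_on[OF noise_bounded_linear] continuous_on_diff
        wiener_paths_continuous[OF assms] path_average_continuous[OF True])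
  then show ?thesis by (simp add: ou_driver_eq[OF True, abs_def])
next
  case False
  then show ?thesis using ou_driver_not_tame[OF assms False] by (simp add: fun_eq_iff[symmetric])
qed

text \<open>For \<open>v \<le> u\<close> the kernel satisfies
  \<open>exp v \<le> exp ((1 - c) * u) * exp (c * v)\<close>. Keeping only the fraction
  \<open>c\<close> of the decay inside the integral shows that the average grows into the past at a
  rate as small as desired.\<close>

lemma path_average_bound:
  assumes t: "tame_path \<omega>" and c: "0 < c" "c \<le> 1" and "u \<le> 0"
  shows "norm (path_average \<omega> u) \<le> exp (- c * u) * (LINT v:{..0}|lborel. exp (c * v) * norm (\<omega> v))"
proof -
  have w: "continuous_on UNIV \<omega>" using t wiener_paths_continuous by (auto simp: tame_path_def)
  let ?J = "LINT v:{..0}|lborel. exp (c * v) * norm (\<omega> v)"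
  note i = tame_path_integrable_linear(2)[OF t c(1)]
  have "norm (LINT v:{..u}|lborel. exp v *\<^sub>R \<omega> v) \<le> (LINT v|lborel. exp ((1 - c) * u) * (indicator {..0} v *\<^sub>R (exp (c * v) * norm (\<omega> v))))"
    unfolding set_lebesgue_integral_def
  proof (rule Bochner_Integration.integral_norm_bound_integral)
    have "set_integrable lborel {..u} (\<lambda>v. exp v *\<^sub>R \<omega> v)"
    proof (rule half_line_integral(1))
      show "continuous_on UNIV (\<lambda>v. exp v *\<^sub>R \<omega> v)" by (intro continuous_intros w)
    qed (use tame_path_integrable_linear(1)[OF t, of 1] in simp)
    then show "integrable lborel (\<lambda>v. indicator {..u} v *\<^sub>R exp v *\<^sub>R \<omega> v)"
      by (simp only: set_integrable_def)
    show "integrable lborel (\<lambda>v. exp ((1 - c) * u) * (indicator {..0} v *\<^sub>R (exp (c * v) * norm (\<omega> v))))"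
      using i unfolding set_integrable_def by (rule integrable_mult_right)
    fix v
    show "norm (indicator {..u} v *\<^sub>R exp v *\<^sub>R \<omega> v) \<le> exp ((1 - c) * u) * (indicator {..0} v *\<^sub>R (exp (c * v) * norm (\<omega> v)))"
    proof (cases "v \<le> u")
      case True
      have "v = (1 - c) * v + c * v" by (simp add: algebra_simps)
      also have "\<dots> \<le> (1 - c) * u + c * v" using mult_left_mono[OF True, of "1 - c"] c by simp
      finally have "exp v \<le> exp ((1 - c) * u) * exp (c * v)" by (simp flip: exp_add)
      from mult_right_mono[OF this, of "norm (\<omega> v)"] show ?thesis
        using True \<open>u \<le> 0\<close> by (simp add: mult_ac)
    qed (simp add: indicator_def)
  qed
  also have "\<dots> = exp ((1 - c) * u) * ?J" unfolding set_lebesgue_integral_def by simp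
  finally have "exp (- u) * norm (LINT v:{..u}|lborel. exp v *\<^sub>R \<omega> v) \<le> exp (- u) * (exp ((1 - c) * u) * ?J)"
    by simp
  also have "\<dots> = (exp (- u) * exp ((1 - c) * u)) * ?J" by simp
  also have "exp (- u) * exp ((1 - c) * u) = exp (- c * u)" by (simp add: exp_add[symmetric] algebra_simps)
  finally show ?thesis by (simp add: path_average_eq)
qed

lemma path_average_integrable:
  assumes t: "tame_path \<omega>" and "\<gamma> > 0"
  shows "set_integrable lborel {..0} (\<lambda>u. exp (\<gamma> * u) * (norm (path_average \<omega> u))\<^sup>2)"
proof (rule half_line_integrable_bound)
  \<comment> \<open>Squaring doubles the rate \<open>c\<close>, so
    \<open>c \<le> \<gamma> / 4\<close> leaves at least \<open>\<gamma> / 2\<close> for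
    integrability.\<close>
  define c where "c = min 1 (\<gamma> / 4)"
  have c: "0 < c" "c \<le> 1" "c \<le> \<gamma> / 4" using \<open>\<gamma> > 0\<close> by (auto simp: c_def)
  define J where "J = (LINT v:{..0}|lborel. exp (c * v) * norm (\<omega> v))"
  show "set_integrable lborel {..0} (\<lambda>u. exp (\<gamma> / 2 * u) * J\<^sup>2)"
    using set_integrable_exp_half_line[of "\<gamma> / 2"] \<open>\<gamma> > 0\<close> by simp
  have [measurable]: "path_average \<omega> \<in> borel_measurable borel"
    by (rule borel_measurable_continuous_onI[OF path_average_continuous[OF t]])
  show "(\<lambda>u. exp (\<gamma> * u) * (norm (path_average \<omega> u))\<^sup>2) \<in> borel_measurable borel"
    by measurable
  show "norm (exp (\<gamma> * u) * (norm (path_average \<omega> u))\<^sup>2) \<le> exp (\<gamma> / 2 * u) * J\<^sup>2" if "u \<le> 0" for u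
  proof -
    have "norm (path_average \<omega> u) \<le> exp (- c * u) * J"
      unfolding J_def by (rule path_average_bound[OF t c(1,2) that])
    then have "(norm (path_average \<omega> u))\<^sup>2 \<le> (exp (- c * u) * J)\<^sup>2" by (intro power_mono) auto
    also have "\<dots> = exp (- 2 * c * u) * J\<^sup>2"
      by (simp add: power_mult_distrib exp_double[symmetric])
    finally have "exp (\<gamma> * u) * (norm (path_average \<omega> u))\<^sup>2 \<le> exp (\<gamma> * u) * (exp (- 2 * c * u) * J\<^sup>2)"
      by simp
    also have "\<dots> = (exp (\<gamma> * u) * exp (- 2 * c * u)) * J\<^sup>2" by simp
    also have "exp (\<gamma> * u) * exp (- 2 * c * u) = exp ((\<gamma> - 2 * c) * u)"
      by (simp add: exp_add[symmetric] algebra_simps)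
    also have "exp ((\<gamma> - 2 * c) * u) * J\<^sup>2 \<le> exp (\<gamma> / 2 * u) * J\<^sup>2"
    proof (intro mult_right_mono)
      have "(\<gamma> - 2 * c) * u \<le> \<gamma> / 2 * u" using c that by (intro mult_right_mono_neg) auto
      then show "exp ((\<gamma> - 2 * c) * u) \<le> exp (\<gamma> / 2 * u)" by simp
    qed simp
    finally show ?thesis by simp
  qed
qed

lemma ou_driver_tempered:
  assumes "\<omega> \<in> wiener_paths"
  shows "tempered_driver (ou_driver \<epsilon> \<omega>)"
  unfolding tempered_driver_def
proof (intro conjI allI impI)
  show c: "continuous_on UNIV (ou_driver \<epsilon> \<omega>)" by (rule ou_driver_continuous[OF assms])
  fix \<gamma> :: real assume \<gamma>: "\<gamma> > 0"
  let ?\<zeta> = "ou_driver \<epsilon> \<omega>"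
  let ?g = "\<lambda>u. exp (\<gamma> * u) * (1 + (norm (?\<zeta> u))\<^sup>2)"
  have cg: "continuous_on UNIV ?g" by (intro continuous_intros c)
  have "set_integrable lborel {..0} (\<lambda>u. exp (\<gamma> * u) * (norm (?\<zeta> u))\<^sup>2)"
  proof (cases "tame_path \<omega>")
    case True
    let ?b = "\<lambda>u. 2 * (norm \<epsilon>)\<^sup>2 * (exp (\<gamma> * u) * (1 + (norm (\<omega> u))\<^sup>2) + exp (\<gamma> * u) * (norm (path_average \<omega> u))\<^sup>2)"
    have "set_integrable lborel {..0} ?b"
      by (intro set_integrable_mult_right set_integral_add(1) tame_path_integrable[OF True \<gamma>]
          path_average_integrable[OF True \<gamma>])
    then show ?thesis
    proof (rule half_line_integrable_bound)
      have [measurable]: "?\<zeta> \<in> borel_measurable borel" by (rule borel_measurable_continuous_onI[OF c])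
      show "(\<lambda>u. exp (\<gamma> * u) * (norm (?\<zeta> u))\<^sup>2) \<in> borel_measurable borel" by measurable
      fix u
      have "norm (?\<zeta> u) \<le> norm \<epsilon> * (norm (\<omega> u) + norm (path_average \<omega> u))"
        unfolding ou_driver_eq[OF True]
        by (rule order_trans[OF noise_norm]) (intro mult_left_mono norm_triangle_ineq4 norm_ge_zero)
      then have "(norm (?\<zeta> u))\<^sup>2 \<le> (norm \<epsilon> * (norm (\<omega> u) + norm (path_average \<omega> u)))\<^sup>2"
        by (intro power_mono) auto
      also have "\<dots> \<le> (norm \<epsilon>)\<^sup>2 * (2 * (norm (\<omega> u))\<^sup>2 + 2 * (norm (path_average \<omega> u))\<^sup>2)"
        unfolding power_mult_distrib by (intro mult_left_mono power2_add_le) simp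
      also have "\<dots> \<le> (norm \<epsilon>)\<^sup>2 * (2 * (1 + (norm (\<omega> u))\<^sup>2) + 2 * (norm (path_average \<omega> u))\<^sup>2)"
        by (intro mult_left_mono) auto
      finally have "exp (\<gamma> * u) * (norm (?\<zeta> u))\<^sup>2
          \<le> exp (\<gamma> * u) * ((norm \<epsilon>)\<^sup>2 * (2 * (1 + (norm (\<omega> u))\<^sup>2) + 2 * (norm (path_average \<omega> u))\<^sup>2))"
        by simp
      also have "\<dots> = ?b u" by (simp add: algebra_simps)
      finally have "exp (\<gamma> * u) * (norm (?\<zeta> u))\<^sup>2 \<le> ?b u" .
      then show "norm (exp (\<gamma> * u) * (norm (?\<zeta> u))\<^sup>2) \<le> ?b u" by simp
    qed
  next
    case False
    then show ?thesis by (simp add: ou_driver_not_tame[OF assms False] set_integrable_def)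
  qed
  from set_integral_add(1)[OF set_integrable_exp_half_line[OF \<gamma>] this]
  have ig: "set_integrable lborel {..0} ?g" by (simp add: distrib_left)
  \<comment> \<open>Variation of constants from minus infinity for the differential equation in
    \<open>tempering\<close>.\<close>
  define q where "q t = exp (- \<gamma> * t) * (LINT u:{..t}|lborel. ?g u)" for t
  have "q t \<ge> 0" for t
    unfolding q_def set_lebesgue_integral_def
    by (intro mult_nonneg_nonneg Bochner_Integration.integral_nonneg) (auto simp: indicator_def)
  moreover have "(q has_real_derivative - \<gamma> * q t + 1 + (norm (?\<zeta> t))\<^sup>2) (at t)" for t
  proof -
    have d: "((\<lambda>t. LINT u:{..t}|lborel. ?g u) has_real_derivative ?g t) (at t)"
      unfolding has_real_derivative_iff_has_vector_derivative
      by (rule half_line_has_vector_derivative[OF cg ig])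
    have "(q has_real_derivative - \<gamma> * exp (- \<gamma> * t) * (LINT u:{..t}|lborel. ?g u) + ?g t * exp (- \<gamma> * t)) (at t)"
      unfolding q_def by (rule derivative_eq_intros d refl | simp)+
    moreover have "- \<gamma> * exp (- \<gamma> * t) * (LINT u:{..t}|lborel. ?g u) + ?g t * exp (- \<gamma> * t)
        = - \<gamma> * q t + 1 + (norm (?\<zeta> t))\<^sup>2"
    proof -
      have "exp (\<gamma> * t) * exp (- \<gamma> * t) = 1" by (simp add: exp_add[symmetric])
      moreover have "?g t * exp (- \<gamma> * t) = (exp (\<gamma> * t) * exp (- \<gamma> * t)) * (1 + (norm (?\<zeta> t))\<^sup>2)"
        by (simp only: mult_ac)
      ultimately have "?g t * exp (- \<gamma> * t) = 1 + (norm (?\<zeta> t))\<^sup>2" by simp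
      then show ?thesis by (simp add: q_def)
    qed
    ultimately show ?thesis by (simp only:)
  qed
  ultimately show "\<exists>q. tempering \<gamma> ?\<zeta> q" unfolding tempering_def by blast
qed

text \<open>By the equation of \<open>path_average\<close>, the driver is the derivative of
  \<open>noise \<epsilon> (path_average \<omega> t)\<close>; the stated value is this primitive
  expressed through the path and the driver.\<close>

lemma ou_driver_has_integral:
  assumes "tame_path \<omega>" "s \<le> t"
  shows "(ou_driver \<epsilon> \<omega> has_integral
    (noise \<epsilon> (\<omega> t - \<omega> s) - (ou_driver \<epsilon> \<omega> t - ou_driver \<epsilon> \<omega> s))) {s..t}"
proof -
  have "((\<lambda>t. noise \<epsilon> (\<omega> t - path_average \<omega> t)) has_integral
      noise \<epsilon> (path_average \<omega> t) - noise \<epsilon> (path_average \<omega> s)) {s..t}"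
  proof (rule fundamental_theorem_of_calculus[OF assms(2)])
    show "((\<lambda>t. noise \<epsilon> (path_average \<omega> t)) has_vector_derivative noise \<epsilon> (\<omega> x - path_average \<omega> x)) (at x within {s..t})" for x
      by (rule bounded_linear.has_vector_derivative[OF noise_bounded_linear
            has_vector_derivative_at_within[OF path_average_has_derivative[OF assms(1)]]])
  qed
  then show ?thesis by (simp add: ou_driver_eq[OF assms(1), abs_def] noise_diff algebra_simps)
qed

section \<open>Measurability and almost sure tameness\<close>

locale wiener_space =
  fixes P :: "('n::{finite,linorder}) path measure"
  assumes wiener: "wiener_measure P"
begin

sublocale prob_space P
  using wiener by (simp add: wiener_measure_def)

lemma space_eq: "space P = wiener_paths"
proof -
  have "space P = space path_algebra"
    using wiener by (intro sets_eq_imp_space_eq) (simp add: wiener_measure_def)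
  then show ?thesis by (simp add: path_algebra_def space_restrict_space space_PiM)
qed

lemma eval_measurable: "(\<lambda>\<omega>. \<omega> t) \<in> borel_measurable P"
proof -
  have "(\<lambda>\<omega>. \<omega> t) \<in> borel_measurable (path_algebra :: 'n path measure)"
    unfolding path_algebra_def by (intro measurable_restrict_space1 measurable_component_singleton) simp
  moreover have "sets P = sets path_algebra" using wiener by (simp add: wiener_measure_def)
  ultimately show ?thesis using measurable_cong_sets by blast
qed

text \<open>Rounding the time down to a multiple of \<open>1 / (n + 1)\<close> leaves countably many
  evaluations, each measurable; continuity of the paths gives convergence.\<close>

lemma path_eval_measurable: "(\<lambda>z. fst z (snd z)) \<in> borel_measurable (P \<Otimes>\<^sub>M borel)"
proof (rule borel_measurable_LIMSEQ_metric)
  show "(\<lambda>z. fst z (of_int \<lfloor>real (Suc n) * snd z\<rfloor> / real (Suc n))) \<in> borel_measurable (P \<Otimes>\<^sub>M borel)" for n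
  proof (rule measurable_compose_countable[where f = "\<lambda>i z. fst z (of_int i / real (Suc n))"
        and g = "\<lambda>z. \<lfloor>real (Suc n) * snd z\<rfloor>"])
    show "(\<lambda>z. fst z (of_int i / real (Suc n))) \<in> borel_measurable (P \<Otimes>\<^sub>M borel)" for i
      by (rule measurable_compose[OF measurable_fst eval_measurable])
  qed measurable
  fix z assume "z \<in> space (P \<Otimes>\<^sub>M (borel :: real measure))"
  then have w: "fst z \<in> wiener_paths" by (auto simp: space_pair_measure space_eq)
  let ?t = "snd z"
  have "(\<lambda>n. of_int \<lfloor>real (Suc n) * ?t\<rfloor> / real (Suc n)) \<longlonglongrightarrow> ?t"
  proof (rule tendsto_sandwich[where f = "\<lambda>n. ?t - inverse (real (Suc n))" and h = "\<lambda>n. ?t"])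
    show "\<forall>\<^sub>F n in sequentially. ?t - inverse (real (Suc n)) \<le> of_int \<lfloor>real (Suc n) * ?t\<rfloor> / real (Suc n)"
    proof (intro always_eventually allI)
      fix n
      have "real (Suc n) * ?t - 1 \<le> of_int \<lfloor>real (Suc n) * ?t\<rfloor>" by linarith
      from divide_right_mono[OF this, of "real (Suc n)"]
      show "?t - inverse (real (Suc n)) \<le> of_int \<lfloor>real (Suc n) * ?t\<rfloor> / real (Suc n)"
        by (simp add: diff_divide_distrib inverse_eq_divide)
    qed
    show "\<forall>\<^sub>F n in sequentially. of_int \<lfloor>real (Suc n) * ?t\<rfloor> / real (Suc n) \<le> ?t"
    proof (intro always_eventually allI)
      fix n
      have "of_int \<lfloor>real (Suc n) * ?t\<rfloor> \<le> real (Suc n) * ?t" by linarith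
      then show "of_int \<lfloor>real (Suc n) * ?t\<rfloor> / real (Suc n) \<le> ?t"
        by (simp add: pos_divide_le_eq mult.commute)
    qed
    show "(\<lambda>n. ?t - inverse (real (Suc n))) \<longlonglongrightarrow> ?t"
      using tendsto_diff[OF tendsto_const LIMSEQ_inverse_real_of_nat] by simp
  qed simp
  then show "(\<lambda>n. fst z (of_int \<lfloor>real (Suc n) * ?t\<rfloor> / real (Suc n))) \<longlonglongrightarrow> fst z ?t"
    by (rule continuous_on_tendsto_compose[OF wiener_paths_continuous[OF w, of UNIV]]) auto
qed

lemma path_eval_measurable_compose:
  assumes "f \<in> M \<rightarrow>\<^sub>M P" "g \<in> borel_measurable M"
  shows "(\<lambda>x. f x (g x)) \<in> borel_measurable M"
  using measurable_compose[OF measurable_Pair[OF assms] path_eval_measurable] by simp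

text \<open>The nonnegative integral is measurable in \<omega>, which the integrability predicate
  does not display.\<close>

lemma tame_path_iff:
  assumes "\<omega> \<in> space P"
  shows "tame_path \<omega> \<longleftrightarrow> (\<integral>\<^sup>+ r. ennreal ((norm (\<omega> r))\<^sup>2 / (1 + r\<^sup>2)\<^sup>2) \<partial>lborel) < \<infinity>"
proof -
  have w: "\<omega> \<in> wiener_paths" using assms by (simp add: space_eq)
  have [measurable]: "\<omega> \<in> borel_measurable borel"
    by (rule borel_measurable_continuous_onI[OF wiener_paths_continuous[OF w]])
  show ?thesis by (simp add: tame_path_def w integrable_iff_bounded)
qed

lemma weight_measurable:
  "(\<lambda>z. ennreal ((norm (fst z (snd z)))\<^sup>2 / (1 + (snd z)\<^sup>2)\<^sup>2)) \<in> borel_measurable (P \<Otimes>\<^sub>M lborel)"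
proof -
  have [measurable]: "(\<lambda>z. fst z (snd z)) \<in> borel_measurable (P \<Otimes>\<^sub>M lborel)"
    by (rule path_eval_measurable_compose) measurable
  show ?thesis by measurable
qed

lemma tame_path_measurable: "Measurable.pred P tame_path"
proof -
  have "(\<lambda>\<omega>. \<integral>\<^sup>+ r. ennreal ((norm (\<omega> r))\<^sup>2 / (1 + r\<^sup>2)\<^sup>2) \<partial>lborel) \<in> borel_measurable P"
    using lborel.borel_measurable_nn_integral[of "\<lambda>\<omega> r. ennreal ((norm (\<omega> r))\<^sup>2 / (1 + r\<^sup>2)\<^sup>2)" P]
      weight_measurable by (simp add: case_prod_beta)
  then have "Measurable.pred P (\<lambda>\<omega>. (\<integral>\<^sup>+ r. ennreal ((norm (\<omega> r))\<^sup>2 / (1 + r\<^sup>2)\<^sup>2) \<partial>lborel) < \<infinity>)"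
    by measurable
  then show ?thesis by (rule measurable_cong[THEN iffD1, rotated]) (simp add: tame_path_iff)
qed

section \<open>Gaussian second moments and almost sure tameness\<close>

lemma nn_integral_increment:
  assumes "s < t"
  shows "(\<integral>\<^sup>+ \<omega>. ennreal (((\<omega> t - \<omega> s) $ i)\<^sup>2) \<partial>P) = ennreal (t - s)"
proof -
  let ?f = "normal_density 0 (sqrt (t - s))"
  have d: "distributed P lborel (\<lambda>\<omega>. (\<omega> t - \<omega> s) $ i) ?f"
    using wiener assms by (simp add: wiener_measure_def)
  have "(\<integral>\<^sup>+ \<omega>. ennreal (((\<omega> t - \<omega> s) $ i)\<^sup>2) \<partial>P) = (\<integral>\<^sup>+ x. ennreal (?f x) * ennreal (x\<^sup>2) \<partial>lborel)"
    by (rule distributed_nn_integral[OF d, symmetric]) measurable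
  also have "\<dots> = (\<integral>\<^sup>+ x. ennreal (?f x * x\<^sup>2) \<partial>lborel)"
    by (intro nn_integral_cong) (simp add: ennreal_mult)
  also have "\<dots> = ennreal (LINT x|lborel. ?f x * x\<^sup>2)"
    using integrable_normal_moment[of "sqrt (t - s)" 0 2] assms
    by (intro nn_integral_eq_integral) auto
  also have "(LINT x|lborel. ?f x * x\<^sup>2) = t - s"
    using integral_normal_moment_even[of "sqrt (t - s)" 0 1] assms by (simp add: fact_2)
  finally show ?thesis .
qed

lemma nn_integral_coordinate: "(\<integral>\<^sup>+ \<omega>. ennreal ((\<omega> r $ i)\<^sup>2) \<partial>P) = ennreal \<bar>r\<bar>"
proof -
  have 0: "\<omega> 0 = 0" if "\<omega> \<in> space P" for \<omega> using that by (simp add: space_eq wiener_paths_def)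
  consider "r = 0" | "r > 0" | "r < 0" by linarith
  then show ?thesis
  proof cases
    case 1
    then have "(\<integral>\<^sup>+ \<omega>. ennreal ((\<omega> r $ i)\<^sup>2) \<partial>P) = (\<integral>\<^sup>+ \<omega>. 0 \<partial>P)"
      by (intro nn_integral_cong) (simp add: 0)
    then show ?thesis using 1 by simp
  next
    case 2
    have "(\<integral>\<^sup>+ \<omega>. ennreal ((\<omega> r $ i)\<^sup>2) \<partial>P) = (\<integral>\<^sup>+ \<omega>. ennreal (((\<omega> r - \<omega> 0) $ i)\<^sup>2) \<partial>P)"
      by (intro nn_integral_cong) (simp add: 0)
    then show ?thesis using nn_integral_increment[OF 2, of i] 2 by simp
  next
    case 3
    have "(\<integral>\<^sup>+ \<omega>. ennreal ((\<omega> r $ i)\<^sup>2) \<partial>P) = (\<integral>\<^sup>+ \<omega>. ennreal (((\<omega> 0 - \<omega> r) $ i)\<^sup>2) \<partial>P)"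
      by (intro nn_integral_cong) (simp add: 0)
    then show ?thesis using nn_integral_increment[OF 3, of i] 3 by simp
  qed
qed

lemma nn_integral_norm: "(\<integral>\<^sup>+ \<omega>. ennreal ((norm (\<omega> r))\<^sup>2) \<partial>P) = ennreal (real CARD('n) * \<bar>r\<bar>)"
proof -
  have m: "(\<lambda>\<omega>. \<omega> r $ i) \<in> borel_measurable P" for i
    by (rule measurable_compose[OF eval_measurable]) (rule borel_measurable_continuous_onI, intro continuous_intros)
  have "(\<integral>\<^sup>+ \<omega>. ennreal ((norm (\<omega> r))\<^sup>2) \<partial>P) = (\<integral>\<^sup>+ \<omega>. (\<Sum>i\<in>UNIV. ennreal ((\<omega> r $ i)\<^sup>2)) \<partial>P)"
    by (simp add: power2_norm_vec sum_ennreal)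
  also have "\<dots> = (\<Sum>i\<in>UNIV. \<integral>\<^sup>+ \<omega>. ennreal ((\<omega> r $ i)\<^sup>2) \<partial>P)"
    by (rule nn_integral_sum) (use m in measurable)
  also have "\<dots> = ennreal (real CARD('n) * \<bar>r\<bar>)"
    by (simp add: nn_integral_coordinate ennreal_mult ennreal_of_nat_eq_real_of_nat)
  finally show ?thesis .
qed

text \<open>Exchanging the integrals, the expected weighted square integral equals that of
  \<open>CARD('n) * |r| / (1 + r\<^sup>2)\<^sup>2\<close>, which lies below a multiple of
  \<open>inverse (1 + r\<^sup>2)\<close>.\<close>

lemma AE_tame_path: "AE \<omega> in P. tame_path \<omega>"
proof -
  interpret pair_sigma_finite P lborel ..
  let ?f = "\<lambda>(\<omega> :: 'n path) r. ennreal ((norm (\<omega> r))\<^sup>2 / (1 + r\<^sup>2)\<^sup>2)"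
  have "(\<integral>\<^sup>+ \<omega>. \<integral>\<^sup>+ r. ?f \<omega> r \<partial>lborel \<partial>P) = (\<integral>\<^sup>+ r. \<integral>\<^sup>+ \<omega>. ?f \<omega> r \<partial>P \<partial>lborel)"
    using Fubini'[of ?f] weight_measurable by (simp add: case_prod_beta)
  also have "\<dots> = (\<integral>\<^sup>+ r. ennreal (real CARD('n) * \<bar>r\<bar> / (1 + r\<^sup>2)\<^sup>2) \<partial>lborel)"
  proof (rule nn_integral_cong)
    fix r :: real
    have m: "(\<lambda>\<omega>. ennreal ((norm (\<omega> r))\<^sup>2)) \<in> borel_measurable P"
      using eval_measurable[of r] by measurable
    have "(\<integral>\<^sup>+ \<omega>. ?f \<omega> r \<partial>P) = (\<integral>\<^sup>+ \<omega>. ennreal (1 / (1 + r\<^sup>2)\<^sup>2) * ennreal ((norm (\<omega> r))\<^sup>2) \<partial>P)"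
      by (intro nn_integral_cong) (simp add: ennreal_mult[symmetric])
    also have "\<dots> = ennreal (1 / (1 + r\<^sup>2)\<^sup>2) * ennreal (real CARD('n) * \<bar>r\<bar>)"
      unfolding nn_integral_cmult[OF m] nn_integral_norm ..
    finally show "(\<integral>\<^sup>+ \<omega>. ?f \<omega> r \<partial>P) = ennreal (real CARD('n) * \<bar>r\<bar> / (1 + r\<^sup>2)\<^sup>2)"
      by (simp add: ennreal_mult[symmetric])
  qed
  also have "\<dots> \<le> (\<integral>\<^sup>+ r. ennreal (real CARD('n) * inverse (1 + r\<^sup>2)) \<partial>lborel)"
  proof (intro nn_integral_mono ennreal_leI)
    fix r :: real
    have "\<bar>r\<bar> \<le> 1 + r\<^sup>2" using le_one_plus_square[of "\<bar>r\<bar>"] by simp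
    then have "\<bar>r\<bar> / (1 + r\<^sup>2)\<^sup>2 \<le> (1 + r\<^sup>2) / (1 + r\<^sup>2)\<^sup>2" by (rule divide_right_mono) simp
    also have "\<dots> = inverse (1 + r\<^sup>2)"
    proof -
      have "x / x\<^sup>2 = inverse x" if "x > 0" for x :: real
        using that by (simp add: power2_eq_square field_simps)
      then show ?thesis by (simp add: add_pos_nonneg)
    qed
    finally have "CARD('n) * (\<bar>r\<bar> / (1 + r\<^sup>2)\<^sup>2) \<le> CARD('n) * inverse (1 + r\<^sup>2)"
      by (intro mult_left_mono) auto
    then show "CARD('n) * \<bar>r\<bar> / (1 + r\<^sup>2)\<^sup>2 \<le> CARD('n) * inverse (1 + r\<^sup>2)" by simp
  qed
  also have "\<dots> < \<infinity>"
    using integrable_mult_right[OF integrable_inverse_1_plus_square_lborel, of "real CARD('n)"]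
    by (subst nn_integral_eq_integral) auto
  finally have "(\<integral>\<^sup>+ \<omega>. \<integral>\<^sup>+ r. ?f \<omega> r \<partial>lborel \<partial>P) \<noteq> \<infinity>" by simp
  moreover have "(\<lambda>\<omega>. \<integral>\<^sup>+ r. ?f \<omega> r \<partial>lborel) \<in> borel_measurable P"
    using lborel.borel_measurable_nn_integral[of ?f P] weight_measurable by (simp add: case_prod_beta)
  ultimately have "AE \<omega> in P. (\<integral>\<^sup>+ r. ?f \<omega> r \<partial>lborel) \<noteq> \<infinity>" by (rule nn_integral_PInf_AE[rotated])
  then show ?thesis
  proof (rule AE_mp, intro AE_I2 impI)
    fix \<omega> assume "\<omega> \<in> space P" "(\<integral>\<^sup>+ r. ?f \<omega> r \<partial>lborel) \<noteq> \<infinity>"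
    then show "tame_path \<omega>" by (simp add: tame_path_iff top.not_eq_extremum)
  qed
qed

text \<open>Goes through the explicit formula: on tame paths the driver comes from path evaluations
  and their parameter integral, and on the other continuous paths it vanishes.\<close>

lemma ou_driver_measurable: "(\<lambda>z. ou_driver \<epsilon> (fst z) (snd z)) \<in> borel_measurable (P \<Otimes>\<^sub>M borel)"
proof -
  have [measurable]: "Measurable.pred (P \<Otimes>\<^sub>M (borel :: real measure)) (\<lambda>z. tame_path (fst z))"
    by (rule measurable_compose[OF measurable_fst tame_path_measurable])
  have noise: "noise \<epsilon> \<in> borel_measurable borel"
    by (rule borel_measurable_continuous_onI[OF bounded_linear.continuous_on[OF noise_bounded_linear continuous_on_id]])
  have [measurable]: "(\<lambda>y. fst (fst y) (snd (fst y) + snd y)) \<in> borel_measurable ((P \<Otimes>\<^sub>M (borel :: real measure)) \<Otimes>\<^sub>M lborel)"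
    by (rule path_eval_measurable_compose) measurable
  have [measurable]: "(\<lambda>z. path_average (fst z) (snd z)) \<in> borel_measurable (P \<Otimes>\<^sub>M (borel :: real measure))"
    unfolding path_average_def set_lebesgue_integral_def by measurable
  have [measurable]: "(\<lambda>z. noise \<epsilon> (fst z (snd z) - path_average (fst z) (snd z))) \<in> borel_measurable (P \<Otimes>\<^sub>M (borel :: real measure))"
    by (rule measurable_compose[OF borel_measurable_diff[OF path_eval_measurable] noise]) measurable
  have "(\<lambda>z. if tame_path (fst z) then noise \<epsilon> (fst z (snd z) - path_average (fst z) (snd z)) else 0)
      \<in> borel_measurable (P \<Otimes>\<^sub>M (borel :: real measure))"
    by measurable
  then show ?thesis
  proof (rule measurable_cong[THEN iffD1, rotated])
    fix z assume "z \<in> space (P \<Otimes>\<^sub>M (borel :: real measure))"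
    then have "fst z \<in> wiener_paths" by (auto simp: space_pair_measure space_eq)
    then show "(if tame_path (fst z) then noise \<epsilon> (fst z (snd z) - path_average (fst z) (snd z)) else 0)
        = ou_driver \<epsilon> (fst z) (snd z)"
      by (simp add: ou_driver_eq ou_driver_not_tame)
  qed
qed

lemma ou_process_measurable: "ou_process \<epsilon> \<in> borel_measurable P"
proof -
  have "(\<lambda>\<omega>. ou_driver \<epsilon> \<omega> 0) \<in> borel_measurable P"
    using measurable_compose[OF measurable_Pair[OF measurable_ident measurable_const[where c = 0]] ou_driver_measurable]
    by simp
  then show ?thesis
    by (rule measurable_cong[THEN iffD1, rotated]) (simp add: space_eq ou_driver_def shift_0)
qed

lemma stationary_ou_process: "stationary_ou P \<epsilon> (ou_process \<epsilon>)"
  unfolding stationary_ou_def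
proof (intro conjI ou_process_measurable)
  show "AE \<omega> in P. continuous_on UNIV (\<lambda>t. ou_process \<epsilon> (shift t \<omega>)) \<and>
      (\<forall>s t. s \<le> t \<longrightarrow> ((\<lambda>r. ou_process \<epsilon> (shift r \<omega>)) has_integral
        (noise \<epsilon> (\<omega> t - \<omega> s) - (ou_process \<epsilon> (shift t \<omega>) - ou_process \<epsilon> (shift s \<omega>)))) {s..t})"
    using AE_tame_path
  proof eventually_elim
    case (elim \<omega>)
    then have "\<omega> \<in> wiener_paths" by (simp add: tame_path_def)
    then show ?case
      using ou_driver_continuous[of \<omega> \<epsilon>] ou_driver_has_integral[OF elim, of _ _ \<epsilon>]
      by (simp add: ou_driver_def[abs_def])
  qed
qed

text \<open>The additional shift \<open>s\<close> covers the frame in which \<open>pullback\<close>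
  runs forward from time \<open>- n\<close>.\<close>

lemma ou_flow_measurable:
  "(\<lambda>((\<omega>, x), t). flow (driven_field k \<alpha> (\<lambda>r. ou_driver \<epsilon> \<omega> (s + r))) x t)
     \<in> borel_measurable ((P \<Otimes>\<^sub>M borel) \<Otimes>\<^sub>M borel)"
proof (rule measurable_flow)
  let ?M = "P \<Otimes>\<^sub>M ((borel :: real measure) \<Otimes>\<^sub>M (borel :: 'n rvec measure))"
  have [measurable]: "(\<lambda>z. ou_driver \<epsilon> (fst z) (s + fst (snd z))) \<in> borel_measurable ?M"
    using measurable_compose[OF _ ou_driver_measurable, of "\<lambda>z. (fst z, s + fst (snd z))" ?M] by simp
  have drift: "drift k \<alpha> \<in> borel_measurable borel"
    by (rule borel_measurable_continuous_onI[OF drift_continuous])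
  have [measurable]: "(\<lambda>z. drift k \<alpha> (snd (snd z) + ou_driver \<epsilon> (fst z) (s + fst (snd z)))) \<in> borel_measurable ?M"
    by (rule measurable_compose[OF _ drift]) measurable
  show "(\<lambda>(\<omega>, t, x). driven_field k \<alpha> (\<lambda>r. ou_driver \<epsilon> \<omega> (s + r)) t x) \<in> borel_measurable ?M"
    unfolding driven_field_def case_prod_beta by measurable
  fix \<omega> assume "\<omega> \<in> space P"
  then have "tempered_driver (\<lambda>r. ou_driver \<epsilon> \<omega> (s + r))"
    by (intro tempered_driver_shift ou_driver_tempered) (simp add: space_eq)
  then show "lipschitz_field (driven_field k \<alpha> (\<lambda>r. ou_driver \<epsilon> \<omega> (s + r))) (drift_lipschitz k)"
    by (intro driven_field_lipschitz) (simp add: tempered_driver_def)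
qed

lemma ou_flow_measurable_compose:
  assumes "f \<in> M \<rightarrow>\<^sub>M P" "g \<in> borel_measurable M" "h \<in> borel_measurable M"
  shows "(\<lambda>y. flow (driven_field k \<alpha> (\<lambda>r. ou_driver \<epsilon> (f y) (s + r))) (g y) (h y)) \<in> borel_measurable M"
  using measurable_compose[OF measurable_Pair[OF measurable_Pair[OF assms(1,2)] assms(3)] ou_flow_measurable]
  by simp

lemma slow_manifold_measurable:
  assumes "k \<ge> 8"
  shows "(\<lambda>\<omega>. slow_manifold k \<alpha> (ou_driver \<epsilon> \<omega>) a) \<in> borel_measurable P"
proof (rule borel_measurable_LIMSEQ_metric)
  fix n
  have "(\<lambda>\<omega>. flow (driven_field k \<alpha> (ou_driver \<epsilon> \<omega>)) (a *\<^sub>R ones) (- real n)) \<in> borel_measurable P"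
    using ou_flow_measurable_compose[OF measurable_ident measurable_const measurable_const, where s = 0] by simp
  then have "(\<lambda>\<omega>. flow (driven_field k \<alpha> (ou_driver \<epsilon> \<omega>)) (a *\<^sub>R ones) (- real n) $ first_index) \<in> borel_measurable P"
    by (rule measurable_compose) (rule borel_measurable_continuous_onI, intro continuous_intros)
  then have "(\<lambda>\<omega>. (flow (driven_field k \<alpha> (ou_driver \<epsilon> \<omega>)) (a *\<^sub>R ones) (- real n) $ first_index) *\<^sub>R (ones :: 'n rvec)) \<in> borel_measurable P"
    by measurable
  from ou_flow_measurable_compose[OF measurable_ident this measurable_const, where s = "- real n"]
  show "(\<lambda>\<omega>. pullback k \<alpha> (ou_driver \<epsilon> \<omega>) n a) \<in> borel_measurable P"
    unfolding pullback_def by simp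
next
  fix \<omega> assume "\<omega> \<in> space P"
  then interpret tempered_system k \<alpha> "ou_driver \<epsilon> \<omega>"
    by unfold_locales (use assms in \<open>auto simp: space_eq intro: ou_driver_tempered\<close>)
  show "(\<lambda>n. pullback k \<alpha> (ou_driver \<epsilon> \<omega>) n a) \<longlonglongrightarrow> slow_manifold k \<alpha> (ou_driver \<epsilon> \<omega>) a"
    by (rule pullback_tendsto)
qed

end

section \<open>Dynamical order\<close>

lemma ennreal_tendsto_0_squeeze:
  fixes f :: "real \<Rightarrow> ennreal" and g :: "real \<Rightarrow> real"
  assumes "\<forall>\<^sub>F t in at_top. f t \<le> ennreal (g t)" "(g \<longlongrightarrow> 0) at_top"
  shows "(f \<longlongrightarrow> 0) at_top"
proof (rule tendsto_sandwich[OF _ assms(1) tendsto_const])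
  show "((\<lambda>t. ennreal (g t)) \<longlongrightarrow> 0) at_top" using tendsto_ennrealI[OF assms(2)] by simp
qed simp

lemma exp_neg_tendsto_0: "c > 0 \<Longrightarrow> ((\<lambda>t::real. K * exp (- c * t)) \<longlongrightarrow> 0) at_top"
proof (intro tendsto_mult_right_zero filterlim_compose[OF exp_at_bot])
  assume "c > 0"
  then show "filterlim (\<lambda>t. - c * t) at_bot at_top"
    by (simp add: filterlim_uminus_at_bot filterlim_tendsto_pos_mult_at_top[OF tendsto_const _ filterlim_ident])
qed

lemma norm_deviation_le: "norm (deviation x) \<le> (1 + norm (ones :: ('n::{finite,linorder}) rvec)) * norm (x :: 'n rvec)"
proof -
  have "norm (deviation x) \<le> norm x + \<bar>x $ first_index\<bar> * norm (ones :: 'n rvec)"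
    unfolding deviation_def using norm_triangle_ineq4[of x "(x $ first_index) *\<^sub>R ones"] by simp
  also have "\<dots> \<le> norm x + norm x * norm (ones :: 'n rvec)"
    by (intro add_left_mono mult_right_mono component_le_norm_cart) simp
  finally show ?thesis by (simp add: algebra_simps)
qed

context tempered_system
begin

sublocale curve: periodic_curve G first_index
  by standard (rule slow_manifold_continuous slow_manifold_first slow_manifold_translate)+

text \<open>A representative with first phase in one period has a bounded diagonal part, and the
  rest is its deviation; \<open>x \<le> 1 + x\<^sup>2\<close> turns the bound on the square into one
  linear in \<open>q 0\<close>.\<close>

lemma wrapped_bound:
  assumes q: "tempering \<gamma> \<zeta> q" "\<gamma> \<le> 1" and p: "p \<in> range curve.wrapped"
  shows "dist (wrap 0) p \<le> (1 + 2 * pi * norm (ones :: 'n rvec)) + 2 ^ CARD('n) * C * q 0"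
proof -
  obtain b where b: "b \<in> {0..2 * pi}" "p = wrap (G b)"
    using p curve.wrapped_surjective_bounded unfolding curve.wrapped_def by (metis rangeE)
  have "energy (deviation (G b)) \<le> C * q 0"
    using slow_manifold_deviation[OF q, where t = 0] by simp
  then have "2 ^ CARD('n) * energy (deviation (G b)) \<le> 2 ^ CARD('n) * (C * q 0)" by simp
  then have "(norm (deviation (G b)))\<^sup>2 \<le> 2 ^ CARD('n) * (C * q 0)"
    using norm_le_energy[of "deviation (G b)"] by (rule order_trans[rotated])
  then have d: "norm (deviation (G b)) \<le> 1 + 2 ^ CARD('n) * C * q 0"
    using le_one_plus_square[of "norm (deviation (G b))"] by (simp add: mult.assoc)
  have "G b = deviation (G b) + b *\<^sub>R ones" by (simp add: deviation_def)
  then have "norm (G b) \<le> norm (deviation (G b)) + \<bar>b\<bar> * norm (ones :: 'n rvec)"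
    by (metis norm_scaleR norm_triangle_ineq)
  also have "\<bar>b\<bar> * norm (ones :: 'n rvec) \<le> 2 * pi * norm (ones :: 'n rvec)"
    using b(1) by (intro mult_right_mono) auto
  finally have "norm (G b) \<le> norm (deviation (G b)) + 2 * pi * norm (ones :: 'n rvec)" by simp
  moreover have "dist (wrap 0) p \<le> norm (G b)"
    unfolding b(2) using dist_wrap_le_dist[of 0 "G b"] by (simp add: dist_norm)
  ultimately show ?thesis using d by linarith
qed

end

section \<open>The random dynamical system and its attractor\<close>

context wiener_space
begin

context
  fixes k :: real and \<alpha> \<epsilon> :: "'n rvec"
  assumes k: "k \<ge> 8"
begin

definition ou_rds :: "real \<Rightarrow> 'n rvec \<Rightarrow> 'n path \<Rightarrow> 'n rvec" where
  "ou_rds t x \<omega> = flow (driven_field k \<alpha> (ou_driver \<epsilon> \<omega>)) x t"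

text \<open>Acts through the representative picked by \<open>rep_cyl\<close>; on
  \<open>space P\<close> equivariance makes the choice immaterial.\<close>

definition wrapped_rds :: "real \<Rightarrow> 'n cyl \<Rightarrow> 'n path \<Rightarrow> 'n cyl" where
  "wrapped_rds t p \<omega> = wrap (ou_rds t (rep_cyl p) \<omega>)"

definition attractor :: "'n path \<Rightarrow> 'n cyl set" where
  "attractor \<omega> = wrap ` range (slow_manifold k \<alpha> (ou_driver \<epsilon> \<omega>))"

lemma tempered_system_ou: "\<omega> \<in> space P \<Longrightarrow> tempered_system k (ou_driver \<epsilon> \<omega>)"
  by standard (use k in \<open>auto simp: space_eq intro: ou_driver_tempered\<close>)

lemma shift_in_space: "\<omega> \<in> space P \<Longrightarrow> shift t \<omega> \<in> space P"
  by (simp add: space_eq shift_in_wiener_paths)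

lemma ou_driver_shift_fun: "ou_driver \<epsilon> (shift s \<omega>) = (\<lambda>t. ou_driver \<epsilon> \<omega> (s + t))"
  by (simp add: ou_driver_shift fun_eq_iff)

lemma attractor_eq:
  assumes "\<omega> \<in> space P"
  shows "attractor \<omega> = range (periodic_curve.wrapped (slow_manifold k \<alpha> (ou_driver \<epsilon> \<omega>)))"
proof -
  interpret tempered_system k \<alpha> "ou_driver \<epsilon> \<omega>" by (rule tempered_system_ou[OF assms])
  show ?thesis by (simp add: attractor_def curve.range_wrapped)
qed

lemma C1_rds_ou: "C1_rds P ou_rds"
  unfolding C1_rds_def
proof (intro conjI ballI)
  let ?M = "restrict_space borel {0..} \<Otimes>\<^sub>M ((borel :: 'n rvec measure) \<Otimes>\<^sub>M P)"
  have f: "fst \<in> borel_measurable ?M"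
    by (rule measurable_compose[OF measurable_fst]) (auto intro: measurable_restrict_space1)
  have "(\<lambda>y. flow (driven_field k \<alpha> (\<lambda>r. ou_driver \<epsilon> (snd (snd y)) (0 + r))) (fst (snd y)) (fst y)) \<in> borel_measurable ?M"
    by (rule ou_flow_measurable_compose[OF _ _ f]) measurable
  then show "(\<lambda>(t, x, \<omega>). ou_rds t x \<omega>) \<in> borel_measurable ?M"
    by (simp add: ou_rds_def case_prod_beta)
next
  fix \<omega> assume \<omega>: "\<omega> \<in> space P"
  interpret tempered_system k \<alpha> "ou_driver \<epsilon> \<omega>" by (rule tempered_system_ou[OF \<omega>])
  show "\<forall>x. ou_rds 0 x \<omega> = x" by (simp add: ou_rds_def)
  show "\<forall>s\<ge>0. \<forall>t\<ge>0. \<forall>x. ou_rds (t + s) x \<omega> = ou_rds t (ou_rds s x \<omega>) (shift s \<omega>)"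
    unfolding ou_rds_def ou_driver_shift_fun using flow_shift by (simp add: add.commute)
  show "continuous_on ({0..} \<times> UNIV) (\<lambda>(t, x). ou_rds t x \<omega>)"
    unfolding ou_rds_def by (rule flow_jointly_continuous)
  show "\<exists>J :: real \<Rightarrow> 'n rvec \<Rightarrow> ('n rvec, 'n) vec.
      (\<forall>t\<ge>0. \<forall>x. ((\<lambda>y. ou_rds t y \<omega>) has_derivative (\<lambda>h. J t x *v h)) (at x)) \<and>
      continuous_on ({0..} \<times> UNIV) (\<lambda>(t, x). J t x)"
    unfolding ou_rds_def using flow_has_derivative flow_jacobian_continuous by blast
qed

lemma rde_solution_ou:
  assumes "\<omega> \<in> space P"
  shows "rde_solution k \<alpha> (ou_process \<epsilon>) \<omega> (\<lambda>t. ou_rds t x \<omega>)"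
proof -
  interpret tempered_system k \<alpha> "ou_driver \<epsilon> \<omega>" by (rule tempered_system_ou[OF assms])
  show ?thesis
    unfolding rde_solution_def ou_rds_def
    using has_vector_derivative_at_within[OF flow_has_vector_derivative]
    by (simp add: driven_field_def ou_driver_def)
qed

lemma sde_solution_ou:
  assumes \<omega>: "\<omega> \<in> space P" and t: "tame_path \<omega>"
  shows "sde_solution k \<alpha> \<epsilon> \<omega> (\<lambda>t. ou_rds t x \<omega> + ou_process \<epsilon> (shift t \<omega>))"
proof -
  interpret tempered_system k \<alpha> "ou_driver \<epsilon> \<omega>" by (rule tempered_system_ou[OF \<omega>])
  let ?\<zeta> = "ou_driver \<epsilon> \<omega>"
  have \<omega>0: "\<omega> 0 = 0" using \<omega> by (simp add: space_eq wiener_paths_def)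
  have "continuous_on {0..} (\<lambda>t. \<phi> t x + ?\<zeta> t)"
    by (intro continuous_on_add flow_continuous continuous_on_subset[OF driver_continuous]) simp
  moreover have "((\<lambda>s. drift k \<alpha> (\<phi> s x + ?\<zeta> s)) has_integral
      (\<phi> t x + ?\<zeta> t - (\<phi> 0 x + ?\<zeta> 0) - noise \<epsilon> (\<omega> t))) {0..t}" if "t \<ge> 0" for t
  proof -
    have "((\<lambda>s. driven_field k \<alpha> ?\<zeta> s (\<phi> s x)) has_integral (\<phi> t x - \<phi> 0 x)) {0..t}"
      by (rule fundamental_theorem_of_calculus[OF that])
        (rule has_vector_derivative_at_within[OF flow_has_vector_derivative])
    from has_integral_diff[OF this ou_driver_has_integral[OF t that, of \<epsilon>]]
    show ?thesis by (simp add: driven_field_def \<omega>0 algebra_simps)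
  qed
  ultimately show ?thesis
    unfolding sde_solution_def ou_rds_def by (simp add: ou_driver_def)
qed

lemma ou_rds_translate:
  assumes "\<omega> \<in> space P"
  shows "ou_rds t (x + (2 * pi * of_int m) *\<^sub>R ones) \<omega> = ou_rds t x \<omega> + (2 * pi * of_int m) *\<^sub>R ones"
proof -
  interpret tempered_system k \<alpha> "ou_driver \<epsilon> \<omega>" by (rule tempered_system_ou[OF assms])
  show ?thesis unfolding ou_rds_def by (rule flow_translate)
qed

lemma wrapped_rds_wrap:
  assumes "\<omega> \<in> space P"
  shows "wrapped_rds t (wrap x) \<omega> = wrap (ou_rds t x \<omega>)"
proof -
  have "wrap (rep_cyl (wrap x)) = wrap x" by (metis Quotient_cyl Quotient_abs_rep)
  then have "period_rel x (rep_cyl (wrap x))" by (metis wrap_eq_iff)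
  then obtain m where "rep_cyl (wrap x) = x + (2 * pi * of_int m) *\<^sub>R ones"
    unfolding period_rel_def by blast
  then show ?thesis
    using ou_rds_translate[OF assms, of t x m] unfolding wrapped_rds_def
    by (metis period_rel_def wrap_eq_iff)
qed

text \<open>Distances to a fibre reduce to distances to the unwrapped curve and then to rational
  parameters, where every term is measurable.\<close>

lemma random_set_attractor: "random_set P attractor"
  unfolding random_set_def
proof (intro conjI ballI allI)
  show "attractor \<omega> \<noteq> {}" for \<omega> by (simp add: attractor_def)
  fix p :: "'n cyl"
  obtain y where y: "p = wrap y" by (metis wrap_surj)
  have "(\<lambda>\<omega>. INF a\<in>\<rat>. dist y (slow_manifold k \<alpha> (ou_driver \<epsilon> \<omega>) a)) \<in> borel_measurable P"
    by (rule borel_measurable_cINF_real[OF countable_rat])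
      (intro borel_measurable_dist borel_measurable_const slow_manifold_measurable[OF k])
  then show "(\<lambda>\<omega>. infdist p (attractor \<omega>)) \<in> borel_measurable P"
  proof (rule measurable_cong[THEN iffD1, rotated])
    fix \<omega> assume \<omega>: "\<omega> \<in> space P"
    interpret tempered_system k \<alpha> "ou_driver \<epsilon> \<omega>" by (rule tempered_system_ou[OF \<omega>])
    show "(INF a\<in>\<rat>. dist y (slow_manifold k \<alpha> (ou_driver \<epsilon> \<omega>) a)) = infdist p (attractor \<omega>)"
      unfolding y attractor_eq[OF \<omega>] curve.infdist_wrapped by (rule curve.infdist_rational[symmetric])
  qed
qed

lemma tempered_attractor: "tempered P attractor"
  unfolding tempered_def
proof (intro AE_I2 allI impI)
  fix \<omega> and \<gamma> :: real assume \<omega>: "\<omega> \<in> space P" and \<gamma>: "\<gamma> > 0"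
  interpret tempered_system k \<alpha> "ou_driver \<epsilon> \<omega>" by (rule tempered_system_ou[OF \<omega>])
  \<comment> \<open>\<open>wrapped_bound\<close> asks for \<open>c \<le> 1\<close>; with
    \<open>c \<le> \<gamma> / 2\<close> the growth of \<open>q\<close> consumes at most half of the
    rate \<gamma>.\<close>
  define c where "c = min 1 (\<gamma> / 2)"
  have c: "c > 0" "c \<le> 1" "c \<le> \<gamma> / 2" using \<gamma> by (auto simp: c_def)
  obtain q where q: "tempering c (ou_driver \<epsilon> \<omega>) q" using tempered c(1) by (auto simp: tempered_driver_def)
  have q0: "q t \<ge> 0" for t using q by (simp add: tempering_def)
  let ?a = "1 + 2 * pi * norm (ones :: 'n rvec)" and ?b = "2 ^ CARD('n) * C"
  have ab: "?a \<ge> 0" "?b \<ge> 0" by (simp_all add: forcing_constant_nonneg)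
  show "((\<lambda>t. ennreal (exp (- \<gamma> * t)) * (SUP p\<in>attractor (shift (- t) \<omega>). ennreal (dist (wrap 0) p))) \<longlongrightarrow> 0) at_top"
  proof (rule ennreal_tendsto_0_squeeze)
    show "((\<lambda>t. (?a + ?b * q 0) * exp (- (\<gamma> / 2) * t)) \<longlongrightarrow> 0) at_top"
      using \<gamma> by (intro exp_neg_tendsto_0) simp
    show "\<forall>\<^sub>F t in at_top. ennreal (exp (- \<gamma> * t)) * (SUP p\<in>attractor (shift (- t) \<omega>). ennreal (dist (wrap 0) p))
        \<le> ennreal ((?a + ?b * q 0) * exp (- (\<gamma> / 2) * t))"
      using eventually_ge_at_top[of 0]
    proof eventually_elim
      case (elim t)
      have \<omega>t: "shift (- t) \<omega> \<in> space P" by (rule shift_in_space[OF \<omega>])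
      interpret sh: tempered_system k \<alpha> "ou_driver \<epsilon> (shift (- t) \<omega>)" by (rule tempered_system_ou[OF \<omega>t])
      have qt: "tempering c (ou_driver \<epsilon> (shift (- t) \<omega>)) (\<lambda>r. q (- t + r))"
        unfolding ou_driver_shift_fun by (rule tempering_shift[OF q])
      have "(SUP p\<in>attractor (shift (- t) \<omega>). ennreal (dist (wrap 0) p)) \<le> ennreal (?a + ?b * q (- t))"
        using sh.wrapped_bound[OF qt c(2)]
        by (intro SUP_least ennreal_leI) (simp add: attractor_eq[OF \<omega>t])
      then have "ennreal (exp (- \<gamma> * t)) * (SUP p\<in>attractor (shift (- t) \<omega>). ennreal (dist (wrap 0) p))
          \<le> ennreal (exp (- \<gamma> * t)) * ennreal (?a + ?b * q (- t))"
        by (rule mult_left_mono) simp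
      also have "\<dots> = ennreal (exp (- \<gamma> * t) * (?a + ?b * q (- t)))"
        using ab q0 by (intro ennreal_mult[symmetric]) auto
      also have "\<dots> \<le> ennreal ((?a + ?b * q 0) * exp (- (\<gamma> / 2) * t))"
      proof (rule ennreal_leI)
        have e: "1 \<le> exp (\<gamma> / 2 * t)" using elim \<gamma> by simp
        have "q (- t) \<le> exp (c * t) * q 0" using tempering_growth[OF q, of "- t"] elim by simp
        also have "\<dots> \<le> exp (\<gamma> / 2 * t) * q 0"
        proof (rule mult_right_mono[OF _ q0])
          have "c * t \<le> \<gamma> / 2 * t" using c(3) elim by (rule mult_right_mono)
          then show "exp (c * t) \<le> exp (\<gamma> / 2 * t)" by simp
        qed
        finally have "?b * q (- t) \<le> ?b * (exp (\<gamma> / 2 * t) * q 0)" using ab(2) by (rule mult_left_mono)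
        moreover have "?a * 1 \<le> ?a * exp (\<gamma> / 2 * t)" using e ab(1) by (rule mult_left_mono)
        ultimately have "?a + ?b * q (- t) \<le> (?a + ?b * q 0) * exp (\<gamma> / 2 * t)"
          by (simp add: algebra_simps)
        then have "exp (- \<gamma> * t) * (?a + ?b * q (- t)) \<le> exp (- \<gamma> * t) * ((?a + ?b * q 0) * exp (\<gamma> / 2 * t))"
          by (rule mult_left_mono) simp
        also have "\<dots> = (?a + ?b * q 0) * (exp (- \<gamma> * t) * exp (\<gamma> / 2 * t))" by (simp only: mult_ac)
        also have "exp (- \<gamma> * t) * exp (\<gamma> / 2 * t) = exp (- (\<gamma> / 2) * t)"
          unfolding exp_add[symmetric] by (simp add: field_simps)
        finally show "exp (- \<gamma> * t) * (?a + ?b * q (- t)) \<le> (?a + ?b * q 0) * exp (- (\<gamma> / 2) * t)" .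
      qed
      finally show ?case .
    qed
  qed
qed

lemma attractor_invariant:
  assumes \<omega>: "\<omega> \<in> space P"
  shows "(\<lambda>p. wrapped_rds t p \<omega>) ` attractor \<omega> = attractor (shift t \<omega>)"
proof -
  interpret tempered_system k \<alpha> "ou_driver \<epsilon> \<omega>" by (rule tempered_system_ou[OF \<omega>])
  have "(\<lambda>p. wrapped_rds t p \<omega>) ` attractor \<omega> = wrap ` (\<phi> t ` range G)"
    unfolding attractor_def image_image wrapped_rds_wrap[OF \<omega>] ou_rds_def ..
  then show ?thesis
    unfolding slow_manifold_invariant_range by (simp add: attractor_def ou_driver_shift_fun)
qed

text \<open>At rate 1/4 the points of the tempered set at time \<open>- t\<close> eventually have
  representatives of norm at most \<open>exp (t / 4)\<close>. Their deviation energy is of order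
  \<open>exp (t / 2)\<close>, contraction gains \<open>exp (- t)\<close>, and the square root leaves
  \<open>exp (- t / 4)\<close>.\<close>

lemma attractor_attracts:
  assumes \<omega>: "\<omega> \<in> space P"
    and D: "((\<lambda>t. ennreal (exp (- (1 / 4) * t)) * (SUP p\<in>D (shift (- t) \<omega>). ennreal (dist (wrap 0) p))) \<longlongrightarrow> 0) at_top"
  shows "((\<lambda>t. hausdorff_semidist ((\<lambda>p. wrapped_rds t p (shift (- t) \<omega>)) ` D (shift (- t) \<omega>)) (attractor \<omega>)) \<longlongrightarrow> 0) at_top"
proof -
  interpret tempered_system k \<alpha> "ou_driver \<epsilon> \<omega>" by (rule tempered_system_ou[OF \<omega>])
  obtain q where q: "tempering (1 / 4) (ou_driver \<epsilon> \<omega>) q"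
    using tempered by (auto simp: tempered_driver_def dest: spec[of _ "1 / 4"])
  have q0: "q t \<ge> 0" for t using q by (simp add: tempering_def)
  define b where "b = (1 + norm (ones :: 'n rvec))\<^sup>2"
  define K where "K = 2 ^ CARD('n) * (2 * b + 2 * (C * q 0))"
  have K: "K \<ge> 0" using q0 by (simp add: K_def b_def forcing_constant_nonneg)
  have "\<forall>\<^sub>F t in at_top. ennreal (exp (- (1 / 4) * t)) * (SUP p\<in>D (shift (- t) \<omega>). ennreal (dist (wrap 0) p)) < 1"
    by (rule order_tendstoD(2)[OF D]) simp
  then have "\<forall>\<^sub>F t in at_top. hausdorff_semidist ((\<lambda>p. wrapped_rds t p (shift (- t) \<omega>)) ` D (shift (- t) \<omega>)) (attractor \<omega>)
      \<le> ennreal (sqrt K * exp (- (1 / 4) * t))"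
    using eventually_ge_at_top[of 0]
  proof eventually_elim
    case (elim t)
    have \<omega>t: "shift (- t) \<omega> \<in> space P" by (rule shift_in_space[OF \<omega>])
    interpret sh: tempered_system k \<alpha> "ou_driver \<epsilon> (shift (- t) \<omega>)" by (rule tempered_system_ou[OF \<omega>t])
    have qt: "tempering (1 / 4) (ou_driver \<epsilon> (shift (- t) \<omega>)) (\<lambda>r. q (- t + r))"
      unfolding ou_driver_shift_fun by (rule tempering_shift[OF q])
    have driver_back: "(\<lambda>r. ou_driver \<epsilon> (shift (- t) \<omega>) (t + r)) = ou_driver \<epsilon> \<omega>"
      by (simp add: ou_driver_shift fun_eq_iff)
    have "infdist (wrapped_rds t p (shift (- t) \<omega>)) (attractor \<omega>) \<le> sqrt K * exp (- (1 / 4) * t)"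
      if p: "p \<in> D (shift (- t) \<omega>)" for p
    proof -
      have "ennreal (exp (- (1 / 4) * t)) * ennreal (dist (wrap 0) p)
          \<le> ennreal (exp (- (1 / 4) * t)) * (SUP p\<in>D (shift (- t) \<omega>). ennreal (dist (wrap 0) p))"
        by (intro mult_left_mono SUP_upper p) simp
      also have "\<dots> < 1" by (rule elim(1))
      finally have "ennreal (exp (- (1 / 4) * t) * dist (wrap 0) p) < ennreal 1"
        by (subst ennreal_mult) (simp_all only: exp_ge_zero zero_le_dist ennreal_1)
      then have "exp (- (1 / 4) * t) * dist (wrap 0) p < 1" by (subst (asm) ennreal_less_iff) auto
      then have "exp (t / 4) * (exp (- (1 / 4) * t) * dist (wrap 0) p) < exp (t / 4) * 1"
        by (rule mult_strict_left_mono) simp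
      moreover have "exp (t / 4) * exp (- (1 / 4) * t) = 1" unfolding exp_add[symmetric] by simp
      ultimately have d: "dist (wrap 0) p < exp (t / 4)" by (simp only: mult.assoc[symmetric] mult_1 mult_1_right)
      obtain y where y: "p = wrap y" by (metis wrap_surj)
      obtain m :: int where m: "norm (0 - y + (2 * pi * of_int m) *\<^sub>R ones) < exp (t / 4)"
        using dist_wrap_ex[OF d[unfolded y]] ..
      \<comment> \<open>The representative of \<open>p\<close> that is itself shorter than
        \<open>exp (t / 4)\<close>.\<close>
      define x where "x = y + (2 * pi * of_int (- m)) *\<^sub>R ones"
      have px: "p = wrap x" unfolding y x_def wrap_eq_iff period_rel_def by blast
      have "norm x = norm (- x)" by simp
      also have "- x = 0 - y + (2 * pi * of_int m) *\<^sub>R ones" by (simp add: x_def)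
      finally have nx: "norm x \<le> exp (t / 4)" using m by simp
      obtain a where a: "(norm (sh.\<phi> t x - G a))\<^sup>2
          \<le> 2 ^ CARD('n) * exp (- t) * (2 * energy (deviation x) + 2 * (C * q (- t + 0)))"
        using sh.slow_manifold_attracts[OF qt _ elim(2), of x] unfolding driver_back by auto
      have "energy (deviation x) \<le> (norm (deviation x))\<^sup>2" by (rule energy_le_norm)
      also have "\<dots> \<le> ((1 + norm (ones :: 'n rvec)) * exp (t / 4))\<^sup>2"
        by (intro power_mono order_trans[OF norm_deviation_le] mult_left_mono nx) auto
      also have "\<dots> = b * exp (t / 2)" by (simp add: b_def power_mult_distrib exp_double[symmetric])
      finally have e: "energy (deviation x) \<le> b * exp (t / 2)" .
      have "q (- t) \<le> exp (t / 4) * q 0" using tempering_growth[OF q, of "- t"] elim(2) by simp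
      also have "\<dots> \<le> exp (t / 2) * q 0" using elim(2) q0 by (intro mult_right_mono) auto
      finally have "C * q (- t) \<le> C * (exp (t / 2) * q 0)" by (rule mult_left_mono) (rule forcing_constant_nonneg)
      with e have "2 * energy (deviation x) + 2 * (C * q (- t + 0)) \<le> (2 * b + 2 * (C * q 0)) * exp (t / 2)"
        by (simp add: algebra_simps)
      then have "2 ^ CARD('n) * exp (- t) * (2 * energy (deviation x) + 2 * (C * q (- t + 0)))
          \<le> 2 ^ CARD('n) * exp (- t) * ((2 * b + 2 * (C * q 0)) * exp (t / 2))"
        by (rule mult_left_mono) simp
      also have "\<dots> = K * (exp (- t) * exp (t / 2))" unfolding K_def by (simp only: mult_ac)
      also have "exp (- t) * exp (t / 2) = (exp (- (1 / 4) * t))\<^sup>2"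
        by (simp flip: exp_add exp_double)
      also have "K * (exp (- (1 / 4) * t))\<^sup>2 = (sqrt K * exp (- (1 / 4) * t))\<^sup>2"
        using K by (simp only: power_mult_distrib real_sqrt_pow2)
      finally have "(norm (sh.\<phi> t x - G a))\<^sup>2 \<le> (sqrt K * exp (- (1 / 4) * t))\<^sup>2"
        by (rule order_trans[OF a])
      then have "norm (sh.\<phi> t x - G a) \<le> sqrt K * exp (- (1 / 4) * t)"
        by (rule power2_le_imp_le) (use K in simp)
      moreover have "infdist (wrapped_rds t p (shift (- t) \<omega>)) (attractor \<omega>) \<le> dist (wrap (sh.\<phi> t x)) (wrap (G a))"
        unfolding px wrapped_rds_wrap[OF \<omega>t] ou_rds_def attractor_def by (rule infdist_le) simp
      ultimately show ?thesis using dist_wrap_le_dist[of "sh.\<phi> t x" "G a"] by (simp add: dist_norm)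
    qed
    then show ?case unfolding hausdorff_semidist_def image_image
      by (intro SUP_least ennreal_leI) blast
  qed
  then show ?thesis by (rule ennreal_tendsto_0_squeeze) (rule exp_neg_tendsto_0, simp)
qed

lemma global_random_attractor_ou: "global_random_attractor P wrapped_rds attractor"
  unfolding global_random_attractor_def
proof (intro conjI allI impI ballI random_set_attractor tempered_attractor)
  fix \<omega> assume \<omega>: "\<omega> \<in> space P"
  interpret tempered_system k \<alpha> "ou_driver \<epsilon> \<omega>" by (rule tempered_system_ou[OF \<omega>])
  show "compact (attractor \<omega>)" unfolding attractor_eq[OF \<omega>] by (rule curve.compact_range_wrapped)
next
  show "AE \<omega> in P. \<forall>t\<ge>0. (\<lambda>p. wrapped_rds t p \<omega>) ` attractor \<omega> = attractor (shift t \<omega>)"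
    using attractor_invariant by (intro AE_I2) simp
next
  fix D assume "tempered P D"
  then show "AE \<omega> in P. ((\<lambda>t. hausdorff_semidist ((\<lambda>p. wrapped_rds t p (shift (- t) \<omega>)) ` D (shift (- t) \<omega>)) (attractor \<omega>)) \<longlongrightarrow> 0) at_top"
    unfolding tempered_def using AE_space
  proof eventually_elim
    case (elim \<omega>)
    show ?case by (rule attractor_attracts[OF elim(2)]) (rule elim(1)[rule_format], simp)
  qed
qed

lemma admits_dynamical_order_ou: "admits_dynamical_order P k \<alpha> \<epsilon>"
  unfolding admits_dynamical_order_def
proof (intro exI conjI)
  show "stationary_ou P \<epsilon> (ou_process \<epsilon>)" by (rule stationary_ou_process)
  show "C1_rds P ou_rds" by (rule C1_rds_ou)
  show "AE \<omega> in P. \<forall>x. rde_solution k \<alpha> (ou_process \<epsilon>) \<omega> (\<lambda>t. ou_rds t x \<omega>) \<and>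
      sde_solution k \<alpha> \<epsilon> \<omega> (\<lambda>t. ou_rds t x \<omega> + ou_process \<epsilon> (shift t \<omega>))"
    using AE_tame_path AE_space
    by eventually_elim (simp add: rde_solution_ou sde_solution_ou)
  show "\<forall>\<omega>\<in>space P. \<forall>t\<ge>0. \<forall>x. ou_rds t (x + (2 * pi) *\<^sub>R ones) \<omega> = ou_rds t x \<omega> + (2 * pi) *\<^sub>R ones \<and>
      wrapped_rds t (wrap x) \<omega> = wrap (ou_rds t x \<omega>)"
    using ou_rds_translate[where m = 1] wrapped_rds_wrap by simp
  show "global_random_attractor P wrapped_rds attractor" by (rule global_random_attractor_ou)
  show "\<forall>\<omega>\<in>space P. one_dim_manifold (attractor \<omega>) \<and> totally_ordered (wrap -` attractor \<omega>)"
  proof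
    fix \<omega> assume \<omega>: "\<omega> \<in> space P"
    interpret tempered_system k \<alpha> "ou_driver \<epsilon> \<omega>" by (rule tempered_system_ou[OF \<omega>])
    show "one_dim_manifold (attractor \<omega>) \<and> totally_ordered (wrap -` attractor \<omega>)"
      unfolding attractor_eq[OF \<omega>]
      by (intro conjI curve.one_dim_manifold_wrapped curve.totally_ordered_wrapped slow_manifold_mono)
  qed
qed

end

end

theorem corollary3p1:
  fixes P :: "('n::{finite,linorder}) path measure"
    and \<alpha> \<epsilon> :: "'n rvec"
  assumes "CARD('n) \<ge> 2"
    and "wiener_measure P"
    and "\<forall>i. \<epsilon> $ i > 0"
  shows "\<exists>K>0. \<forall>k\<ge>K. admits_dynamical_order P k \<alpha> \<epsilon>"
proof (intro exI[of _ 8] conjI allI impI)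
  fix k :: real assume "k \<ge> 8"
  interpret wiener_space P by standard (rule assms(2))
  show "admits_dynamical_order P k \<alpha> \<epsilon>" by (rule admits_dynamical_order_ou) fact
qed simp

end
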